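(* Fix an integer $n\ge 1$ and a real number $0<\sigma<\frac14$. There exist a constant $E_0$ and a constant $C_\sigma$ such that the following holds for every integer $m\ge1$ for which $E:=2m+n\ge E_0$: for every $j\in J_n$ and every $k$ with $|k|\le \sigma E$ (where $k$ ranges over $\mathbb{Z}$ if $m$ is odd and over $\mathbb{Z}+\frac12$ if $m$ is even), the generalised Hermite polynomial $H_{m,n}(z)$ has one and only one zero in the disc $$\left|z-E^{\frac12}\alpha_{j,k}\right|\le C_\sigma E^{-\frac56}.$$
   Context: Generalised Hermite polynomials $H_{m,n}(z)$, $m,n\in\mathbb{N}=\{0,1,2,\dots\}$, are defined recursively by $$2mH_{m+1,n}H_{m-1,n}=H_{m,n}H_{m,n}''-(H_{m,n}')^2+2mH_{m,n}^2,$$ $$2nH_{m,n+1}H_{m,n-1}=-H_{m,n}H_{m,n}''+(H_{m,n}')^2+2nH_{m,n}^2,$$ with $H_{0,0}=H_{1,0}=H_{0,1}=1$ and $H_{1,1}=2z$. Set $J_n=\{-n+1,-n+3,\dots,n-3,n-1\}$ and $E=2m+n$. Define $$f:[-1,1]\to[-\tfrac{\pi}{4},\tfrac{\pi}{4}],\qquad f(x)=\tfrac12\left(x(1-x^2)^{\frac12}-\cos^{-1}(x)\right)+\tfrac{\pi}{4},$$ which is strictly monotone and invertible, and, for $j\in J_n$, $$g_{j,E}:(-1,1)\to\mathbb{R},\qquad g_{j,E}(x)=\frac{2j\log\left(2E^{\frac12}(1-x^2)^{\frac34}\right)-\log F_{n,j}}{2E(1-x^2)^{\frac12}},\qquad F_{n,j}=\frac{\Gamma\left[\frac12(1+n+j)\right]}{\Gamma\left[\frac12(1+n-j)\right]}.$$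 For $j\in J_n$ and admissible $k$ (integer if $m$ is odd, half-integer, i.e. in $\mathbb{Z}+\frac12$, if $m$ is even; $|k|<\frac E4$), $\alpha_{j,k}=\alpha_R+i\alpha_I$ with $\alpha_R,\alpha_I\in\mathbb{R}$ is the unique complex number with $$f(\alpha_R)=\frac{\pi k}{E},\quad \alpha_R\in(-1,1),\qquad \alpha_I=g_{j,E}(\alpha_R).$$ *)

theory Defs
  imports "HOL-Analysis.Analysis" "HOL-Computational_Algebra.Polynomial"
begin

text \<open>
  The recursion determines the family uniquely: at \<open>m = 0\<close> the second relation gives
  \<open>H 0 n = 1\<close>, the first one gives \<open>H m 0 = 1\<close> and \<open>H m 1\<close>, and the second one then gives all
  \<open>H m n\<close>. The relations at index \<open>0\<close> in the shifted direction would involve an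
  index \<open>-1\<close> with coefficient \<open>0\<close>; they carry no recursive content and are excluded by the guards.
\<close>

definition generalised_hermite :: "(nat \<Rightarrow> nat \<Rightarrow> complex poly) \<Rightarrow> bool" where
  "generalised_hermite H \<longleftrightarrow>
     H 0 0 = 1 \<and> H 1 0 = 1 \<and> H 0 1 = 1 \<and> H 1 1 = [:0, 2:] \<and>
     (\<forall>m n. m \<ge> 1 \<longrightarrow>
        of_nat (2 * m) * H (m + 1) n * H (m - 1) n =
          H m n * pderiv (pderiv (H m n)) - (pderiv (H m n))\<^sup>2 + of_nat (2 * m) * (H m n)\<^sup>2) \<and>
     (\<forall>m n. n \<ge> 1 \<longrightarrow>
        of_nat (2 * n) * H m (n + 1) * H m (n - 1) =
          - (H m n * pderiv (pderiv (H m n))) + (pderiv (H m n))\<^sup>2 + of_nat (2 * n) * (H m n)\<^sup>2)"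

definition J :: "nat \<Rightarrow> int set" where
  "J n = (\<lambda>i. 2 * int i - int n + 1) ` {..<n}"

definition f :: "real \<Rightarrow> real" where
  "f x = 1/2 * (x * sqrt (1 - x\<^sup>2) - arccos x) + pi / 4"

definition F :: "nat \<Rightarrow> int \<Rightarrow> real" where
  "F n j = Gamma ((1 + real n + of_int j) / 2) / Gamma ((1 + real n - of_int j) / 2)"

definition g :: "nat \<Rightarrow> int \<Rightarrow> real \<Rightarrow> real \<Rightarrow> real" where
  "g n j E x =
     (2 * of_int j * ln (2 * sqrt E * (1 - x\<^sup>2) powr (3/4)) - ln (F n j)) / (2 * E * sqrt (1 - x\<^sup>2))"

text \<open>The integers if \<open>m\<close> is odd, the half-integers if \<open>m\<close> is even.\<close>

definition K :: "nat \<Rightarrow> real set" where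
  "K m = (if odd m then \<int> else {k. k - 1/2 \<in> \<int>})"

definition alpha :: "nat \<Rightarrow> real \<Rightarrow> int \<Rightarrow> real \<Rightarrow> complex" where
  "alpha n E j k =
     (THE a. f (Re a) = pi * k / E \<and> Re a \<in> {-1<..<1} \<and> Im a = g n j E (Re a))"

end

theory Submission
  imports Defs "HOL-Complex_Analysis.Complex_Analysis" "HOL-Probability.Probability"
    "HOL-Real_Asymp.Real_Asymp" "Jordan_Normal_Form.Determinant"
begin

text \<open>
For fixed \<open>n\<close> the polynomial \<open>H m n\<close> is, up to a nonzero constant, the Hankel determinant
\<open>det (h\<^bsub>m+i+j\<^esub>)\<close> of size \<open>n\<close> formed from the Hermite polynomials \<open>h\<^sub>k\<close>: the recursion in \<open>n\<close> is a
Toda equation, and the Desnanot-Jacobi identity shows that Hankel determinants of successive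
derivatives solve it (\<open>generalised_hermite_hankel\<close>). By Cauchy's formula each entry is an integral
over the circle of radius \<open>\<surd>E / 2\<close>. The determinant is therefore a nonzero constant times the
moment determinant of a linear functional \<open>\<Lambda>\<^sub>z\<close> on polynomials, and hence becomes, after any
change of basis, the Gram determinant \<open>det (\<Lambda>\<^sub>z (\<phi>\<^sub>i \<phi>\<^sub>j))\<close> of any \<open>n\<close> polynomials of degree less than
\<open>n\<close>, times a factor that does not depend on \<open>z\<close> (\<open>generalised_hermite_gram\<close>).

This freedom of basis is what makes the asymptotics elementary. Write \<open>z = \<surd>E \<zeta>\<close> with \<open>\<zeta>\<close> close to
\<open>cos \<theta>\<close>, \<open>\<theta>\<close> real. The saddle points of the integrand are close to \<open>u = e\<^bsup>\<plusminus>i\<theta>\<^esup>\<close> on the unit circle, and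
for \<open>\<zeta> = cos \<theta>\<close> its modulus on the circle is maximal exactly there, so the circle needs no
deformation. Near each of the two points the weight is a complex Gaussian of width \<open>E\<^bsup>-1/2\<^esup>\<close>. For
\<open>j = b - a\<close> and \<open>n = a + b + 1\<close> the basis consists of \<open>a\<close> polynomials concentrated at the upper
saddle point (a Hermite polynomial of the local variable times the \<open>b\<close>-th power of a factor
vanishing at the lower one), \<open>b\<close> polynomials concentrated at the lower saddle point, and one
polynomial with the degree \<open>a\<close> Hermite polynomial at the upper and the degree \<open>b\<close> one at the lower
saddle point. Local orthogonality makes the Gram matrix, after division by the upper saddle
contribution, diagonal up to a small error (\<open>gram_circle_functional\<close>). All diagonal entries stay
away from \<open>0\<close> except the last, which is the sum of contributions of the two saddle points. Their
ratio is computed in \<open>leading_ratio\<close>: the condition \<open>f (cos \<theta>) = \<pi> k / E\<close>, with \<open>k\<close> of the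
right parity class, makes the two opposite in phase and the definition of \<open>g\<close> makes them equal in modulus, so that the last entry is a
nonvanishing constant times \<open>1 - exp (- 2 \<i> sin \<theta> \<surd>E (z - Z))\<close> with \<open>Z = \<surd>E \<alpha>\<^bsub>j,k\<^esub>\<close>, up to the error.

On the circle \<open>\<bar>z - Z\<bar> = E\<^bsup>-5/6\<^esup>\<close> this main term has size \<open>E\<^bsup>-1/3\<^esup>\<close>. Since \<open>E \<bar>Im \<alpha>\<^bsub>j,k\<^esub>\<bar>\<close> is only
\<open>O (log E)\<close>, hence eventually less than \<open>E\<^bsup>1/12\<^esup>\<close>, the error is of order \<open>E\<^bsup>1/12 - 1/2\<^esup> = E\<^bsup>-5/12\<^esup>\<close>, which is smaller.
Rouche's theorem gives exactly one zero (\<open>one_zero_in_disc\<close>), with \<open>C\<^sub>\<sigma> = 1\<close>. The hypothesis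
\<open>\<sigma> < 1/4\<close> keeps \<open>\<theta>\<close> away from \<open>0\<close> and \<open>\<pi>\<close>, where the two saddle points would merge.
\<close>

section \<open>Hermite polynomials and the recursion\<close>

fun hermite_poly :: "nat \<Rightarrow> complex poly" where
  "hermite_poly 0 = 1"
| "hermite_poly (Suc k) = [:0, 2:] * hermite_poly k - pderiv (hermite_poly k)"

lemma pderiv_hermite_poly:
  "pderiv (hermite_poly (Suc k)) = of_nat (2 * Suc k) * hermite_poly k"
proof (induction k)
  case 0
  show ?case by (simp add: pderiv_pCons numeral_poly)
next
  case (Suc k)
  have two: "[:2:] = (2 :: complex poly)" by (simp add: numeral_poly)
  have "pderiv (hermite_poly (Suc (Suc k))) =
      2 * hermite_poly (Suc k) + [:0, 2:] * pderiv (hermite_poly (Suc k))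
      - pderiv (pderiv (hermite_poly (Suc k)))"
    by (subst hermite_poly.simps(2), simp only: pderiv_diff pderiv_mult)
       (simp add: pderiv_pCons two algebra_simps del: hermite_poly.simps)
  also have "pderiv (pderiv (hermite_poly (Suc k))) = of_nat (2 * Suc k) * pderiv (hermite_poly k)"
    by (simp only: Suc.IH) (simp only: pderiv_mult pderiv_of_nat, simp)
  also have "[:0, 2:] * pderiv (hermite_poly (Suc k)) = of_nat (2 * Suc k) * ([:0, 2:] * hermite_poly k)"
    by (simp only: Suc.IH) (simp add: algebra_simps)
  finally show ?case by (simp add: algebra_simps)
qed

lemma hermite_poly_recursion:
  "hermite_poly (Suc (Suc k)) =
     [:0, 2:] * hermite_poly (Suc k) - of_nat (2 * Suc k) * hermite_poly k"
  by (subst hermite_poly.simps(2)) (simp only: pderiv_hermite_poly)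

lemma hermite_poly_degree_lead_coeff:
  "degree (hermite_poly k) = k \<and> lead_coeff (hermite_poly k) = 2 ^ k"
proof (induction k)
  case (Suc k)
  have d: "degree ([:0, 2:] * hermite_poly k) = Suc k"
    using Suc by (subst degree_mult_eq) auto
  have "degree (pderiv (hermite_poly k)) < Suc k"
    using Suc by (simp add: degree_pderiv)
  then have "degree (- pderiv (hermite_poly k)) < degree ([:0, 2:] * hermite_poly k)"
    using d by simp
  from degree_add_eq_left[OF this] lead_coeff_add_le[OF this]
  have "degree (hermite_poly (Suc k)) = degree ([:0, 2:] * hermite_poly k)"
    "lead_coeff (hermite_poly (Suc k)) = lead_coeff ([:0, 2:] * hermite_poly k)"
    by (simp_all add: add.commute)
  moreover have "lead_coeff ([:0, 2:] * hermite_poly k) = 2 * 2 ^ k"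
    using Suc by (simp only: lead_coeff_mult) (metis degree_pCons_eq_if lead_coeff_pCons(1,2) pCons_0_0 zero_neq_numeral)
  ultimately show ?case using d by simp
qed simp

lemma hermite_poly_nonzero: "hermite_poly k \<noteq> 0"
  by (metis hermite_poly_degree_lead_coeff leading_coeff_0_iff power_not_zero zero_neq_numeral)

lemma generalised_hermite_zero:
  assumes "generalised_hermite H"
  shows "H m 0 = 1"
proof (induction m rule: less_induct)
  case (less m)
  consider "m = 0" | "m = 1" | k where "m = Suc (Suc k)"
    by (metis One_nat_def not0_implies_Suc)
  then show ?case
  proof cases
    case (3 k)
    have "of_nat (2 * Suc k) * H (Suc k + 1) 0 * H (Suc k - 1) 0 =
        H (Suc k) 0 * pderiv (pderiv (H (Suc k) 0)) - (pderiv (H (Suc k) 0))\<^sup>2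
        + of_nat (2 * Suc k) * (H (Suc k) 0)\<^sup>2"
      using assms unfolding generalised_hermite_def by (metis le_add1 plus_1_eq_Suc)
    moreover have "H k 0 = 1" "H (Suc k) 0 = 1" using less 3 by auto
    ultimately have "of_nat (2 * Suc k) * H m 0 = of_nat (2 * Suc k) * 1"
      using 3 by (simp add: pderiv_1 del: of_nat_mult)
    moreover have "of_nat (2 * Suc k) \<noteq> (0 :: complex poly)"
      by (metis mult_is_0 nat.simps(3) of_nat_eq_0_iff zero_neq_numeral)
    ultimately show ?thesis by (metis mult_left_cancel)
  qed (use assms in \<open>auto simp: generalised_hermite_def\<close>)
qed

text \<open>The recursion in \<open>m\<close> at \<open>n = 1\<close> is the quadratic identity that Hermite's differential equation and
  the three-term recursion give for Hermite polynomials; dividing by the nonzero \<open>H (m - 1) 1\<close>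
  determines the next one.\<close>
lemma generalised_hermite_one:
  assumes "generalised_hermite H"
  shows "H m 1 = hermite_poly m"
proof (induction m rule: less_induct)
  case (less m)
  consider "m = 0" | "m = 1" | k where "m = Suc (Suc k)"
    by (metis One_nat_def not0_implies_Suc)
  then show ?case
  proof cases
    case (3 k)
    define h where "h = hermite_poly"
    define N where "N = (of_nat (2 * Suc k) :: complex poly)"
    have N0: "N \<noteq> 0"
      unfolding N_def by (metis mult_is_0 nat.simps(3) of_nat_eq_0_iff zero_neq_numeral)
    have "N * H (Suc k + 1) 1 * H (Suc k - 1) 1 =
        H (Suc k) 1 * pderiv (pderiv (H (Suc k) 1)) - (pderiv (H (Suc k) 1))\<^sup>2
        + N * (H (Suc k) 1)\<^sup>2"
      using assms unfolding generalised_hermite_def N_def by (metis le_add1 plus_1_eq_Suc)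
    moreover have "H k 1 = h k" "H (Suc k) 1 = h (Suc k)"
      using less 3 unfolding h_def by auto
    moreover have d1: "pderiv (h (Suc k)) = N * h k"
      unfolding h_def N_def by (rule pderiv_hermite_poly)
    moreover have "pderiv (N * h k) = N * ([:0, 2:] * h k - h (Suc k))"
      unfolding h_def N_def by (simp only: pderiv_mult pderiv_of_nat hermite_poly.simps) simp
    ultimately have e: "N * H m 1 * h k =
        h (Suc k) * (N * ([:0, 2:] * h k - h (Suc k))) - (N * h k)\<^sup>2 + N * (h (Suc k))\<^sup>2"
      using 3 by simp
    have "h m = [:0, 2:] * h (Suc k) - N * h k"
      unfolding h_def N_def 3 by (rule hermite_poly_recursion)
    then have "N * h k * h m = N * H m 1 * h k"
      unfolding e by (simp only: power2_eq_square ring_distribs) (simp add: algebra_simps)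
    moreover have "h k \<noteq> 0" unfolding h_def by (rule hermite_poly_nonzero)
    ultimately show ?thesis using N0 unfolding h_def by simp
  qed (use assms in \<open>auto simp: generalised_hermite_def\<close>)
qed

text \<open>In the recursion in \<open>n\<close> the derivative terms have lower degree than \<open>2 n H\<^bsub>m,n\<^esub>\<^sup>2\<close>, so the right hand side
  has a nonzero leading coefficient. This allows division by \<open>H m n\<close> later on.\<close>
lemma generalised_hermite_nonzero:
  assumes "generalised_hermite H"
  shows "H m n \<noteq> 0"
proof (induction n rule: less_induct)
  case (less n)
  consider "n = 0" | "n = 1" | k where "n = Suc (Suc k)"
    by (metis One_nat_def not0_implies_Suc)
  then show ?case
  proof cases
    case 1
    then show ?thesis using generalised_hermite_zero[OF assms] by simp
  next
    case 2
    then show ?thesis using generalised_hermite_one[OF assms] hermite_poly_nonzero by simp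
  next
    case (3 k)
    define P where "P = H m (Suc k)"
    define d where "d = degree P"
    have P0: "P \<noteq> 0" using less 3 by (simp add: P_def)
    have e: "of_nat (2 * Suc k) * H m (Suc k + 1) * H m (Suc k - 1) =
        - (P * pderiv (pderiv P)) + (pderiv P)\<^sup>2 + of_nat (2 * Suc k) * P\<^sup>2"
      using assms unfolding generalised_hermite_def P_def by (metis le_add1 plus_1_eq_Suc)
    \<comment> \<open>Only the two coefficients of degree \<open>d\<close> meet in degree \<open>2 d\<close>.\<close>
    have c: "coeff (p * q) (2 * d) = coeff p d * coeff q d"
      if "degree p \<le> d" "degree q \<le> d" for p q :: "complex poly"
    proof -
      have "coeff p i * coeff q (2 * d - i) = 0" if "i \<in> {..2 * d} - {d}" for i
        using that \<open>degree p \<le> d\<close> \<open>degree q \<le> d\<close> by (cases "i < d") (auto simp: coeff_eq_0)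
      then have "(\<Sum>i\<le>2 * d. coeff p i * coeff q (2 * d - i)) = (\<Sum>i\<in>{d}. coeff p i * coeff q (2 * d - i))"
        by (intro sum.mono_neutral_right) auto
      then show ?thesis by (simp add: coeff_mult)
    qed
    have dP: "degree (pderiv P) \<le> d" "degree (pderiv (pderiv P)) \<le> d"
      by (simp_all add: degree_pderiv d_def)
    have "coeff (pderiv P) d = 0" "coeff (pderiv (pderiv P)) d = 0"
      by (simp_all add: coeff_pderiv d_def coeff_eq_0)
    moreover have "coeff (P * pderiv (pderiv P)) (2 * d) = coeff P d * coeff (pderiv (pderiv P)) d"
      "coeff (pderiv P * pderiv P) (2 * d) = coeff (pderiv P) d * coeff (pderiv P) d"
      "coeff (P * P) (2 * d) = coeff P d * coeff P d"
      using dP by (intro c; simp add: d_def)+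
    ultimately have "coeff (- (P * pderiv (pderiv P)) + (pderiv P)\<^sup>2 + of_nat (2 * Suc k) * P\<^sup>2) (2 * d)
        = of_nat (2 * Suc k) * (coeff P d * coeff P d)"
      unfolding power2_eq_square
      by (simp only: coeff_add coeff_minus of_nat_poly mult_pCons_left coeff_smult coeff_pCons_0 mult_zero_left) simp
    moreover have "of_nat (2 * Suc k) * (coeff P d * coeff P d) \<noteq> 0"
      using P0 unfolding d_def
      by (metis leading_coeff_0_iff mult_eq_0_iff nat.simps(3) of_nat_eq_0_iff zero_neq_numeral)
    ultimately have "of_nat (2 * Suc k) * H m (Suc k + 1) * H m (Suc k - 1) \<noteq> 0"
      unfolding e by (metis coeff_0)
    then show ?thesis using 3 by auto
  qed
qed

section \<open>Determinants\<close>

text \<open>Entries are given by a function on all pairs of indices, so that minors of different sizes of the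
  same array can be compared.\<close>
definition det_of :: "nat \<Rightarrow> (nat \<Rightarrow> nat \<Rightarrow> 'a :: comm_ring_1) \<Rightarrow> 'a" where
  "det_of n A = det (mat n n (\<lambda>(i, j). A i j))"

lemma det_of_leibniz:
  "det_of n A = (\<Sum>p | p permutes {0..<n}. signof p * (\<Prod>i = 0..<n. A i (p i)))"
  unfolding det_of_def
  by (subst det_def'[OF mat_carrier])
     (auto intro!: sum.cong prod.cong arg_cong2[where f="(*)"] dest: permutes_in_image)

lemma det_of_cong: "(\<And>i j. i < n \<Longrightarrow> j < n \<Longrightarrow> A i j = B i j) \<Longrightarrow> det_of n A = det_of n B"
  unfolding det_of_def by (intro arg_cong[of _ _ det] cong_mat) auto

lemma det_of_transpose: "det_of n (\<lambda>i j. A j i) = det_of n A"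
proof -
  have "mat n n (\<lambda>(i, j). A j i) = transpose_mat (mat n n (\<lambda>(i, j). A i j))"
    by (rule eq_matI) auto
  then show ?thesis unfolding det_of_def by (metis det_transpose mat_carrier)
qed

lemma det_of_mult: "det_of n (\<lambda>i j. \<Sum>k<n. A i k * B k j) = det_of n A * det_of n B"
proof -
  have "mat n n (\<lambda>(i, j). \<Sum>k<n. A i k * B k j) = mat n n (\<lambda>(i, j). A i j) * mat n n (\<lambda>(i, j). B i j)"
    by (rule eq_matI) (auto simp: scalar_prod_def atLeast0LessThan)
  then show ?thesis unfolding det_of_def by (simp add: det_mult[of _ n])
qed

lemma det_of_identical_rows:
  assumes "k < n" "l < n" "k \<noteq> l" "\<And>j. j < n \<Longrightarrow> A k j = A l j"
  shows "det_of n A = 0"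
  unfolding det_of_def using assms
  by (intro det_identical_rows[of _ n k l]) (auto intro!: eq_vecI)

lemma det_of_lower_triangular:
  assumes "\<And>i j. i < j \<Longrightarrow> j < n \<Longrightarrow> A i j = 0"
  shows "det_of n A = (\<Prod>i<n. A i i)"
  unfolding det_of_def using assms
  by (subst det_lower_triangular[of n]) (auto simp: prod_list_diag_prod atLeast0LessThan)

lemma det_of_scale: "det_of n (\<lambda>i j. c i * A i j * d j) = (\<Prod>i<n. c i) * (\<Prod>i<n. d i) * det_of n A"
proof -
  have "signof p * (\<Prod>i = 0..<n. c i * A i (p i) * d (p i)) =
      (\<Prod>i<n. c i) * (\<Prod>i<n. d i) * (signof p * (\<Prod>i = 0..<n. A i (p i)))"
    if "p permutes {0..<n}" for p
    using prod.permute[OF that, of d] by (simp add: prod.distrib atLeast0LessThan o_def mult_ac)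
  then show ?thesis by (simp add: det_of_leibniz sum_distrib_left)
qed

lemma det_of_block:
  fixes A :: "nat \<Rightarrow> nat \<Rightarrow> 'a :: idom"
  assumes "\<And>i j. i < l \<Longrightarrow> j < k \<Longrightarrow> A (k + i) j = 0"
  shows "det_of (k + l) A = det_of k A * det_of l (\<lambda>i j. A (k + i) (k + j))"
proof -
  have "mat (k + l) (k + l) (\<lambda>(i, j). A i j) =
      four_block_mat (mat k k (\<lambda>(i, j). A i j)) (mat k l (\<lambda>(i, j). A i (k + j)))
        (0\<^sub>m l k) (mat l l (\<lambda>(i, j). A (k + i) (k + j)))" (is "_ = ?M")
  proof (intro eq_matI)
    fix i j assume "i < dim_row ?M" "j < dim_col ?M"
    then show "mat (k + l) (k + l) (\<lambda>(i, j). A i j) $$ (i, j) = ?M $$ (i, j)"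
      using assms[of "i - k" j] by (auto simp: not_less)
  qed auto
  then show ?thesis unfolding det_of_def
    by (simp add: det_four_block_mat_lower_left_zero[of _ k _ l])
qed

lemma det_of_1: "det_of 1 A = A 0 0" and det_of_2: "det_of 2 A = A 0 0 * A 1 1 - A 0 1 * A 1 0"
proof -
  show "det_of 1 A = A 0 0" unfolding det_of_def by (simp add: det_single)
  have S: "{p :: nat \<Rightarrow> nat. p permutes {0..<2}} = {id, Transposition.transpose 0 1}"
  proof -
    have "{0..<2} = {0, 1 :: nat}" by auto
    then show ?thesis by (simp add: permutes_doubleton_iff) auto
  qed
  have "id \<noteq> Transposition.transpose 0 (1 :: nat)" by (metis id_apply transpose_apply_first zero_neq_one)
  then show "det_of 2 A = A 0 0 * A 1 1 - A 0 1 * A 1 0"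
    unfolding det_of_leibniz S by (simp add: sign_swap_id sign_id numeral_2_eq_2)
qed

lemma det_of_0: "det_of 0 A = 1" unfolding det_of_def by simp

text \<open>Block elimination. The function \<open>s\<close> is the Schur complement, and the point is that one \<open>s\<close> serves
  every choice \<open>r\<close>, \<open>c\<close> of additional rows and columns: all determinants bordering the same
  \<open>k \<times> k\<close> block become determinants of \<open>s\<close>.\<close>
lemma det_of_schur:
  fixes M :: "nat \<Rightarrow> nat \<Rightarrow> 'a :: field"
  assumes "det_of k M \<noteq> 0"
  obtains s where "\<And>l r c. det_of (k + l) (\<lambda>i j. M (if i < k then i else r (i - k)) (if j < k then j else c (j - k)))
      = det_of k M * det_of l (\<lambda>i j. s (r i) (c j))"
proof -
  define P where "P = mat k k (\<lambda>(i, j). M i j)"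
  have P: "P \<in> carrier_mat k k" by (simp add: P_def)
  define a where "a l i = adj_mat P $$ (l, i)" for l i
  have adj: "(\<Sum>i<k. a l i * M i j) = (if l = j then det_of k M else 0)" if "l < k" "j < k" for l j
  proof -
    have "(adj_mat P * P) $$ (l, j) = (det P \<cdot>\<^sub>m 1\<^sub>m k) $$ (l, j)"
      using adj_mat(3)[OF P] by simp
    moreover have "(adj_mat P * P) $$ (l, j) = (\<Sum>i<k. a l i * M i j)"
      using that adj_mat(1)[OF P] P by (auto simp: scalar_prod_def a_def P_def atLeast0LessThan)
    ultimately show ?thesis using that P by (simp add: det_of_def flip: P_def)
  qed
  define x where "x r i = (\<Sum>l<k. M r l * a l i) / det_of k M" for r i
  have x: "(\<Sum>i<k. x r i * M i j) = M r j" if "j < k" for r j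
  proof -
    have "(\<Sum>i<k. x r i * M i j) = (\<Sum>i<k. \<Sum>l<k. M r l * (a l i * M i j)) / det_of k M"
      by (simp add: x_def sum_divide_distrib sum_distrib_left sum_distrib_right mult_ac)
    also have "(\<Sum>i<k. \<Sum>l<k. M r l * (a l i * M i j)) = (\<Sum>l<k. M r l * (\<Sum>i<k. a l i * M i j))"
      by (subst sum.swap) (simp add: sum_distrib_left)
    also have "\<dots> = (\<Sum>l<k. M r l * (if l = j then det_of k M else 0))"
      using that by (intro sum.cong) (simp_all add: adj)
    also have "\<dots> = M r j * det_of k M" using that by (simp add: if_distrib cong: if_cong)
    finally show ?thesis using assms by simp
  qed
  define s where "s r c = M r c - (\<Sum>i<k. x r i * M i c)" for r c
  show ?thesis
  proof (rule that)
    fix l r c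
    define N where "N i j = M (if i < k then i else r (i - k)) (if j < k then j else c (j - k))" for i j
    define L where "L i q = (if i = q then 1 else if k \<le> i \<and> q < k then x (r (i - k)) q else 0)" for i q
    define U where "U i j = (if i < k then N i j else if j < k then 0 else s (r (i - k)) (c (j - k)))" for i j
    have "N i j = (\<Sum>q<k + l. L i q * U q j)" if "i < k + l" "j < k + l" for i j
    proof (cases "i < k")
      case True
      have "(\<Sum>q<k + l. L i q * U q j) = (\<Sum>q<k + l. if q = i then U i j else 0)"
        using True by (intro sum.cong) (auto simp: L_def)
      also have "\<dots> = N i j" using that True by (simp add: U_def)
      finally show ?thesis by simp
    next
      case False
      have "(\<Sum>q<k + l. L i q * U q j) = (\<Sum>q<k. L i q * U q j) + (\<Sum>q\<in>{k..<k + l}. L i q * U q j)"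
        by (subst sum.union_disjoint[symmetric]) (auto intro!: sum.cong)
      also have "(\<Sum>q\<in>{k..<k + l}. L i q * U q j) = (\<Sum>q\<in>{k..<k + l}. if q = i then U i j else 0)"
        by (intro sum.cong) (auto simp: L_def)
      also have "\<dots> = U i j" using that False by simp
      also have "(\<Sum>q<k. L i q * U q j) = (\<Sum>q<k. x (r (i - k)) q * M q (if j < k then j else c (j - k)))"
        using False by (intro sum.cong) (auto simp: L_def U_def N_def)
      also have "\<dots> + U i j = N i j"
        using False x by (auto simp: U_def N_def s_def)
      finally show ?thesis by simp
    qed
    then have "det_of (k + l) N = det_of (k + l) (\<lambda>i j. \<Sum>q<k + l. L i q * U q j)" by (intro det_of_cong) auto
    also have "\<dots> = det_of (k + l) L * det_of (k + l) U" by (rule det_of_mult)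
    also have "det_of (k + l) L = 1" by (subst det_of_lower_triangular) (auto simp: L_def)
    also have "det_of (k + l) U = det_of k U * det_of l (\<lambda>i j. U (k + i) (k + j))"
      by (rule det_of_block) (simp add: U_def)
    also have "det_of k U = det_of k M" by (rule det_of_cong) (simp add: U_def N_def)
    also have "det_of l (\<lambda>i j. U (k + i) (k + j)) = det_of l (\<lambda>i j. s (r i) (c j))"
      by (rule det_of_cong) (simp add: U_def)
    finally show "det_of (k + l) (\<lambda>i j. M (if i < k then i else r (i - k)) (if j < k then j else c (j - k)))
      = det_of k M * det_of l (\<lambda>i j. s (r i) (c j))" by (simp add: N_def[abs_def])
  qed
qed

text \<open>Divided by \<open>(det_of k M)\<^sup>2\<close>, this is the expansion of a \<open>2 \<times> 2\<close> determinant of Schur complements.\<close>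
lemma desnanot_jacobi:
  fixes M :: "nat \<Rightarrow> nat \<Rightarrow> 'a :: field"
  assumes "det_of k M \<noteq> 0"
  defines "B r c \<equiv> det_of (Suc k) (\<lambda>i j. M (if i = k then r else i) (if j = k then c else j))"
  shows "det_of (Suc (Suc k)) M * det_of k M =
    B k k * B (Suc k) (Suc k) - B k (Suc k) * B (Suc k) k"
proof -
  obtain s where s: "\<And>l r c. det_of (k + l) (\<lambda>i j. M (if i < k then i else r (i - k)) (if j < k then j else c (j - k)))
      = det_of k M * det_of l (\<lambda>i j. s (r i) (c j))" using det_of_schur[OF assms(1)] by blast
  have B: "B r c = det_of k M * s r c" for r c
  proof -
    have "B r c = det_of (k + 1) (\<lambda>i j. M (if i < k then i else r) (if j < k then j else c))"
      unfolding B_def by (simp, intro det_of_cong) (auto simp: less_Suc_eq)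
    then show ?thesis using s[of 1 "\<lambda>_. r" "\<lambda>_. c"] by (simp add: det_of_1[simplified])
  qed
  have "det_of (Suc (Suc k)) M = det_of (k + 2) (\<lambda>i j. M (if i < k then i else k + (i - k)) (if j < k then j else k + (j - k)))"
    by (simp, intro det_of_cong) auto
  also have "\<dots> = det_of k M * (s k k * s (Suc k) (Suc k) - s k (Suc k) * s (Suc k) k)"
    using s[of 2 "\<lambda>i. k + i" "\<lambda>i. k + i"] by (simp add: det_of_2)
  finally show ?thesis by (simp only: B) (simp add: algebra_simps)
qed

text \<open>When each row is the derivative of the previous one, differentiating any row but the last produces
  two equal rows.\<close>
lemma det_of_has_field_derivative:
  fixes A :: "nat \<Rightarrow> nat \<Rightarrow> 'a :: real_normed_field \<Rightarrow> 'a"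
  assumes "\<And>i j. i \<le> n \<Longrightarrow> j \<le> n \<Longrightarrow> (A i j has_field_derivative A (Suc i) j z) (at z)"
  shows "((\<lambda>z. det_of (Suc n) (\<lambda>i j. A i j z)) has_field_derivative
          det_of (Suc n) (\<lambda>i j. A (if i = n then Suc n else i) j z)) (at z)"
proof -
  let ?S = "{p. p permutes {0..<Suc n}}"
  have "((\<lambda>z. det_of (Suc n) (\<lambda>i j. A i j z)) has_field_derivative
     (\<Sum>p\<in>?S. signof p * (\<Sum>l\<in>{0..<Suc n}. A (Suc l) (p l) z * (\<Prod>i\<in>{0..<Suc n} - {l}. A i (p i) z)))) (at z)"
    unfolding det_of_leibniz
    by (intro DERIV_sum DERIV_cmult has_field_derivative_prod)
       (use permutes_in_image assms in \<open>auto simp: less_Suc_eq_le[symmetric]\<close>)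
  also have "(\<Sum>p\<in>?S. signof p * (\<Sum>l\<in>{0..<Suc n}. A (Suc l) (p l) z * (\<Prod>i\<in>{0..<Suc n} - {l}. A i (p i) z)))
     = (\<Sum>l\<in>{0..<Suc n}. det_of (Suc n) (\<lambda>i j. A (if i = l then Suc l else i) j z))"
  proof -
    have "A (Suc l) (p l) z * (\<Prod>i\<in>{0..<Suc n} - {l}. A i (p i) z)
       = (\<Prod>i\<in>{0..<Suc n}. A (if i = l then Suc l else i) (p i) z)" if "l \<in> {0..<Suc n}" for l p
      using that by (subst (2) prod.remove[of _ l]) (auto intro!: prod.cong)
    then show ?thesis
      unfolding det_of_leibniz sum_distrib_left by (subst sum.swap) (intro sum.cong refl, simp only:)
  qed
  also have "\<dots> = det_of (Suc n) (\<lambda>i j. A (if i = n then Suc n else i) j z)"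
  proof -
    have "det_of (Suc n) (\<lambda>i j. A (if i = l then Suc l else i) j z) = 0" if "l < n" for l
      using that by (intro det_of_identical_rows[of l _ "Suc l"]) auto
    then show ?thesis by simp
  qed
  finally show ?thesis .
qed

section \<open>The Toda equation and Hankel determinants\<close>

text \<open>The first derivative of a Hankel determinant shifts the last row and the second derivative shifts
  also the last column. So the four bordered minors in the Desnanot-Jacobi identity are the
  determinant, its first derivative (twice) and its second derivative.\<close>
lemma toda_hankel:
  fixes Y :: "nat \<Rightarrow> complex \<Rightarrow> complex"
  assumes Y: "\<And>k z. (Y k has_field_derivative Y (Suc k) z) (at z)"
  obtains D' D'' where
    "\<And>z. ((\<lambda>z. det_of (Suc p) (\<lambda>i j. Y (i + j) z)) has_field_derivative D' z) (at z)"
    "\<And>z. (D' has_field_derivative D'' z) (at z)"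
    "\<And>z. det_of p (\<lambda>i j. Y (i + j) z) \<noteq> 0 \<Longrightarrow>
       det_of (Suc (Suc p)) (\<lambda>i j. Y (i + j) z) * det_of p (\<lambda>i j. Y (i + j) z) =
       det_of (Suc p) (\<lambda>i j. Y (i + j) z) * D'' z - (D' z)\<^sup>2"
proof -
  define l where "l i = (if i = p then Suc p else i)" for i
  define D' where "D' z = det_of (Suc p) (\<lambda>i j. Y (l i + j) z)" for z
  define D'' where "D'' z = det_of (Suc p) (\<lambda>i j. Y (l i + l j) z)" for z
  show ?thesis
  proof (rule that)
    fix z
    show "((\<lambda>z. det_of (Suc p) (\<lambda>i j. Y (i + j) z)) has_field_derivative D' z) (at z)"
      unfolding D'_def l_def
      by (rule det_of_has_field_derivative) (use Y in auto)
    have "((\<lambda>z. det_of (Suc p) (\<lambda>j i. Y (l i + j) z)) has_field_derivative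
        det_of (Suc p) (\<lambda>j i. Y (l i + l j) z)) (at z)"
      unfolding l_def[where ?i = "_ :: nat", symmetric]
      using det_of_has_field_derivative[of p "\<lambda>j i. Y (l i + j)" z] Y by (simp add: l_def)
    then show "(D' has_field_derivative D'' z) (at z)"
      unfolding D'_def[abs_def] D''_def
      by (subst (1 2) det_of_transpose[symmetric]) 
    assume "det_of p (\<lambda>i j. Y (i + j) z) \<noteq> 0"
    from desnanot_jacobi[OF this] 
    have "det_of (Suc (Suc p)) (\<lambda>i j. Y (i + j) z) * det_of p (\<lambda>i j. Y (i + j) z) =
       det_of (Suc p) (\<lambda>i j. Y ((if i = p then p else i) + (if j = p then p else j)) z) * D'' z
       - det_of (Suc p) (\<lambda>i j. Y ((if i = p then p else i) + l j) z)
       * det_of (Suc p) (\<lambda>i j. Y (l i + (if j = p then p else j)) z)"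
      by (simp add: D''_def l_def)
    also have "det_of (Suc p) (\<lambda>i j. Y ((if i = p then p else i) + (if j = p then p else j)) z)
        = det_of (Suc p) (\<lambda>i j. Y (i + j) z)"
      by (rule det_of_cong) auto
    also have "det_of (Suc p) (\<lambda>i j. Y (l i + (if j = p then p else j)) z) = D' z"
      unfolding D'_def by (rule det_of_cong) auto
    also have "det_of (Suc p) (\<lambda>i j. Y ((if i = p then p else i) + l j) z) = D' z"
      unfolding D'_def by (subst det_of_transpose[symmetric], rule det_of_cong) (auto simp: add.commute)
    finally show "det_of (Suc (Suc p)) (\<lambda>i j. Y (i + j) z) * det_of p (\<lambda>i j. Y (i + j) z) =
       det_of (Suc p) (\<lambda>i j. Y (i + j) z) * D'' z - (D' z)\<^sup>2"
      by (simp add: power2_eq_square)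
  qed
qed

text \<open>The sign and the Gaussian factor make this sequence in \<open>k\<close> a sequence of successive derivatives
  (Rodrigues' formula), as required by \<open>toda_hankel\<close>.\<close>
definition hermite_fun :: "nat \<Rightarrow> nat \<Rightarrow> complex \<Rightarrow> complex" where
  "hermite_fun m k z = (-1) ^ k * (exp (- z\<^sup>2) * poly (hermite_poly (m + k)) z)"

lemma hermite_fun_deriv: "(hermite_fun m k has_field_derivative hermite_fun m (Suc k) z) (at z)"
  unfolding hermite_fun_def
  by (rule derivative_eq_intros | simp)+ (simp add: algebra_simps)

lemma hermite_fun_hankel:
  "det_of n (\<lambda>i j. hermite_fun m (i + j) z) =
     exp (- z\<^sup>2) ^ n * det_of n (\<lambda>i j. poly (hermite_poly (m + i + j)) z)"
proof -
  have "det_of n (\<lambda>i j. hermite_fun m (i + j) z) =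
      det_of n (\<lambda>i j. ((-1) ^ i * exp (- z\<^sup>2)) * poly (hermite_poly (m + i + j)) z * (-1) ^ j)"
    by (rule det_of_cong) (simp add: hermite_fun_def power_add add.assoc)
  also have "\<dots> = (\<Prod>i<n. (-1) ^ i * exp (- z\<^sup>2)) * (\<Prod>i<n. (-1) ^ i) *
      det_of n (\<lambda>i j. poly (hermite_poly (m + i + j)) z)"
    by (rule det_of_scale)
  also have "(\<Prod>i<n. (-1) ^ i * exp (- z\<^sup>2)) * (\<Prod>i<n. (-1 :: complex) ^ i) = exp (- z\<^sup>2) ^ n"
    by (simp add: prod.distrib mult.assoc mult.left_commute) (simp flip: prod.distrib power_mult_distrib)
  finally show ?thesis .
qed

text \<open>Multiplied by \<open>e\<^bsup>-n z\<^sup>2\<^esup>\<close>, the polynomials \<open>H m n\<close> satisfy the Toda equation in \<open>n\<close>, because the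
  second logarithmic derivative of the Gaussian factor accounts for the term \<open>2 n H\<^bsub>m,n\<^esub>\<^sup>2\<close>. The
  Hankel determinants of \<open>hermite_fun\<close> satisfy it too, with the same values at \<open>n = 0\<close> and \<open>n = 1\<close>
  up to constants. Division by \<open>H m (n - 2)\<close> is possible outside a finite set, and continuity does the
  rest.\<close>
lemma generalised_hermite_hankel:
  assumes H: "generalised_hermite H"
  shows "\<exists>c. c \<noteq> 0 \<and> (\<forall>z. poly (H m n) z = c * det_of n (\<lambda>i j. poly (hermite_poly (m + i + j)) z))"
proof (induction n rule: less_induct)
  case (less n)
  let ?D = "\<lambda>n z. det_of n (\<lambda>i j. poly (hermite_poly (m + i + j)) z)"
  let ?T = "\<lambda>n z. det_of n (\<lambda>i j. hermite_fun m (i + j) z)"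
  consider "n = 0" | "n = 1" | p where "n = Suc (Suc p)"
    by (metis One_nat_def not0_implies_Suc)
  then show ?case
  proof cases
    case 1
    then show ?thesis using generalised_hermite_zero[OF H] by (auto simp: det_of_0)
  next
    case 2
    then show ?thesis using generalised_hermite_one[OF H, of m] by (auto simp: det_of_1[simplified])
  next
    case (3 p)
    obtain c where c: "c \<noteq> 0" "\<And>z. poly (H m p) z = c * ?D p z" using less[of p] 3 by auto
    obtain d where d: "d \<noteq> 0" "\<And>z. poly (H m (Suc p)) z = d * ?D (Suc p) z"
      using less[of "Suc p"] 3 by auto
    define P where "P = H m (Suc p)"
    define N where "N = (of_nat (Suc p) :: complex)"
    define b where "b = - (d\<^sup>2 / (2 * N * c))"
    have N0: "N \<noteq> 0" unfolding N_def by (metis nat.simps(3) of_nat_eq_0_iff)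
    obtain D' D'' where D:
      "\<And>z. (?T (Suc p) has_field_derivative D' z) (at z)"
      "\<And>z. (D' has_field_derivative D'' z) (at z)"
      "\<And>z. ?T p z \<noteq> 0 \<Longrightarrow> ?T (Suc (Suc p)) z * ?T p z = ?T (Suc p) z * D'' z - (D' z)\<^sup>2"
      using toda_hankel[of "hermite_fun m" p] hermite_fun_deriv by metis
    \<comment> \<open>The factor \<open>e\<close> is the Gaussian that turns the recursion into the Toda equation.\<close>
    have eq: "poly (H m n) z = b * ?D n z" if nz: "poly (H m p) z \<noteq> 0" for z
    proof -
      define e where "e z = exp (- (z\<^sup>2)) ^ Suc p" for z :: complex
      have e: "(e has_field_derivative - (2 * N * z) * e z) (at z)" for z
      proof -
        have e_eq: "e = (\<lambda>z. exp (- (N * z\<^sup>2)))"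
          by (rule ext) (simp add: e_def N_def exp_of_nat_mult[symmetric] del: of_nat_Suc power_Suc)
        show ?thesis unfolding e_eq
          by (rule derivative_eq_intros | simp)+
      qed
      have U: "poly P z * e z = d * ?T (Suc p) z" for z
        by (simp only: hermite_fun_hankel) (simp add: P_def d e_def del: power_Suc)
      have U': "(poly (pderiv P) z - 2 * N * z * poly P z) * e z = d * D' z" for z
      proof (rule DERIV_unique)
        show "((\<lambda>z. d * ?T (Suc p) z) has_field_derivative d * D' z) (at z)"
          by (rule DERIV_cmult[OF D(1)])
        show "((\<lambda>z. d * ?T (Suc p) z) has_field_derivative
            (poly (pderiv P) z - 2 * N * z * poly P z) * e z) (at z)"
          unfolding U[symmetric]
          by (rule DERIV_cong[OF DERIV_mult[OF poly_DERIV e]]) (simp add: algebra_simps)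
      qed
      have U'': "(poly (pderiv (pderiv P)) z - 2 * N * poly P z - 4 * N * z * poly (pderiv P) z
          + 4 * N\<^sup>2 * z\<^sup>2 * poly P z) * e z = d * D'' z" for z
      proof (rule DERIV_unique)
        show "((\<lambda>z. d * D' z) has_field_derivative d * D'' z) (at z)"
          by (rule DERIV_cmult[OF D(2)])
        show "((\<lambda>z. d * D' z) has_field_derivative
            (poly (pderiv (pderiv P)) z - 2 * N * poly P z - 4 * N * z * poly (pderiv P) z
          + 4 * N\<^sup>2 * z\<^sup>2 * poly P z) * e z) (at z)"
          unfolding U'[symmetric]
          by (rule derivative_eq_intros e | simp)+ (simp add: algebra_simps power2_eq_square)
      qed
      have T0: "?T p z \<noteq> 0" using nz unfolding c hermite_fun_hankel by auto
      have Hp: "2 * N * poly (H m n) z * poly (H m p) z =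
          - (poly P z * poly (pderiv (pderiv P)) z) + (poly (pderiv P) z)\<^sup>2 + 2 * N * (poly P z)\<^sup>2"
      proof -
        have "of_nat (2 * Suc p) * H m (Suc p + 1) * H m (Suc p - 1) =
            - (P * pderiv (pderiv P)) + (pderiv P)\<^sup>2 + of_nat (2 * Suc p) * P\<^sup>2"
          using H unfolding generalised_hermite_def P_def by (metis le_add1 plus_1_eq_Suc)
        then have "poly (of_nat (2 * Suc p) * H m n * H m p) z =
            poly (- (P * pderiv (pderiv P)) + (pderiv P)\<^sup>2 + of_nat (2 * Suc p) * P\<^sup>2) z"
          using 3 by (simp only: Suc_eq_plus1[symmetric] diff_Suc_1)
        then show ?thesis unfolding N_def
          by (simp only: poly_mult poly_add poly_minus poly_power poly_of_nat) (simp add: algebra_simps)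
      qed
      \<comment> \<open>The polynomial identities behind the chain below, in indeterminates.\<close>
      have a1: "x\<^sup>2 * (t * r - q\<^sup>2) = x * t * (x * r) - (x * q)\<^sup>2" for x t r q :: complex
        by Groebner_Basis.algebra
      have a2: "x * y * ((r - 2 * N * x - 4 * N * z * q + 4 * N\<^sup>2 * z\<^sup>2 * x) * y)
          - ((q - 2 * N * z * x) * y)\<^sup>2 = y\<^sup>2 * (x * r - q\<^sup>2 - 2 * N * x\<^sup>2)" for x y q r
        by Groebner_Basis.algebra
      have a3: "y\<^sup>2 * (t - q - r) = - (y\<^sup>2 * (- t + q + r))" for y t q r :: complex
        by Groebner_Basis.algebra
      have a4: "y * (t * q + r) = 0" if "t * (y * q) = - (y * r)" for y t q r :: complex
        using that by Groebner_Basis.algebra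
      have a5: "x * t + r * y = 0" if "x * t * q + r * y * q = 0" "q \<noteq> 0" for x t q r y :: complex
        using that by Groebner_Basis.algebra
      have "d\<^sup>2 * (?T n z * ?T p z) = (d * ?T (Suc p) z) * (d * D'' z) - (d * D' z)\<^sup>2"
        unfolding 3 D(3)[OF T0] by (rule a1)
      also have "\<dots> = (e z)\<^sup>2 * (poly P z * poly (pderiv (pderiv P)) z - (poly (pderiv P) z)\<^sup>2 - 2 * N * (poly P z)\<^sup>2)"
        unfolding U[symmetric] U'[symmetric] U''[symmetric] by (rule a2)
      also have "\<dots> = - ((e z)\<^sup>2 * (2 * N * poly (H m n) z * poly (H m p) z))"
        unfolding Hp by (rule a3)
      also have "?T n z * ?T p z = (e z)\<^sup>2 * (?D n z * ?D p z)"
        unfolding hermite_fun_hankel e_def by (simp add: 3 power2_eq_square power_add)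
      finally have "d\<^sup>2 * ((e z)\<^sup>2 * (?D n z * ?D p z)) = - ((e z)\<^sup>2 * (2 * N * poly (H m n) z * poly (H m p) z))" .
      then have "(e z)\<^sup>2 * (d\<^sup>2 * (?D n z * ?D p z) + 2 * N * poly (H m n) z * (c * ?D p z)) = 0"
        unfolding c by (rule a4)
      moreover have "e z \<noteq> 0" "?D p z \<noteq> 0" using nz c by (auto simp: e_def)
      ultimately have "d\<^sup>2 * ?D n z + 2 * N * c * poly (H m n) z = 0"
        using a5[of "d\<^sup>2" "?D n z" "?D p z" "2 * N * c" "poly (H m n) z"] by (simp add: mult_ac)
      then have "2 * N * c * poly (H m n) z = - (d\<^sup>2 * ?D n z)"
        by (simp add: add_eq_0_iff)
      then show ?thesis using N0 c(1) by (simp add: b_def field_simps)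
    qed
    \<comment> \<open>The excluded points are finitely many, so the identity extends by continuity.\<close>
    have "poly (H m n) z = b * ?D n z" for z
    proof -
      let ?g = "\<lambda>z. poly (H m n) z - b * ?D n z"
      have cont: "continuous_on UNIV ?g"
        unfolding det_of_leibniz by (intro continuous_intros)
      have "{z. poly (H m p) z \<noteq> 0} \<subseteq> {z. ?g z = 0}" using eq by auto
      moreover have "closed {z. ?g z = 0}"
        using continuous_closed_vimage[of "{0}" ?g] cont by (simp add: vimage_def continuous_on_eq_continuous_at)
      ultimately have "closure {z. poly (H m p) z \<noteq> 0} \<subseteq> {z. ?g z = 0}" by (rule closure_minimal)
      moreover have "closure {z. poly (H m p) z \<noteq> 0} = UNIV"
      proof -
        have "finite {z. poly (H m p) z = 0}"
          by (rule poly_roots_finite[OF generalised_hermite_nonzero[OF H]])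
        then have "interior {z. poly (H m p) z = 0} = {}" by (rule empty_interior_finite)
        moreover have "{z. poly (H m p) z \<noteq> 0} = - {z. poly (H m p) z = 0}" by auto
        ultimately show ?thesis by (simp add: closure_complement)
      qed
      ultimately show ?thesis by auto
    qed
    moreover have "b \<noteq> 0" using N0 c d by (simp add: b_def)
    ultimately show ?thesis by blast
  qed
qed

section \<open>Circle integrals and Gram determinants\<close>

text \<open>Up to a constant factor this is \<open>exp (2 z x - x\<^sup>2) x\<^bsup>-N\<^esup>\<close> at \<open>x = (\<surd>E / 2) e\<^bsup>it\<^esup>\<close> and \<open>z = \<surd>E \<zeta>\<close>. With
  \<open>N\<close> close to \<open>E / 2\<close> its exponent is nearly \<open>E (\<zeta> u - u\<^sup>2 / 4 - (log u) / 2)\<close> in \<open>u = e\<^bsup>it\<^esup>\<close>, whose critical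
  points satisfy \<open>u + 1 / u = 2 \<zeta>\<close>.\<close>
definition circle_weight :: "real \<Rightarrow> nat \<Rightarrow> complex \<Rightarrow> real \<Rightarrow> complex" where
  "circle_weight E N \<zeta> t = exp (of_real E * (\<zeta> * cis t - cis (2 * t) / 4)) * cis (- (real N * t))"

text \<open>The circle is cut into two half circles because each of them contains one saddle point.\<close>
definition upper_arc :: "real \<Rightarrow> nat \<Rightarrow> complex \<Rightarrow> (complex \<Rightarrow> complex) \<Rightarrow> complex" where
  "upper_arc E N \<zeta> q = integral {0..pi} (\<lambda>t. q (cis t) * circle_weight E N \<zeta> t)"

definition lower_arc :: "real \<Rightarrow> nat \<Rightarrow> complex \<Rightarrow> (complex \<Rightarrow> complex) \<Rightarrow> complex" where
  "lower_arc E N \<zeta> q = integral {0..pi} (\<lambda>t. q (cis (- t)) * circle_weight E N \<zeta> (- t))"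

definition circle_functional :: "real \<Rightarrow> nat \<Rightarrow> complex \<Rightarrow> (complex \<Rightarrow> complex) \<Rightarrow> complex" where
  "circle_functional E N \<zeta> q = upper_arc E N \<zeta> q + lower_arc E N \<zeta> q"

lemma continuous_on_circle_weight [continuous_intros]: "continuous_on A (circle_weight E N \<zeta>)"
  unfolding circle_weight_def by (intro continuous_intros) auto

lemma circle_functional_sum:
  assumes "\<And>k. k \<in> A \<Longrightarrow> continuous_on UNIV (q k)" "finite A"
  shows "circle_functional E N \<zeta> (\<lambda>u. \<Sum>k\<in>A. c k * q k u) = (\<Sum>k\<in>A. c k * circle_functional E N \<zeta> (q k))"
proof -
  have c: "continuous_on B (\<lambda>t. q k (cis (h t)) * circle_weight E N \<zeta> (h t))"
    if "k \<in> A" "continuous_on B h" for k B and h :: "real \<Rightarrow> real"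
    by (intro continuous_intros continuous_on_compose2[OF assms(1)[OF that(1)]]
      continuous_on_compose2[OF continuous_on_circle_weight] that(2)) auto
  have "integral {0..pi} (\<lambda>t. (\<Sum>k\<in>A. c k * q k (cis (h t))) * circle_weight E N \<zeta> (h t)) =
      (\<Sum>k\<in>A. c k * integral {0..pi} (\<lambda>t. q k (cis (h t)) * circle_weight E N \<zeta> (h t)))"
    if "continuous_on {0..pi} h" for h
    using that assms(2)
    by (simp add: sum_distrib_right mult.assoc,
        subst integral_sum) (auto intro!: integrable_continuous_real continuous_intros c)
  from this[of "\<lambda>t. t"] this[of "\<lambda>t. - t"] show ?thesis
    by (simp add: circle_functional_def upper_arc_def lower_arc_def sum.distrib distrib_left continuous_intros)
qed

lemma circle_functional_eq_contour_integral:
  assumes q: "continuous_on UNIV q" and r: "r > 0" and E: "E = 4 * r\<^sup>2" and z: "z = 2 * of_real r * \<zeta>"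
  shows "((\<lambda>x. q (x / of_real r) * exp (2 * z * x - x\<^sup>2) / x ^ Suc N) has_contour_integral
      (\<i> / of_real r ^ N) * circle_functional E N \<zeta> q) (circlepath 0 r)"
proof -
  define G where "G t = q (cis t) * circle_weight E N \<zeta> t" for t
  have contG: "continuous_on A G" for A
    unfolding G_def by (intro continuous_intros continuous_on_compose2[OF q]) auto
  have int: "(G has_integral integral {a..b} G) {a..b}" for a b
    by (intro integrable_integral integrable_continuous_real contG)
  have per: "G (2 * pi - t) = G (- t)" for t
  proof -
    have "cis (2 * pi - t) = cis (- t)" "cis (2 * (2 * pi - t)) = cis (2 * (- t))"
      by (simp_all add: cis.ctr cos_diff sin_diff algebra_simps cos_double sin_double)
    moreover have "cis (- (real N * (2 * pi - t))) = cis (- (real N * (- t)))"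
    proof -
      have "cis (- (real N * (2 * pi - t))) = cis (- (2 * pi * real N)) * cis (real N * t)"
        by (simp add: cis_mult algebra_simps)
      also have "cis (- (2 * pi * real N)) = 1" 
        using cis_multiple_2pi[of "- real N"] by simp
      finally show ?thesis by simp
    qed
    ultimately show ?thesis by (simp add: G_def circle_weight_def)
  qed
  have "((\<lambda>t. G (- 1 * t + 2 * pi)) has_integral integral {pi..2 * pi} G) {0..pi}"
    using has_integral_affinity[OF int[of pi "2 * pi", unfolded box_real(2)[symmetric]], of "-1" "2 * pi"]
    by (simp add: image_affinity_cbox[where m = "-1 :: real", simplified] algebra_simps)
  then have "((\<lambda>t. G (- t)) has_integral integral {pi..2 * pi} G) {0..pi}"
    by (simp add: per[symmetric])
  then have "integral {0..pi} (\<lambda>t. G (- t)) = integral {pi..2 * pi} G"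
    by (rule integral_unique)
  then have "circle_functional E N \<zeta> q = integral {0..pi} G + integral {pi..2 * pi} G"
    by (simp add: circle_functional_def upper_arc_def lower_arc_def G_def[abs_def])
  also have "\<dots> = integral {0..2 * pi} G"
    by (rule Henstock_Kurzweil_Integration.integral_combine) (auto intro: integrable_continuous_real contG)
  finally have "(G has_integral circle_functional E N \<zeta> q) {0..2 * pi}" using int[of 0 "2 * pi"] by simp
  then have "((\<lambda>t. (\<i> / of_real r ^ N) * G t) has_integral (\<i> / of_real r ^ N) * circle_functional E N \<zeta> q) {0..2 * pi}"
    by (rule has_integral_mult_right)
  moreover have "(\<i> / of_real r ^ N) * G t =
      q ((0 + of_real r * cis t) / of_real r) * exp (2 * z * (0 + of_real r * cis t) - (0 + of_real r * cis t)\<^sup>2)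
      / (0 + of_real r * cis t) ^ Suc N * of_real r * \<i> * cis t" for t
  proof -
    have "exp (2 * z * (of_real r * cis t) - (of_real r * cis t)\<^sup>2) =
        exp (of_real E * (\<zeta> * cis t - cis (2 * t) / 4))"
      by (simp add: z E power_mult_distrib Complex.DeMoivre algebra_simps) (simp add: power2_eq_square mult_ac)
    moreover have "cis (- (real N * t)) = 1 / cis t ^ N"
      by (simp add: Complex.DeMoivre cis_inverse[symmetric] divide_simps) 
    ultimately show ?thesis using r
      by (simp add: G_def circle_weight_def power_mult_distrib field_simps)
  qed
  ultimately show ?thesis
    unfolding circlepath_def by (subst has_contour_integral_part_circlepath_iff) simp_all
qed

text \<open>The function \<open>x \<mapsto> h\<^sub>i (z - x) exp (2 z x - x\<^sup>2)\<close> is the \<open>i\<close>-th derivative of the generating function of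
  the Hermite polynomials, and \<open>h\<^bsub>M+i\<^esub> (z)\<close> is its \<open>M\<close>-th derivative at \<open>0\<close>.\<close>
lemma hermite_poly_contour_integral:
  assumes r: "r > 0"
  shows "((\<lambda>x. poly (hermite_poly i) (z - x) * exp (2 * z * x - x\<^sup>2) / x ^ Suc M) has_contour_integral
      2 * of_real pi * \<i> / fact M * poly (hermite_poly (M + i)) z) (circlepath 0 r)"
proof -
  define \<Phi> where "\<Phi> i x = poly (hermite_poly i) (z - x) * exp (2 * z * x - x\<^sup>2)" for i x
  have \<Phi>: "(\<Phi> i has_field_derivative \<Phi> (Suc i) x) (at x)" for i x
    unfolding \<Phi>_def
    by (rule derivative_eq_intros poly_DERIV[THEN DERIV_chain2] | simp)+ (simp add: algebra_simps)
  have "(deriv ^^ M) (\<Phi> i) = \<Phi> (M + i)" for M i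
  proof (induction M)
    case (Suc M)
    have "(deriv ^^ Suc M) (\<Phi> i) = deriv (\<Phi> (M + i))" by (simp add: Suc)
    also have "\<dots> = \<Phi> (Suc M + i)" by (rule ext) (simp add: DERIV_imp_deriv[OF \<Phi>])
    finally show ?case .
  qed simp
  moreover have "\<Phi> i holomorphic_on A" for A
    unfolding holomorphic_on_def using \<Phi> field_differentiable_at_within field_differentiable_def by blast
  moreover have "((\<lambda>x. \<Phi> i x / (x - 0) ^ Suc M) has_contour_integral
      2 * pi * \<i> / fact M * (deriv ^^ M) (\<Phi> i) 0) (circlepath 0 r)"
    by (rule Cauchy_has_contour_integral_higher_derivative_circlepath)
       (use r \<open>\<And>A. \<Phi> i holomorphic_on A\<close> holomorphic_on_imp_continuous_on in auto)
  ultimately show ?thesis by (simp add: \<Phi>_def)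
qed


text \<open>The index \<open>i\<close> enters through a polynomial factor of degree \<open>i\<close> and \<open>j\<close> through a power of \<open>u\<close>, while the
  weight is the same for all \<open>i\<close> and \<open>j\<close>. This is what turns the Hankel determinant into a moment
  determinant.\<close>
lemma hermite_poly_eq_circle_functional:
  assumes r: "r > 0" and E: "E = 4 * r\<^sup>2" and z: "z = 2 * of_real r * \<zeta>" and j: "j < n"
  shows "poly (hermite_poly (m + i + j)) z =
    (fact (m + j) * of_real r ^ (n - 1 - j) / (2 * of_real pi * of_real r ^ (m + n - 1))) *
    circle_functional E (m + n - 1) \<zeta> (\<lambda>u. poly (hermite_poly i) (z - of_real r * u) * u ^ (n - 1 - j))"
proof -
  define N where "N = m + n - 1"
  define q where "q u = poly (hermite_poly i) (z - of_real r * u) * u ^ (n - 1 - j)" for u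
  have "continuous_on UNIV q" unfolding q_def by (intro continuous_intros)
  from circle_functional_eq_contour_integral[OF this r E z, of N]
  have 1: "((\<lambda>x. q (x / of_real r) * exp (2 * z * x - x\<^sup>2) / x ^ Suc N) has_contour_integral
      (\<i> / of_real r ^ N) * circle_functional E N \<zeta> q) (circlepath 0 r)" .
  have "((\<lambda>x. (1 / of_real r ^ (n - 1 - j)) * (poly (hermite_poly i) (z - x) * exp (2 * z * x - x\<^sup>2) / x ^ Suc (m + j)))
      has_contour_integral (1 / of_real r ^ (n - 1 - j)) *
        (2 * of_real pi * \<i> / fact (m + j) * poly (hermite_poly (m + j + i)) z)) (circlepath 0 r)"
    by (intro has_contour_integral_lmul hermite_poly_contour_integral r)
  moreover have "(1 / of_real r ^ (n - 1 - j)) * (poly (hermite_poly i) (z - x) * exp (2 * z * x - x\<^sup>2) / x ^ Suc (m + j))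
      = q (x / of_real r) * exp (2 * z * x - x\<^sup>2) / x ^ Suc N" if "x \<in> path_image (circlepath 0 r)" for x
  proof -
    have "x \<noteq> 0" using that r by auto
    moreover have "Suc N = (n - 1 - j) + Suc (m + j)" using j by (simp add: N_def)
    ultimately show ?thesis using r
      by (simp only: power_add) (simp add: q_def power_divide field_simps)
  qed
  ultimately have "((\<lambda>x. q (x / of_real r) * exp (2 * z * x - x\<^sup>2) / x ^ Suc N)
      has_contour_integral (1 / of_real r ^ (n - 1 - j)) *
        (2 * of_real pi * \<i> / fact (m + j) * poly (hermite_poly (m + j + i)) z)) (circlepath 0 r)"
    by (rule has_contour_integral_eq)
  from has_contour_integral_unique[OF 1 this] r show ?thesis
    unfolding N_def[symmetric] q_def[abs_def, symmetric]
    by (simp add: field_simps add.commute add.left_commute)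
qed

lemma det_of_reversal_nonzero:
  "det_of n (\<lambda>k l. if k + l + 1 = n then 1 else 0 :: 'a :: idom) \<noteq> 0"
proof -
  let ?R = "\<lambda>k l. if k + l + 1 = n then 1 else 0 :: 'a"
  have "(\<Sum>k<n. ?R i k * ?R k j) = (if i = j then 1 else 0)" if "i < n" "j < n" for i j
  proof -
    have "(\<Sum>k<n. ?R i k * ?R k j) = (\<Sum>k<n. if k = n - 1 - i then ?R k j else 0)"
      using that by (intro sum.cong) auto
    also have "\<dots> = (if i = j then 1 else 0)" using that by auto
    finally show ?thesis .
  qed
  then have "det_of n ?R * det_of n ?R = det_of n (\<lambda>i j. if i = j then 1 else 0)"
    unfolding det_of_mult[symmetric] by (intro det_of_cong) auto
  also have "\<dots> = 1" by (subst det_of_lower_triangular) auto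
  finally show ?thesis by auto
qed

lemma poly_eq_sum_lessThan:
  fixes p :: "'a :: comm_semiring_1 poly"
  shows "degree p < n \<Longrightarrow> poly p x = (\<Sum>k<n. coeff p k * x ^ k)"
  unfolding poly_altdef by (rule sum.mono_neutral_left) (auto simp: coeff_eq_0)

text \<open>The Hankel matrix factors as a triangular matrix (the coefficients of \<open>h\<^sub>i (z - r u)\<close>, whose leading
  coefficients do not depend on \<open>z\<close>), the matrix of moments, and a scaled reversal of the indices.\<close>
lemma hermite_hankel_eq_circle_functional:
  assumes r: "r > 0" and E: "E = 4 * r\<^sup>2"
  obtains c where "c \<noteq> 0"
    "\<And>z \<zeta>. z = 2 * of_real r * \<zeta> \<Longrightarrow>
      det_of n (\<lambda>i j. poly (hermite_poly (m + i + j)) z) =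
      c * det_of n (\<lambda>k l. circle_functional E (m + n - 1) \<zeta> (\<lambda>u. u ^ (k + l)))"
proof -
  define d where "d j = (fact (m + j) * of_real r ^ (n - 1 - j) / (2 * of_real pi * of_real r ^ (m + n - 1)) :: complex)" for j
  define R where "R k l = (if k + l + 1 = n then 1 else 0 :: complex)" for k l
  define c where "c = (\<Prod>i<n. (- 2 * of_real r) ^ i) * (det_of n R * (\<Prod>j<n. d j))"
  show ?thesis
  proof (rule that[of c])
    show "c \<noteq> 0"
      using r det_of_reversal_nonzero[of n] by (auto simp: c_def d_def R_def[abs_def])
    fix z \<zeta> :: complex assume z: "z = 2 * of_real r * \<zeta>"
    define S where "S k l = circle_functional E (m + n - 1) \<zeta> (\<lambda>u. u ^ (k + l))" for k l
    define h where "h i = pcompose (hermite_poly i) [:z, - of_real r:]" for i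
    have h: "poly (h i) u = poly (hermite_poly i) (z - of_real r * u)" for i u
      by (simp add: h_def poly_pcompose mult.commute)
    have deg: "degree (h i) = i" and leading_coeff_at: "coeff (h i) i = (- 2 * of_real r) ^ i" for i
    proof -
      show *: "degree (h i) = i" using r by (simp add: h_def degree_pcompose hermite_poly_degree_lead_coeff)
      have "lead_coeff (h i) = lead_coeff (hermite_poly i) * lead_coeff [:z, - of_real r:] ^ degree (hermite_poly i)"
        unfolding h_def using r by (intro lead_coeff_comp) simp
      moreover have "lead_coeff (hermite_poly i) = 2 ^ i" "degree (hermite_poly i) = i"
        using hermite_poly_degree_lead_coeff[of i] by blast+
      moreover have "lead_coeff [:z, - complex_of_real r:] = - of_real r" using r by simp
      ultimately have "coeff (h i) i = 2 ^ i * (- of_real r) ^ i" unfolding * by metis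
      also have "\<dots> = (2 * - of_real r) ^ i" by (rule power_mult_distrib[symmetric])
      also have "2 * - complex_of_real r = - 2 * of_real r" by simp
      finally show "coeff (h i) i = (- 2 * of_real r) ^ i" .
    qed
    have "poly (hermite_poly (m + i + j)) z = (\<Sum>k<n. coeff (h i) k * (\<Sum>l<n. S k l * (R l j * d j)))"
      if "i < n" "j < n" for i j
    proof -
      have "(\<Sum>l<n. S k l * (R l j * d j)) = (\<Sum>l<n. if l = n - 1 - j then S k l * d j else 0)" for k
        using that by (intro sum.cong) (auto simp: R_def)
      then have "(\<Sum>k<n. coeff (h i) k * (\<Sum>l<n. S k l * (R l j * d j))) =
          d j * (\<Sum>k<n. coeff (h i) k * circle_functional E (m + n - 1) \<zeta> (\<lambda>u. u ^ (k + (n - 1 - j))))"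
        using that by (simp add: S_def sum_distrib_left mult_ac)
      also have "\<dots> = d j * circle_functional E (m + n - 1) \<zeta> (\<lambda>u. \<Sum>k<n. coeff (h i) k * u ^ (k + (n - 1 - j)))"
        by (subst circle_functional_sum) (auto intro!: continuous_intros)
      also have "(\<lambda>u. \<Sum>k<n. coeff (h i) k * u ^ (k + (n - 1 - j))) =
          (\<lambda>u. poly (hermite_poly i) (z - of_real r * u) * u ^ (n - 1 - j))"
        unfolding h[symmetric] using that deg
        by (simp add: poly_eq_sum_lessThan[of _ n] sum_distrib_right mult.assoc flip: power_add)
      finally show ?thesis
        unfolding hermite_poly_eq_circle_functional[OF r E z that(2)] d_def by simp
    qed
    then have "det_of n (\<lambda>i j. poly (hermite_poly (m + i + j)) z) =
        det_of n (\<lambda>i j. \<Sum>k<n. coeff (h i) k * (\<Sum>l<n. S k l * (R l j * d j)))"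
      by (intro det_of_cong) auto
    also have "\<dots> = det_of n (\<lambda>i k. coeff (h i) k) * (det_of n S * det_of n (\<lambda>l j. R l j * d j))"
      by (simp only: det_of_mult)
    also have "det_of n (\<lambda>i k. coeff (h i) k) = (\<Prod>i<n. (- 2 * of_real r) ^ i)"
      by (subst det_of_lower_triangular) (auto simp: deg coeff_eq_0 leading_coeff_at)
    also have "det_of n (\<lambda>l j. R l j * d j) = det_of n R * (\<Prod>j<n. d j)"
      using det_of_scale[of n "\<lambda>_. 1" R d] by simp
    finally show "det_of n (\<lambda>i j. poly (hermite_poly (m + i + j)) z) = c * det_of n S"
      by (simp add: c_def mult_ac)
  qed
qed

text \<open>Change of basis for the bilinear form \<open>(p, q) \<mapsto> \<Lambda> (p q)\<close>.\<close>
lemma gram_eq_hankel: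
  assumes "\<And>i. i < n \<Longrightarrow> degree (b i) < n"
  shows "det_of n (\<lambda>i j. circle_functional E N \<zeta> (\<lambda>u. poly (b i) u * poly (b j) u)) =
    (det_of n (\<lambda>i k. coeff (b i) k))\<^sup>2 * det_of n (\<lambda>k l. circle_functional E N \<zeta> (\<lambda>u. u ^ (k + l)))"
proof -
  let ?S = "\<lambda>k l. circle_functional E N \<zeta> (\<lambda>u. u ^ (k + l))"
  have "circle_functional E N \<zeta> (\<lambda>u. poly (b i) u * poly (b j) u) =
      (\<Sum>k<n. coeff (b i) k * (\<Sum>l<n. ?S k l * coeff (b j) l))" if "i < n" "j < n" for i j
  proof -
    have "(\<lambda>u. poly (b i) u * poly (b j) u) =
        (\<lambda>u. \<Sum>(k, l)\<in>{..<n} \<times> {..<n}. (coeff (b i) k * coeff (b j) l) * u ^ (k + l))"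
      unfolding poly_eq_sum_lessThan[OF assms[OF that(1)]] poly_eq_sum_lessThan[OF assms[OF that(2)]]
      by (simp add: sum_product sum.cartesian_product power_add mult.assoc mult.left_commute)
    then have "circle_functional E N \<zeta> (\<lambda>u. poly (b i) u * poly (b j) u) =
        circle_functional E N \<zeta> (\<lambda>u. \<Sum>(k, l)\<in>{..<n} \<times> {..<n}. (coeff (b i) k * coeff (b j) l) * u ^ (k + l))"
      by simp
    also have "\<dots> = (\<Sum>(k, l)\<in>{..<n} \<times> {..<n}. (coeff (b i) k * coeff (b j) l) * ?S k l)"
      unfolding case_prod_unfold by (subst circle_functional_sum) (auto intro!: continuous_intros)
    also have "\<dots> = (\<Sum>k<n. \<Sum>l<n. (coeff (b i) k * coeff (b j) l) * ?S k l)"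
      by (rule sum.cartesian_product[symmetric])
    finally show ?thesis by (simp add: sum_distrib_left mult_ac)
  qed
  then have "det_of n (\<lambda>i j. circle_functional E N \<zeta> (\<lambda>u. poly (b i) u * poly (b j) u)) =
      det_of n (\<lambda>i j. \<Sum>k<n. coeff (b i) k * (\<Sum>l<n. ?S k l * coeff (b j) l))"
    by (intro det_of_cong) auto
  also have "\<dots> = det_of n (\<lambda>i k. coeff (b i) k) * (det_of n ?S * det_of n (\<lambda>l j. coeff (b j) l))"
    by (simp only: det_of_mult)
  finally show ?thesis
    by (simp add: det_of_transpose[of n "\<lambda>i k. coeff (b i) k"] power2_eq_square)
qed

text \<open>The constant depends neither on \<open>z\<close> nor on the polynomials \<open>b\<close>, so the basis may be adapted to the
  saddle points of a given region of the \<open>z\<close>-plane. The squared determinant of coefficients vanishes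
  only if the Gram determinant vanishes identically.\<close>
lemma generalised_hermite_gram:
  assumes "generalised_hermite H" and r: "r > 0" and E: "E = 4 * r\<^sup>2"
  obtains c where "c \<noteq> 0"
    "\<And>z \<zeta> b. z = 2 * of_real r * \<zeta> \<Longrightarrow> (\<And>i. i < n \<Longrightarrow> degree (b i) < n) \<Longrightarrow>
      c * det_of n (\<lambda>i j. circle_functional E (m + n - 1) \<zeta> (\<lambda>u. poly (b i) u * poly (b j) u)) =
      (det_of n (\<lambda>i k. coeff (b i) k))\<^sup>2 * poly (H m n) z"
proof -
  obtain d where d: "d \<noteq> 0" "\<And>z. poly (H m n) z = d * det_of n (\<lambda>i j. poly (hermite_poly (m + i + j)) z)"
    using generalised_hermite_hankel[OF assms(1), of m n] by metis
  obtain c where c: "c \<noteq> 0"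
    "\<And>z \<zeta>. z = 2 * of_real r * \<zeta> \<Longrightarrow>
      det_of n (\<lambda>i j. poly (hermite_poly (m + i + j)) z) =
      c * det_of n (\<lambda>k l. circle_functional E (m + n - 1) \<zeta> (\<lambda>u. u ^ (k + l)))"
    by (rule hermite_hankel_eq_circle_functional[OF r E, where n = n and m = m]) (rule that)
  have comb: "d * c * t = s * x" if "t = s * y" "x = d * w" "w = c * y" for t s x y w :: complex
    unfolding that by simp
  have "d * c * det_of n (\<lambda>i j. circle_functional E (m + n - 1) \<zeta> (\<lambda>u. poly (b i) u * poly (b j) u)) =
      (det_of n (\<lambda>i k. coeff (b i) k))\<^sup>2 * poly (H m n) z"
    if "z = 2 * of_real r * \<zeta>" "\<And>i. i < n \<Longrightarrow> degree (b i) < n" for z \<zeta> b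
    by (rule comb[OF gram_eq_hankel[OF that(2)] d(2) c(2)[OF that(1)]])
  moreover have "d * c \<noteq> 0" using c(1) d(1) by simp
  ultimately show ?thesis by (rule that[rotated])
qed

section \<open>Complex Gaussian integrals\<close>

lemma integrable_gaussian:
  assumes "a > 0"
  shows "integrable lborel (\<lambda>s :: real. exp (- (a * s\<^sup>2)))"
proof -
  have "integrable lborel (\<lambda>s. sqrt (2 * pi * (1 / (2 * a))) * normal_density 0 (sqrt (1 / (2 * a))) s)"
    by (intro integrable_mult_right integrable_normal_density) (use assms in auto)
  also have "(\<lambda>s. sqrt (2 * pi * (1 / (2 * a))) * normal_density 0 (sqrt (1 / (2 * a))) s) = (\<lambda>s. exp (- (a * s\<^sup>2)))"
    using assms by (auto simp: normal_density_def field_simps)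
  finally show ?thesis .
qed

lemma power_le_fact_exp:
  fixes x :: real
  assumes "x \<ge> 0"
  shows "x ^ k \<le> fact k * exp x"
proof -
  have "(\<Sum>n\<in>{k}. x ^ n /\<^sub>R fact n) \<le> (\<Sum>n. x ^ n /\<^sub>R fact n)"
    by (rule sum_le_suminf) (use assms summable_exp_generic[of x] in auto)
  then have "x ^ k / fact k \<le> exp x" by (simp add: exp_def divide_inverse mult.commute)
  then show ?thesis by (simp add: field_simps)
qed

text \<open>Half of the Gaussian decay absorbs both the polynomial and the factor \<open>exp \<bar>s\<bar>\<close>; the latter arises
  from the displacement of \<open>\<zeta>\<close> off the point \<open>cos \<theta>\<close>.\<close>
lemma gaussian_dominates:
  fixes a s :: real
  assumes "a > 0"
  shows "(1 + \<bar>s\<bar>) ^ k * exp (- (a * s\<^sup>2) + \<bar>s\<bar>) \<le> fact k * exp (1 + 2 / a) * exp (- (a / 2 * s\<^sup>2))"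
proof -
  have "(1 + \<bar>s\<bar>) ^ k \<le> fact k * exp (1 + \<bar>s\<bar>)"
    by (rule power_le_fact_exp) simp
  then have "(1 + \<bar>s\<bar>) ^ k * exp (- (a * s\<^sup>2) + \<bar>s\<bar>) \<le> fact k * exp (1 + \<bar>s\<bar>) * exp (- (a * s\<^sup>2) + \<bar>s\<bar>)"
    by (rule mult_right_mono) simp
  also have "\<dots> = fact k * exp (1 + 2 * \<bar>s\<bar> - a * s\<^sup>2)"
    by (simp add: exp_add exp_diff exp_minus field_simps flip: exp_add)
  also have "\<dots> \<le> fact k * exp (1 + 2 / a - a / 2 * s\<^sup>2)"
  proof -
    have "0 \<le> (a * \<bar>s\<bar> - 2)\<^sup>2 / (2 * a)" using assms by simp
    also have "\<dots> = a / 2 * s\<^sup>2 + 2 / a - 2 * \<bar>s\<bar>"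
      using assms by (simp add: power2_diff power_mult_distrib field_simps power2_eq_square)
    finally show ?thesis by (intro mult_left_mono) auto
  qed
  also have "\<dots> = fact k * exp (1 + 2 / a) * exp (- (a / 2 * s\<^sup>2))"
    by (simp add: exp_add[symmetric] mult.assoc)
  finally show ?thesis .
qed

lemma integrable_poly_gaussian:
  assumes "a > 0"
  shows "integrable lborel (\<lambda>s :: real. (1 + \<bar>s\<bar>) ^ k * exp (- (a * s\<^sup>2) + \<bar>s\<bar>))"
proof (rule Bochner_Integration.integrable_bound)
  show "integrable lborel (\<lambda>s. fact k * exp (1 + 2 / a) * exp (- (a / 2 * s\<^sup>2)))"
    using integrable_gaussian[of "a / 2"] assms by simp
  show "AE s in lborel. norm ((1 + \<bar>s\<bar>) ^ k * exp (- (a * s\<^sup>2) + \<bar>s\<bar>)) \<le> norm (fact k * exp (1 + 2 / a) * exp (- (a / 2 * s\<^sup>2)))"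
    using gaussian_dominates[OF assms, of _ k] by (simp add: abs_mult)
qed simp

lemma poly_norm_le:
  fixes p :: "complex poly"
  obtains C where "C \<ge> 0" "\<And>s x. cmod x \<le> s \<Longrightarrow> cmod (poly p x) \<le> C * (1 + s) ^ degree p"
proof (rule that[of "\<Sum>i\<le>degree p. cmod (coeff p i)"])
  fix s x assume x: "cmod x \<le> s"
  then have s: "s \<ge> 0" using norm_ge_zero order_trans by blast
  have "cmod (poly p x) \<le> (\<Sum>i\<le>degree p. cmod (coeff p i * x ^ i))"
    unfolding poly_altdef by (rule norm_sum)
  also have "\<dots> \<le> (\<Sum>i\<le>degree p. cmod (coeff p i) * (1 + s) ^ degree p)"
  proof (intro sum_mono)
    fix i assume "i \<in> {..degree p}"
    have "cmod x ^ i \<le> (1 + s) ^ i" using x by (intro power_mono) auto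
    also have "\<dots> \<le> (1 + s) ^ degree p" using \<open>i \<in> _\<close> s by (intro power_increasing) auto
    finally show "cmod (coeff p i * x ^ i) \<le> cmod (coeff p i) * (1 + s) ^ degree p"
      by (simp add: norm_mult norm_power mult_left_mono)
  qed
  finally show "cmod (poly p x) \<le> (\<Sum>i\<le>degree p. cmod (coeff p i)) * (1 + s) ^ degree p"
    by (simp add: sum_distrib_right)
qed (simp add: sum_nonneg)

text \<open>Reduces integrals over the line to segments, where the fundamental theorem of calculus applies.\<close>
lemma integral_exhaust:
  fixes q :: "real \<Rightarrow> complex"
  assumes "integrable lborel q"
  shows "(\<lambda>n. \<integral>s. indicator {- real n..real n} s *\<^sub>R q s \<partial>lborel) \<longlonglongrightarrow> (\<integral>s. q s \<partial>lborel)"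
proof (rule integral_dominated_convergence[where w = "\<lambda>s. norm (q s)"])
  show "AE s in lborel. (\<lambda>n. indicator {- real n..real n} s *\<^sub>R q s) \<longlonglongrightarrow> q s"
  proof (rule AE_I2, rule tendsto_eventually)
    fix s :: real
    show "\<forall>\<^sub>F n in sequentially. indicator {- real n..real n} s *\<^sub>R q s = q s"
      using eventually_ge_at_top[of "nat \<lceil>\<bar>s\<bar>\<rceil>"]
      by eventually_elim (auto simp: indicator_def abs_le_iff ceiling_le_iff nat_le_iff)
  qed
qed (use assms in \<open>auto simp: indicator_def intro: borel_measurable_integrable\<close>)

definition gauss :: "complex \<Rightarrow> real \<Rightarrow> complex" where
  "gauss c s = exp (- (c * (of_real s)\<^sup>2 / 2))"

lemma norm_gauss: "cmod (gauss c s) = exp (- (Re c / 2 * s\<^sup>2))"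
  by (simp add: gauss_def flip: of_real_power)

lemma gauss_measurable [measurable]: "gauss c \<in> borel_measurable borel"
  unfolding gauss_def[abs_def] by (intro borel_measurable_continuous_onI continuous_intros) auto

lemma integrable_poly_gauss:
  assumes "Re c > 0"
  shows "integrable lborel (\<lambda>s. poly p (of_real s) * gauss c s)"
proof -
  obtain C where C: "C \<ge> 0" "\<And>s x. cmod x \<le> s \<Longrightarrow> cmod (poly p x) \<le> C * (1 + s) ^ degree p"
    using poly_norm_le by blast
  show ?thesis
  proof (rule Bochner_Integration.integrable_bound)
    show "integrable lborel (\<lambda>s. C * ((1 + \<bar>s\<bar>) ^ degree p * exp (- (Re c / 2 * s\<^sup>2) + \<bar>s\<bar>)))"
      by (intro integrable_mult_right integrable_poly_gaussian) (use assms in auto)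
    show "AE s in lborel. norm (poly p (of_real s) * gauss c s)
        \<le> norm (C * ((1 + \<bar>s\<bar>) ^ degree p * exp (- (Re c / 2 * s\<^sup>2) + \<bar>s\<bar>)))"
    proof (rule AE_I2)
      fix s :: real
      have "norm (poly p (of_real s) * gauss c s) \<le> (C * (1 + \<bar>s\<bar>) ^ degree p) * exp (- (Re c / 2 * s\<^sup>2) + \<bar>s\<bar>)"
        unfolding norm_mult norm_gauss using C(2)[of "of_real s" "\<bar>s\<bar>"] C(1)
        by (intro mult_mono) auto
      also have "\<dots> = norm (C * ((1 + \<bar>s\<bar>) ^ degree p * exp (- (Re c / 2 * s\<^sup>2) + \<bar>s\<bar>)))"
        using C(1) by (simp add: abs_mult)
      finally show "norm (poly p (of_real s) * gauss c s)
        \<le> norm (C * ((1 + \<bar>s\<bar>) ^ degree p * exp (- (Re c / 2 * s\<^sup>2) + \<bar>s\<bar>)))" .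
    qed
    have "continuous_on UNIV (\<lambda>s :: real. poly p (of_real s :: complex))" by (intro continuous_intros)
    then have [measurable]: "(\<lambda>s :: real. poly p (of_real s :: complex)) \<in> borel_measurable borel"
      by (rule borel_measurable_continuous_onI)
    show "(\<lambda>s. poly p (of_real s) * gauss c s) \<in> borel_measurable lborel" by measurable
  qed
qed

text \<open>The precision \<open>c\<close> is complex with positive real part. The integral is not normalised, so its value
  at \<open>1\<close> carries the phase of \<open>c\<^bsup>-1/2\<^esup>\<close>.\<close>
definition gaussian_mean :: "complex \<Rightarrow> complex poly \<Rightarrow> complex" where
  "gaussian_mean c p = (\<integral>s. poly p (of_real s) * gauss c s \<partial>lborel)"

lemma gaussian_mean_add: "Re c > 0 \<Longrightarrow> gaussian_mean c (p + q) = gaussian_mean c p + gaussian_mean c q"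
  by (simp add: gaussian_mean_def distrib_right integrable_poly_gauss)

lemma gaussian_mean_diff: "Re c > 0 \<Longrightarrow> gaussian_mean c (p - q) = gaussian_mean c p - gaussian_mean c q"
  by (simp add: gaussian_mean_def left_diff_distrib integrable_poly_gauss)

lemma gaussian_mean_smult: "gaussian_mean c (Polynomial.smult k p) = k * gaussian_mean c p"
  by (simp add: gaussian_mean_def mult.assoc)

text \<open>Integration by parts; the boundary terms decay.\<close>
lemma gaussian_mean_pderiv:
  assumes "Re c > 0"
  shows "gaussian_mean c (pderiv p) = c * gaussian_mean c ([:0, 1:] * p)"
proof -
  define U where "U s = poly p (of_real s) * gauss c s" for s :: real
  define u where "u s = poly (pderiv p - Polynomial.smult c ([:0, 1:] * p)) (of_real s) * gauss c s" for s :: real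
  have U: "(U has_vector_derivative u s) (at s within S)" for s S
  proof -
    have "((\<lambda>w. poly p w * exp (- (c * w\<^sup>2 / 2))) has_field_derivative u s) (at (of_real s))"
      by (rule derivative_eq_intros poly_DERIV | simp)+ (simp add: u_def gauss_def algebra_simps)
    from has_vector_derivative_real_field[OF this] show ?thesis
      unfolding U_def[abs_def] gauss_def[abs_def] by simp
  qed
  have "(\<lambda>n. \<integral>s. indicator {- real n..real n} s *\<^sub>R u s \<partial>lborel) \<longlonglongrightarrow> (\<integral>s. u s \<partial>lborel)"
    unfolding u_def by (intro integral_exhaust integrable_poly_gauss assms)
  moreover have "(\<integral>s. indicator {- real n..real n} s *\<^sub>R u s \<partial>lborel) = U (real n) - U (- real n)" for n
    by (rule integral_FTC_atLeastAtMost[OF _ U])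
       (auto intro!: continuous_intros simp: u_def gauss_def)
  moreover have "(\<lambda>n. U (real n) - U (- real n)) \<longlonglongrightarrow> 0 - 0"
  proof -
    obtain C where C: "C \<ge> 0" "\<And>s x. cmod x \<le> s \<Longrightarrow> cmod (poly p x) \<le> C * (1 + s) ^ degree p"
      using poly_norm_le by blast
    have bd: "cmod (U s) \<le> C * (fact (degree p) * exp (1 + 2 / (Re c / 2)) * exp (- (Re c / 2 / 2 * s\<^sup>2)))" for s
    proof -
      have "cmod (U s) \<le> (C * (1 + \<bar>s\<bar>) ^ degree p) * exp (- (Re c / 2 * s\<^sup>2) + \<bar>s\<bar>)"
        unfolding U_def norm_mult norm_gauss using C(2)[of "of_real s" "\<bar>s\<bar>"] C(1)
        by (intro mult_mono) auto
      also have "\<dots> \<le> C * (fact (degree p) * exp (1 + 2 / (Re c / 2)) * exp (- (Re c / 2 / 2 * s\<^sup>2)))"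
        unfolding mult.assoc[of C] using assms C(1) by (intro mult_left_mono gaussian_dominates) auto
      finally show ?thesis .
    qed
    have lim: "(\<lambda>n. C * (fact (degree p) * exp (1 + 2 / (Re c / 2)) * exp (- (Re c / 2 / 2 * (real n)\<^sup>2)))) \<longlonglongrightarrow> 0"
      using assms by real_asymp
    show ?thesis
      by (intro tendsto_diff Lim_null_comparison[OF _ lim] always_eventually allI)
         (use bd[of "real _"] bd[of "- real _"] in simp_all)
  qed
  ultimately have "(\<integral>s. u s \<partial>lborel) = 0" using LIMSEQ_unique by fastforce
  then have "gaussian_mean c (pderiv p - Polynomial.smult c ([:0, 1:] * p)) = 0"
    by (simp add: gaussian_mean_def u_def)
  then show ?thesis using assms by (simp only: gaussian_mean_diff gaussian_mean_smult) simp
qed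

text \<open>Rotating the line of integration by \<open>\<mu>\<close>: with a primitive of \<open>exp (- w\<^sup>2 / 2)\<close> the integrals over
  \<open>[-R, R]\<close> and \<open>\<mu> [-R, R]\<close> differ by two short differences, and the segments joining \<open>\<plusminus>R\<close> to \<open>\<plusminus>\<mu> R\<close> stay
  in the sector where \<open>exp (- w\<^sup>2 / 2)\<close> decays. Stated with a square root \<open>\<mu>\<close> of the precision, this
  fixes the branch.\<close>
lemma gaussian_mean_one:
  assumes "\<bar>Im \<mu>\<bar> < Re \<mu>"
  shows "gaussian_mean (\<mu>\<^sup>2) 1 = of_real (sqrt (2 * pi)) / \<mu>"
proof -
  have Re_sq: "Re (w\<^sup>2) = (Re w - \<bar>Im w\<bar>) * (Re w + \<bar>Im w\<bar>)" for w
    by (simp add: power2_eq_square algebra_simps)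
  have pos: "Re (\<mu>\<^sup>2) > 0" unfolding Re_sq using assms by (intro mult_pos_pos) auto
  have mu0: "\<mu> \<noteq> 0" using assms by auto
  have hol: "(\<lambda>w :: complex. exp (- w\<^sup>2 / 2)) holomorphic_on UNIV"
    by (intro holomorphic_intros) auto
  obtain P :: "complex \<Rightarrow> complex" where P: "\<And>w. (P has_field_derivative exp (- w\<^sup>2 / 2)) (at w)"
    by (rule holomorphic_convex_primitive'[OF convex_UNIV open_UNIV hol]) (rule that, simp)
  have int: "(\<integral>s. indicator {- real n..real n} s *\<^sub>R gauss (k\<^sup>2) s \<partial>lborel) = (P (k * n) - P (- (k * n))) / k"
    if "k \<noteq> 0" for k :: complex and n :: nat
  proof -
    have "((\<lambda>s. P (k * of_real s) / k) has_vector_derivative gauss (k\<^sup>2) s) (at s within S)" for s S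
    proof -
      have "((\<lambda>w. P (k * w) / k) has_field_derivative gauss (k\<^sup>2) s) (at (of_real s))"
        using that by (auto intro!: derivative_eq_intros DERIV_chain2[OF P] simp: gauss_def power_mult_distrib)
      from has_vector_derivative_real_field[OF this] show ?thesis by simp
    qed
    then have "(\<integral>s. indicator {- real n..real n} s *\<^sub>R gauss (k\<^sup>2) s \<partial>lborel) =
        P (k * of_real (real n)) / k - P (k * of_real (- real n)) / k"
      by (intro integral_FTC_atLeastAtMost) (auto intro!: continuous_intros simp: gauss_def)
    then show ?thesis by (simp add: diff_divide_distrib)
  qed
  define d where "d = min 1 (Re \<mu> - \<bar>Im \<mu>\<bar>)"
  have d: "d > 0" using assms by (simp add: d_def)
  have close: "cmod (P (r * \<mu>) - P r) \<le> exp (- (d\<^sup>2 * r\<^sup>2 / 2)) * (\<bar>r\<bar> * cmod (\<mu> - 1))" for r :: real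
  proof -
    let ?S = "closed_segment (of_real r) (of_real r * \<mu>)"
    have "cmod (exp (- w\<^sup>2 / 2)) \<le> exp (- (d\<^sup>2 * r\<^sup>2 / 2))" if "w \<in> ?S" for w
    proof -
      from that obtain t :: real where t: "0 \<le> t" "t \<le> 1" "w = of_real r * (of_real (1 - t) + of_real t * \<mu>)"
        by (auto simp: in_segment scaleR_conv_of_real algebra_simps)
      define v where "v = of_real (1 - t) + of_real t * \<mu>"
      have "(1 - t) * d + t * d \<le> (1 - t) * 1 + t * (Re \<mu> - \<bar>Im \<mu>\<bar>)"
        using t(1,2) by (intro add_mono mult_left_mono) (auto simp: d_def)
      then have "d \<le> Re v - \<bar>Im v\<bar>" using t(1,2) by (simp add: v_def abs_mult algebra_simps)
      then have "d * d \<le> Re (v\<^sup>2)" unfolding Re_sq using d by (intro mult_mono) auto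
      then have "r\<^sup>2 * d\<^sup>2 \<le> r\<^sup>2 * Re (v\<^sup>2)" by (intro mult_left_mono) (auto simp: power2_eq_square)
      moreover have "Re (w\<^sup>2) = r\<^sup>2 * Re (v\<^sup>2)"
        unfolding t(3) v_def[symmetric] by (simp add: power_mult_distrib flip: of_real_power)
      ultimately show ?thesis by (simp add: mult.commute)
    qed
    then have "cmod (P (r * \<mu>) - P r) \<le> exp (- (d\<^sup>2 * r\<^sup>2 / 2)) * cmod (r * \<mu> - r)"
      by (intro field_differentiable_bound[of ?S P "\<lambda>w. exp (- w\<^sup>2 / 2)"])
         (simp_all only: convex_closed_segment ends_in_segment has_field_derivative_at_within[OF P])
    also have "cmod (r * \<mu> - r) = \<bar>r\<bar> * cmod (\<mu> - 1)"
      using norm_mult[of "of_real r" "\<mu> - 1"] by (simp add: algebra_simps)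
    finally show ?thesis .
  qed
  have lim0: "(\<lambda>n. P (real n * \<mu>) - P (real n) - (P (- (real n) * \<mu>) - P (- real n))) \<longlonglongrightarrow> 0 - 0"
  proof -
    have lim: "(\<lambda>n. exp (- (d\<^sup>2 * (real n)\<^sup>2 / 2)) * (real n * cmod (\<mu> - 1))) \<longlonglongrightarrow> 0"
      using d by real_asymp
    show ?thesis
      by (intro tendsto_diff Lim_null_comparison[OF _ lim] always_eventually allI)
         (use close[of "real _"] close[of "- real _"] in simp_all)
  qed
  have limmu: "(\<lambda>n. (P (\<mu> * real n) - P (- (\<mu> * real n))) / \<mu>) \<longlonglongrightarrow> gaussian_mean (\<mu>\<^sup>2) 1"
    using integral_exhaust[OF integrable_poly_gauss[OF pos, of 1]] int[OF mu0]
    by (simp add: gaussian_mean_def)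
  have lim1: "(\<lambda>n. (P (1 * real n) - P (- (1 * real n))) / 1) \<longlonglongrightarrow> gaussian_mean (1\<^sup>2) 1"
    using integral_exhaust[OF integrable_poly_gauss[of 1 1]] int[of 1]
    by (simp add: gaussian_mean_def)
  have "(\<lambda>n. \<mu> * ((P (\<mu> * real n) - P (- (\<mu> * real n))) / \<mu>) - (P (1 * real n) - P (- (1 * real n))) / 1)
      \<longlonglongrightarrow> \<mu> * gaussian_mean (\<mu>\<^sup>2) 1 - gaussian_mean (1\<^sup>2) 1"
    by (intro tendsto_intros limmu lim1)
  moreover have "(\<lambda>n. \<mu> * ((P (\<mu> * real n) - P (- (\<mu> * real n))) / \<mu>) - (P (1 * real n) - P (- (1 * real n))) / 1) =
      (\<lambda>n. P (real n * \<mu>) - P (real n) - (P (- (real n) * \<mu>) - P (- real n)))"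
    using mu0 by (auto simp: mult.commute)
  ultimately have "\<mu> * gaussian_mean (\<mu>\<^sup>2) 1 = gaussian_mean (1\<^sup>2) 1"
    using lim0 LIMSEQ_unique by fastforce
  moreover have "gaussian_mean (1\<^sup>2) 1 = of_real (sqrt (2 * pi))"
  proof -
    have "gaussian_mean (1\<^sup>2) 1 = (\<integral>s. of_real (sqrt (2 * pi) * std_normal_density s) \<partial>lborel)"
      unfolding gaussian_mean_def gauss_def std_normal_density_def
      by (intro Bochner_Integration.integral_cong) (auto simp: exp_of_real[symmetric])
    also have "\<dots> = of_real (sqrt (2 * pi))"
      by (subst integral_complex_of_real) simp
    finally show ?thesis .
  qed
  ultimately show ?thesis using mu0 by (simp add: field_simps)
qed

section \<open>The phase on the circle\<close>

lemma abs_sin_ge: "\<bar>x\<bar> \<le> pi / 2 \<Longrightarrow> \<bar>sin x\<bar> \<ge> \<bar>x\<bar> / 3" for x :: real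
proof -
  assume x: "\<bar>x\<bar> \<le> pi / 2"
  have "\<bar>sin x - x\<bar> \<le> \<bar>x\<bar> ^ 3 / 6"
    using Maclaurin_sin_bound[of x 3] by (simp add: eval_nat_numeral sin_coeff_def)
  moreover have "\<bar>x\<bar> ^ 3 \<le> 4 * \<bar>x\<bar>"
  proof -
    have "\<bar>x\<bar>\<^sup>2 \<le> 2\<^sup>2" using x pi_less_4 by (intro power_mono) auto
    then have "\<bar>x\<bar>\<^sup>2 * \<bar>x\<bar> \<le> 4 * \<bar>x\<bar>" by (intro mult_right_mono) auto
    then show ?thesis by (simp add: eval_nat_numeral)
  qed
  ultimately show ?thesis by linarith
qed

text \<open>A bound on the whole half circle, so that one estimate of the weight covers points near to and far from
  the saddle point. The vanishing of \<open>cos t - cos \<theta>\<close> at \<open>t = \<theta>\<close> is simple because \<open>sin ((t + \<theta>) / 2)\<close> stays above \<open>sin \<theta> / 2\<close>.\<close>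
lemma abs_cos_diff_ge:
  assumes "0 \<le> \<theta>" "\<theta> \<le> pi" "0 \<le> t" "t \<le> pi"
  shows "\<bar>cos t - cos \<theta>\<bar> \<ge> sin \<theta> * \<bar>t - \<theta>\<bar> / 6"
proof -
  define A where "A = sin (t / 2)"
  define B where "B = cos (t / 2)"
  define S where "S = sin (\<theta> / 2)"
  define C where "C = cos (\<theta> / 2)"
  have nn: "0 \<le> A" "0 \<le> B" "0 \<le> S" "0 \<le> C"
    unfolding A_def B_def S_def C_def using assms by (auto intro!: sin_ge_zero cos_ge_zero)
  have "A\<^sup>2 + B\<^sup>2 = 1" unfolding A_def B_def by simp
  moreover have "(A + B)\<^sup>2 \<ge> A\<^sup>2 + B\<^sup>2" using nn by (simp add: power2_sum)
  ultimately have AB: "A + B \<ge> 1" using nn by (metis add_nonneg_nonneg one_power2 power2_le_imp_le)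
  have le1: "S \<le> 1" "C \<le> 1" by (simp_all add: S_def C_def)
  have "A * (S * C) \<le> A * C" "B * (S * C) \<le> B * S"
    using nn le1 by (auto intro!: mult_left_mono simp: mult_left_le mult_left_le_one_le)
  moreover have "S * C \<le> (A + B) * (S * C)" using mult_right_mono[OF AB, of "S * C"] nn by simp
  moreover have "sin ((t + \<theta>) / 2) = A * C + B * S"
    by (simp add: A_def B_def S_def C_def add_divide_distrib sin_add)
  moreover have "sin \<theta> = 2 * S * C" using sin_double[of "\<theta> / 2"] by (simp add: S_def C_def)
  ultimately have 1: "sin ((t + \<theta>) / 2) \<ge> sin \<theta> / 2" by (simp add: algebra_simps)
  have 2: "\<bar>sin ((t - \<theta>) / 2)\<bar> \<ge> \<bar>t - \<theta>\<bar> / 6"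
    using abs_sin_ge[of "(t - \<theta>) / 2"] assms by simp
  have s: "sin \<theta> \<ge> 0" using assms by (simp add: sin_ge_zero)
  have "cos t - cos \<theta> = 2 * sin ((t + \<theta>) / 2) * sin ((\<theta> - t) / 2)" by (rule cos_diff_cos)
  then have "\<bar>cos t - cos \<theta>\<bar> = 2 * \<bar>sin ((t + \<theta>) / 2)\<bar> * \<bar>sin ((t - \<theta>) / 2)\<bar>"
    using sin_minus[of "(t - \<theta>) / 2"] by (simp add: abs_mult minus_divide_left)
  also have "\<dots> \<ge> 2 * (sin \<theta> / 2) * (\<bar>t - \<theta>\<bar> / 6)"
    using 1 2 s by (intro mult_mono) auto
  finally show ?thesis by simp
qed

text \<open>The exponent of the weight for \<open>\<zeta> = cos \<theta>\<close> and \<open>N = E / 2\<close>, divided by \<open>E\<close> and normalised to vanish at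
  the saddle point \<open>t = \<theta>\<close>.\<close>
definition phase :: "real \<Rightarrow> real \<Rightarrow> complex" where
  "phase \<theta> t = of_real (cos \<theta>) * (cis t - cis \<theta>) - (cis (2 * t) - cis (2 * \<theta>)) / 4 - \<i> * of_real (t - \<theta>) / 2"

text \<open>Minus the second derivative of \<open>phase \<theta>\<close> at the saddle point, that is, the complex precision of the
  limiting Gaussian.\<close>
definition curv :: "real \<Rightarrow> complex" where
  "curv \<theta> = - \<i> * cis \<theta> * of_real (sin \<theta>)"

lemma Re_curv: "Re (curv \<theta>) = (sin \<theta>)\<^sup>2"
  by (simp add: curv_def power2_eq_square)

text \<open>A negative square: on the circle of this radius the modulus of the weight has its maxima exactly at
  the two saddle points.\<close>
lemma Re_phase: "Re (phase \<theta> t) = - ((cos t - cos \<theta>)\<^sup>2 / 2)"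
  unfolding phase_def using cos_double_cos[of t] cos_double_cos[of \<theta>]
  by (simp add: power2_eq_square field_simps)

lemma cis_taylor1: "cmod (cis x - 1 - \<i> * x) \<le> x\<^sup>2 / 2"
  using iexp_approx1[of x 1] by (simp add: cis_conv_exp eval_nat_numeral algebra_simps)

lemma cis_taylor2: "cmod (cis x - 1 - \<i> * x + (of_real x)\<^sup>2 / 2) \<le> \<bar>x\<bar> ^ 3 / 6"
  using iexp_approx1[of x 2] by (simp add: cis_conv_exp eval_nat_numeral algebra_simps)

lemma cmod_cis_diff_le: "cmod (cis s - cis t) \<le> \<bar>s - t\<bar>"
proof -
  have "cis s - cis t = cis t * (cis (s - t) - 1)" by (simp add: cis_mult algebra_simps)
  then have "cmod (cis s - cis t) = cmod (cis (s - t) - 1)" by (simp add: norm_mult)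
  also have "\<dots> \<le> \<bar>s - t\<bar>" using iexp_approx1[of "s - t" 0] by (simp add: cis_conv_exp)
  finally show ?thesis .
qed

text \<open>The first order term vanishes since \<open>\<theta>\<close> is critical. The remainder is expressed by the remainders of
  \<open>cis x\<close> and \<open>cis (2 * x)\<close>.\<close>
lemma phase_taylor: "cmod (phase \<theta> t + curv \<theta> * of_real ((t - \<theta>)\<^sup>2) / 2) \<le> \<bar>t - \<theta>\<bar> ^ 3 / 2"
proof -
  define x where "x = t - \<theta>"
  define R where "R y = cis y - 1 - \<i> * of_real y + (of_real y)\<^sup>2 / 2" for y
  have cis: "cis y = 1 + \<i> * of_real y - (of_real y)\<^sup>2 / 2 + R y" for y by (simp add: R_def)
  define u where "u = cis \<theta>"
  have t: "cis t = u * cis x" "cis (2 * t) = u\<^sup>2 * cis (2 * x)" "cis (2 * \<theta>) = u\<^sup>2"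
    by (simp_all add: u_def x_def cis_mult power2_eq_square algebra_simps)
  have cs: "of_real (cos \<theta>) * 2 * u = u\<^sup>2 + 1" "of_real (sin \<theta>) * 2 * \<i> * u = u\<^sup>2 - 1"
  proof -
    have c: "of_real (cos \<theta>) * 2 = u + cnj u" "of_real (sin \<theta>) * 2 * \<i> = u - cnj u"
      by (simp_all add: u_def complex_eq_iff)
    have "u * cnj u = 1" by (simp add: u_def cis_cnj cis_mult)
    then show "of_real (cos \<theta>) * 2 * u = u\<^sup>2 + 1" "of_real (sin \<theta>) * 2 * \<i> * u = u\<^sup>2 - 1"
      unfolding c by (simp_all add: power2_eq_square algebra_simps)
  qed
  have "phase \<theta> t + curv \<theta> * of_real ((t - \<theta>)\<^sup>2) / 2 =
      (of_real (cos \<theta>) * 2 * u) * (cis x - 1) / 2 - u\<^sup>2 * (cis (2 * x) - 1) / 4 - \<i> * of_real x / 2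
      - (of_real (sin \<theta>) * 2 * \<i> * u) * (of_real x)\<^sup>2 / 4"
    unfolding phase_def t curv_def u_def[symmetric] by (simp add: x_def field_simps)
  also have "\<dots> = (u\<^sup>2 + 1) / 2 * R x - u\<^sup>2 / 4 * R (2 * x)"
    unfolding cs cis[of x] cis[of "2 * x"] by (simp add: field_simps power2_eq_square)
  also have "cmod \<dots> \<le> 1 * (\<bar>x\<bar> ^ 3 / 6) + 1 / 4 * (\<bar>2 * x\<bar> ^ 3 / 6)"
  proof -
    have "cmod ((u\<^sup>2 + 1) / 2) \<le> 1"
      using norm_triangle_ineq[of "u\<^sup>2" 1] by (simp add: u_def norm_power norm_divide)
    moreover have "cmod (R y) \<le> \<bar>y\<bar> ^ 3 / 6" for y unfolding R_def by (rule cis_taylor2)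
    ultimately have "cmod ((u\<^sup>2 + 1) / 2 * R x) \<le> 1 * (\<bar>x\<bar> ^ 3 / 6)"
      "cmod (u\<^sup>2 / 4 * R (2 * x)) \<le> 1 / 4 * (\<bar>2 * x\<bar> ^ 3 / 6)"
      unfolding norm_mult by (intro mult_mono; simp add: u_def norm_power norm_divide)+
    then show ?thesis by (meson add_mono norm_triangle_ineq4 order_trans)
  qed
  also have "\<dots> = \<bar>x\<bar> ^ 3 / 2" by (simp add: abs_mult power_mult_distrib)
  finally show ?thesis unfolding x_def .
qed

lemma exp_diff_le:
  assumes "Re a \<le> m" "Re b \<le> m"
  shows "cmod (exp a - exp b) \<le> exp m * cmod (a - b)"
proof (rule field_differentiable_bound[of "{w. Re w \<le> m}"])
  show "convex {w. Re w \<le> m}" by (rule convex_halfspace_Re_le)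
qed (use assms in \<open>auto intro!: derivative_eq_intros\<close>)

section \<open>Laplace's method on a half circle\<close>

text \<open>Polynomial growth together with a Lipschitz estimate of the same growth. This is all that the
  comparison with the Gaussian uses, and a single constant covers all Hermite polynomials of bounded
  variance, whose coefficients vary with \<open>\<theta>\<close> and \<open>E\<close>.\<close>
definition polybound :: "real \<Rightarrow> nat \<Rightarrow> (complex \<Rightarrow> complex) \<Rightarrow> bool" where
  "polybound C k A \<longleftrightarrow> C \<ge> 0 \<and> continuous_on UNIV A \<and>
     (\<forall>s x. cmod x \<le> s \<longrightarrow> cmod (A x) \<le> C * (1 + s) ^ k) \<and>
     (\<forall>s x y. cmod x \<le> s \<longrightarrow> cmod y \<le> s \<longrightarrow> cmod (A x - A y) \<le> C * (1 + s) ^ k * cmod (x - y))"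

text \<open>One saddle point \<open>e\<^bsup>i\<theta>\<^esup>\<close> and the values \<open>\<zeta> = cos \<theta> + \<eta>\<close> near it. The number \<open>q\<close> bounds the displacement
  \<open>E \<eta>\<close>; relative errors will be of order \<open>q / \<surd>E\<close>. The offset \<open>\<beta>\<close> of \<open>N\<close> from \<open>E / 2\<close> depends only on \<open>n\<close>,
  and \<open>s0\<close> gives uniformity in \<open>\<theta>\<close>.\<close>
locale saddle =
  fixes E \<theta> q \<beta> s0 :: real and \<eta> :: complex and N :: nat
  assumes s0: "0 < s0" "s0 \<le> sin \<theta>"
    and \<theta>: "0 \<le> \<theta>" "\<theta> \<le> pi"
    and q: "1 \<le> q" "q \<le> sqrt E" "E * cmod \<eta> \<le> q"
    and N: "real N = E / 2 + \<beta>"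
begin

definition "\<epsilon> = 1 / sqrt E"
definition "\<delta> = s0\<^sup>2 / 72"
definition "w = cis \<theta>"
definition "\<zeta> = of_real (cos \<theta>) + \<eta>"
definition "loc t = (cis t - w) / (\<i> * w * of_real \<epsilon>)" for t
definition "X t = of_real E * phase \<theta> t + of_real E * \<eta> * (cis t - w) - \<i> * of_real (\<beta> * (t - \<theta>))" for t
definition "W s = exp (- (\<delta> * s\<^sup>2) + \<bar>s\<bar>)" for s

lemma E_ge1: "E \<ge> 1" using order_trans[OF q(1,2)] by simp
lemma eps: "\<epsilon> > 0" "\<epsilon> \<le> 1" "E * \<epsilon>\<^sup>2 = 1" "q * \<epsilon> \<le> 1" "\<epsilon> \<le> q * \<epsilon>"
  using E_ge1 q by (auto simp: \<epsilon>_def power_divide field_simps)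
lemma delta: "\<delta> > 0" using s0 by (simp add: \<delta>_def)
lemma w0: "w \<noteq> 0" "cmod w = 1" by (simp_all add: w_def)

text \<open>The value at the saddle point is factored out exactly, so only the exponent difference \<open>X\<close>
  has to be estimated.\<close>
lemma circle_weight_ratio: "circle_weight E N \<zeta> t = circle_weight E N \<zeta> \<theta> * exp (X t)"
proof -
  define Y where "Y t = of_real E * (\<zeta> * cis t - cis (2 * t) / 4) - \<i> * of_real ((E / 2 + \<beta>) * t)" for t
  have circle_weight: "circle_weight E N \<zeta> t = exp (Y t)" for t
    unfolding Y_def N[symmetric] circle_weight_def cis_conv_exp[of "- _"] by (simp flip: exp_add)
  have "Y t = Y \<theta> + X t"
    by (simp add: Y_def X_def phase_def \<zeta>_def w_def algebra_simps add_divide_distrib diff_divide_distrib)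
  then show ?thesis unfolding circle_weight by (simp only: exp_add)
qed

text \<open>The displacement term \<open>E \<eta> (e\<^bsup>it\<^esup> - e\<^bsup>i\<theta>\<^esup>)\<close> is at most \<open>q \<epsilon> \<bar>s\<bar>\<close>, hence at most \<open>\<bar>s\<bar>\<close>, in the scaled
  variable \<open>s\<close>. The constant in \<open>\<delta>\<close> is half the square of the constant \<open>s0 / 6\<close> given by \<open>abs_cos_diff_ge\<close>.\<close>
lemma Re_X: 
  assumes "t \<in> {0..pi}" "t = \<theta> + \<epsilon> * s"
  shows "Re (X t) \<le> - (\<delta> * s\<^sup>2) + \<bar>s\<bar>"
proof -
  have ts: "\<bar>t - \<theta>\<bar> = \<epsilon> * \<bar>s\<bar>" using eps assms by (simp add: abs_mult)
  have "s0 * \<bar>t - \<theta>\<bar> / 6 \<le> sin \<theta> * \<bar>t - \<theta>\<bar> / 6"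
    using s0 by (intro divide_right_mono mult_right_mono) auto
  also have "\<dots> \<le> \<bar>cos t - cos \<theta>\<bar>" using abs_cos_diff_ge[of \<theta> t] \<theta> assms by auto
  finally have "(s0 * \<bar>t - \<theta>\<bar> / 6)\<^sup>2 \<le> (cos t - cos \<theta>)\<^sup>2"
    using s0 power_mono[of "s0 * \<bar>t - \<theta>\<bar> / 6" "\<bar>cos t - cos \<theta>\<bar>" 2] by simp
  then have "E * ((s0 * \<bar>t - \<theta>\<bar> / 6)\<^sup>2 / 2) \<le> E * ((cos t - cos \<theta>)\<^sup>2 / 2)"
    using E_ge1 by (intro mult_left_mono) auto
  also have "E * ((s0 * \<bar>t - \<theta>\<bar> / 6)\<^sup>2 / 2) = (E * \<epsilon>\<^sup>2) * (\<delta> * s\<^sup>2)"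
    unfolding ts \<delta>_def by (simp add: power_mult_distrib power_divide)
  finally have 1: "Re (of_real E * phase \<theta> t) \<le> - (\<delta> * s\<^sup>2)"
    unfolding eps(3) by (simp add: Re_phase)
  have "Re (of_real E * \<eta> * (cis t - w)) \<le> cmod (of_real E * \<eta> * (cis t - w))" by (rule complex_Re_le_cmod)
  also have "\<dots> = (E * cmod \<eta>) * cmod (cis t - w)" using E_ge1 by (simp add: norm_mult)
  also have "\<dots> \<le> q * (\<epsilon> * \<bar>s\<bar>)"
    using q E_ge1 cmod_cis_diff_le[of t \<theta>] unfolding w_def ts by (intro mult_mono) auto
  also have "\<dots> \<le> 1 * \<bar>s\<bar>" unfolding mult.assoc[symmetric] using eps by (intro mult_right_mono) auto
  finally show ?thesis using 1 by (simp add: X_def)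
qed

text \<open>The cubic Taylor remainder contributes \<open>E \<epsilon>\<^sup>3 = \<epsilon>\<close>, the displacement \<open>q \<epsilon>\<close> and the offset of \<open>N\<close>
  contributes \<open>\<bar>\<beta>\<bar> \<epsilon>\<close>.\<close>
lemma X_approx:
  assumes "t = \<theta> + \<epsilon> * s"
  shows "cmod (X t - (- (curv \<theta> * (of_real s)\<^sup>2 / 2))) \<le> q * \<epsilon> * (1 + \<bar>\<beta>\<bar>) * (1 + \<bar>s\<bar>) ^ 3"
proof -
  have ts: "\<bar>t - \<theta>\<bar> = \<epsilon> * \<bar>s\<bar>" and ts': "t - \<theta> = \<epsilon> * s" using eps assms by (simp_all add: abs_mult)
  have "X t - (- (curv \<theta> * (of_real s)\<^sup>2 / 2)) =
      of_real E * (phase \<theta> t + curv \<theta> * of_real ((t - \<theta>)\<^sup>2) / 2) + of_real E * \<eta> * (cis t - w) - \<i> * of_real (\<beta> * (t - \<theta>))"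
  proof -
    have "of_real E * (curv \<theta> * of_real ((t - \<theta>)\<^sup>2) / 2) = of_real (E * \<epsilon>\<^sup>2) * (curv \<theta> * (of_real s)\<^sup>2 / 2)"
      unfolding ts' by (simp add: power_mult_distrib)
    then show ?thesis unfolding eps(3) by (auto simp: X_def distrib_left)
  qed
  also have "cmod \<dots> \<le> E * (\<bar>t - \<theta>\<bar> ^ 3 / 2) + q * \<bar>t - \<theta>\<bar> + \<bar>\<beta>\<bar> * \<bar>t - \<theta>\<bar>"
  proof (intro norm_triangle_le_diff norm_triangle_le add_mono)
    show "cmod (of_real E * (phase \<theta> t + curv \<theta> * of_real ((t - \<theta>)\<^sup>2) / 2)) \<le> E * (\<bar>t - \<theta>\<bar> ^ 3 / 2)"
      using E_ge1 phase_taylor[of \<theta> t] by (simp add: norm_mult mult_left_mono)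
    have "cmod (of_real E * \<eta> * (cis t - w)) = (E * cmod \<eta>) * cmod (cis t - w)" using E_ge1 by (simp add: norm_mult)
    also have "\<dots> \<le> q * \<bar>t - \<theta>\<bar>"
      using q E_ge1 cmod_cis_diff_le[of t \<theta>] unfolding w_def by (intro mult_mono) auto
    finally show "cmod (of_real E * \<eta> * (cis t - w)) \<le> q * \<bar>t - \<theta>\<bar>" .
    show "cmod (\<i> * of_real (\<beta> * (t - \<theta>))) \<le> \<bar>\<beta>\<bar> * \<bar>t - \<theta>\<bar>"
      unfolding norm_mult norm_of_real abs_mult by simp
  qed
  also have "E * (\<bar>t - \<theta>\<bar> ^ 3 / 2) = (E * \<epsilon>\<^sup>2) * \<epsilon> * \<bar>s\<bar> ^ 3 / 2"
    unfolding ts by (simp add: power_mult_distrib power2_eq_square eval_nat_numeral)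
  also have "(E * \<epsilon>\<^sup>2) * \<epsilon> * \<bar>s\<bar> ^ 3 / 2 + q * \<bar>t - \<theta>\<bar> + \<bar>\<beta>\<bar> * \<bar>t - \<theta>\<bar>
      \<le> q * \<epsilon> * \<bar>s\<bar> ^ 3 + q * \<epsilon> * \<bar>s\<bar> + q * \<epsilon> * \<bar>\<beta>\<bar> * \<bar>s\<bar>"
  proof (intro add_mono)
    have "\<epsilon> * (\<bar>s\<bar> ^ 3) \<le> (q * \<epsilon>) * \<bar>s\<bar> ^ 3" using eps by (intro mult_right_mono) auto
    moreover have "\<epsilon> * \<bar>s\<bar> ^ 3 / 2 \<le> \<epsilon> * \<bar>s\<bar> ^ 3" using eps by simp
    ultimately show "(E * \<epsilon>\<^sup>2) * \<epsilon> * \<bar>s\<bar> ^ 3 / 2 \<le> q * \<epsilon> * \<bar>s\<bar> ^ 3" unfolding eps(3) by simp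
    have "\<epsilon> * (\<bar>\<beta>\<bar> * \<bar>s\<bar>) \<le> (q * \<epsilon>) * (\<bar>\<beta>\<bar> * \<bar>s\<bar>)" using eps by (intro mult_right_mono) auto
    then show "\<bar>\<beta>\<bar> * \<bar>t - \<theta>\<bar> \<le> q * \<epsilon> * \<bar>\<beta>\<bar> * \<bar>s\<bar>" unfolding ts by (simp add: mult_ac)
  qed (simp add: ts)
  also have "\<dots> = q * \<epsilon> * (\<bar>s\<bar> ^ 3 + \<bar>s\<bar> + \<bar>\<beta>\<bar> * \<bar>s\<bar>)" by (simp add: algebra_simps)
  also have "\<dots> \<le> q * \<epsilon> * ((1 + \<bar>\<beta>\<bar>) * (1 + \<bar>s\<bar>) ^ 3)"
  proof (intro mult_left_mono)
    have "a + a ^ 3 \<le> (1 + a) ^ 3" "a \<le> (1 + a) ^ 3" if "a \<ge> 0" for a :: real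
    proof -
      have "(1 + a) ^ 3 = 1 + 3 * a + 3 * (a * a) + a ^ 3" by (simp add: power3_eq_cube algebra_simps)
      moreover have "a * a \<ge> 0" "a ^ 3 \<ge> 0" using that by auto
      ultimately show "a + a ^ 3 \<le> (1 + a) ^ 3" "a \<le> (1 + a) ^ 3" using that by linarith+
    qed
    from this[of "\<bar>s\<bar>"] have "\<bar>s\<bar> + \<bar>s\<bar> ^ 3 \<le> (1 + \<bar>s\<bar>) ^ 3" and "\<bar>s\<bar> \<le> (1 + \<bar>s\<bar>) ^ 3" by simp_all
    then have "\<bar>s\<bar> ^ 3 + \<bar>s\<bar> + \<bar>\<beta>\<bar> * \<bar>s\<bar> \<le> (1 + \<bar>s\<bar>) ^ 3 + \<bar>\<beta>\<bar> * (1 + \<bar>s\<bar>) ^ 3"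
      by (intro add_mono mult_left_mono) auto
    then show "\<bar>s\<bar> ^ 3 + \<bar>s\<bar> + \<bar>\<beta>\<bar> * \<bar>s\<bar> \<le> (1 + \<bar>\<beta>\<bar>) * (1 + \<bar>s\<bar>) ^ 3" by (simp add: algebra_simps)
  qed (use eps q in auto)
  finally show ?thesis by (simp add: mult.assoc)
qed

lemma gauss_le_W: "cmod (gauss (curv \<theta>) s) \<le> W s"
proof -
  have "s0\<^sup>2 \<le> (sin \<theta>)\<^sup>2" using s0 by (intro power_mono) auto
  then have "\<delta> \<le> (sin \<theta>)\<^sup>2 / 2" using zero_le_power2[of "sin \<theta>"] unfolding \<delta>_def by linarith
  then have "\<delta> * s\<^sup>2 \<le> (sin \<theta>)\<^sup>2 / 2 * s\<^sup>2" by (intro mult_right_mono) auto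
  then show ?thesis by (simp add: norm_gauss W_def Re_curv)
qed

lemma weight_le:
  assumes "t \<in> {0..pi}" "t = \<theta> + \<epsilon> * s"
  shows "cmod (exp (X t)) \<le> W s"
  using Re_X[OF assms] by (simp add: W_def)

lemma weight_diff_le:
  assumes "t \<in> {0..pi}" "t = \<theta> + \<epsilon> * s"
  shows "cmod (exp (X t) - gauss (curv \<theta>) s) \<le> W s * (q * \<epsilon> * (1 + \<bar>\<beta>\<bar>) * (1 + \<bar>s\<bar>) ^ 3)"
proof -
  have "Re (- (curv \<theta> * (of_real s)\<^sup>2 / 2)) \<le> - (\<delta> * s\<^sup>2) + \<bar>s\<bar>"
    using gauss_le_W[of s] by (simp add: gauss_def W_def)
  from exp_diff_le[OF Re_X[OF assms] this]
  have "cmod (exp (X t) - gauss (curv \<theta>) s) \<le> W s * cmod (X t - (- (curv \<theta> * (of_real s)\<^sup>2 / 2)))"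
    by (simp add: gauss_def W_def)
  also have "\<dots> \<le> W s * (q * \<epsilon> * (1 + \<bar>\<beta>\<bar>) * (1 + \<bar>s\<bar>) ^ 3)"
    by (intro mult_left_mono X_approx assms) (simp add: W_def)
  finally show ?thesis .
qed

text \<open>The local coordinate \<open>loc\<close> is affine in \<open>u = e\<^bsup>it\<^esup>\<close>, so that polynomials in it are polynomials in \<open>u\<close>; it
  agrees with the scaled angle \<open>s\<close> up to \<open>O (\<epsilon>)\<close>.\<close>
lemma loc_approx:
  assumes "t = \<theta> + \<epsilon> * s"
  shows "cmod (loc t) \<le> \<bar>s\<bar>" "cmod (loc t - of_real s) \<le> \<epsilon> * s\<^sup>2 / 2"
proof -
  have "loc t * (\<i> * of_real \<epsilon>) = cis (\<epsilon> * s) - 1"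
    unfolding loc_def w_def assms using eps by (simp add: cis_mult[symmetric] field_simps)
  then have l: "loc t = (cis (\<epsilon> * s) - 1) / (\<i> * of_real \<epsilon>)" using eps by (simp add: field_simps)
  have "cmod (cis (\<epsilon> * s) - 1) \<le> \<epsilon> * \<bar>s\<bar>"
    using cmod_cis_diff_le[of "\<epsilon> * s" 0] eps by (simp add: abs_mult)
  then show "cmod (loc t) \<le> \<bar>s\<bar>" unfolding l using eps by (simp add: norm_divide norm_mult field_simps)
  have "loc t - of_real s = (cis (\<epsilon> * s) - 1 - \<i> * of_real (\<epsilon> * s)) / (\<i> * of_real \<epsilon>)"
    unfolding l using eps by (simp add: field_simps)
  then have "cmod (loc t - of_real s) = cmod (cis (\<epsilon> * s) - 1 - \<i> * of_real (\<epsilon> * s)) / \<epsilon>"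
    using eps by (simp add: norm_divide norm_mult)
  also have "\<dots> \<le> (\<epsilon> * s)\<^sup>2 / 2 / \<epsilon>" using eps by (intro divide_right_mono cis_taylor1) auto
  also have "\<dots> = \<epsilon> * s\<^sup>2 / 2" using eps by (simp add: power2_eq_square)
  finally show "cmod (loc t - of_real s) \<le> \<epsilon> * s\<^sup>2 / 2" .
qed

lemma arc_eq_lebesgue:
  assumes "continuous_on {0..pi} Q"
  shows "integral {0..pi} Q = of_real \<epsilon> * (\<integral>s. indicator {0..pi} (\<theta> + \<epsilon> * s) *\<^sub>R Q (\<theta> + \<epsilon> * s) \<partial>lborel)"
    "integrable lborel (\<lambda>s. indicator {0..pi} (\<theta> + \<epsilon> * s) *\<^sub>R Q (\<theta> + \<epsilon> * s) :: complex)"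
proof -
  have si: "set_integrable lborel {0..pi} Q" by (rule borel_integrable_atLeastAtMost'[OF assms])
  have "integral {0..pi} Q = (\<integral>t. indicator {0..pi} t *\<^sub>R Q t \<partial>lborel)"
    using set_borel_integral_eq_integral(2)[OF si] by (simp add: set_lebesgue_integral_def)
  also have "\<dots> = of_real \<epsilon> * (\<integral>s. indicator {0..pi} (\<theta> + \<epsilon> * s) *\<^sub>R Q (\<theta> + \<epsilon> * s) \<partial>lborel)"
    using eps by (subst lborel_integral_real_affine[of \<epsilon> _ \<theta>]) (auto simp: scaleR_conv_of_real)
  finally show "integral {0..pi} Q = of_real \<epsilon> * (\<integral>s. indicator {0..pi} (\<theta> + \<epsilon> * s) *\<^sub>R Q (\<theta> + \<epsilon> * s) \<partial>lborel)" .
  show "integrable lborel (\<lambda>s. indicator {0..pi} (\<theta> + \<epsilon> * s) *\<^sub>R Q (\<theta> + \<epsilon> * s) :: complex)"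
    using si eps unfolding set_integrable_def by (intro lborel_integrable_real_affine) auto
qed

text \<open>The constants of the estimates are multiples of such moments, which depend on \<open>s0\<close> and \<open>k\<close> only.\<close>
definition moment :: "nat \<Rightarrow> real" where
  "moment k = (\<integral>s. (1 + \<bar>s\<bar>) ^ k * W s \<partial>lborel)"

lemma integrable_W: "integrable lborel (\<lambda>s. (1 + \<bar>s\<bar>) ^ k * W s)"
  unfolding W_def by (intro integrable_poly_gaussian delta)

lemma W_pos: "W s > 0" by (simp add: W_def)

text \<open>The crude size of the integral, used where the integrand already carries a small factor.\<close>
lemma arc_bound:
  assumes A: "polybound CA k A" and B: "continuous_on {0..pi} B" "\<And>t. t \<in> {0..pi} \<Longrightarrow> cmod (B t) \<le> CB"
  shows "cmod (integral {0..pi} (\<lambda>t. A (loc t) * B t * circle_weight E N \<zeta> t))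
     \<le> CA * CB * moment k * \<epsilon> * cmod (circle_weight E N \<zeta> \<theta>)"
proof -
  define Q where "Q t = A (loc t) * B t * exp (X t)" for t
  have A': "continuous_on UNIV A" "CA \<ge> 0" "\<And>s x. cmod x \<le> s \<Longrightarrow> cmod (A x) \<le> CA * (1 + s) ^ k"
    using A by (auto simp: polybound_def)
  have CB: "CB \<ge> 0" using order_trans[OF norm_ge_zero B(2)[of 0]] by simp
  have Q: "continuous_on {0..pi} Q"
    unfolding Q_def X_def phase_def loc_def
    by (intro continuous_intros B continuous_on_compose2[OF A'(1)]) (use eps w0 in auto)
  have "integral {0..pi} (\<lambda>t. A (loc t) * B t * circle_weight E N \<zeta> t) = circle_weight E N \<zeta> \<theta> * integral {0..pi} Q"
  proof -
    have "A (loc t) * B t * circle_weight E N \<zeta> t = circle_weight E N \<zeta> \<theta> * Q t" for t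
      unfolding Q_def circle_weight_ratio[of t] by simp
    then show ?thesis by simp
  qed
  then have eq: "cmod (integral {0..pi} (\<lambda>t. A (loc t) * B t * circle_weight E N \<zeta> t)) =
      cmod (circle_weight E N \<zeta> \<theta>) * (\<epsilon> * cmod (\<integral>s. indicator {0..pi} (\<theta> + \<epsilon> * s) *\<^sub>R Q (\<theta> + \<epsilon> * s) \<partial>lborel))"
    unfolding arc_eq_lebesgue(1)[OF Q] using eps by (simp add: norm_mult)
  have "cmod (\<integral>s. indicator {0..pi} (\<theta> + \<epsilon> * s) *\<^sub>R Q (\<theta> + \<epsilon> * s) \<partial>lborel)
      \<le> (\<integral>s. CA * CB * ((1 + \<bar>s\<bar>) ^ k * W s) \<partial>lborel)"
  proof (intro Bochner_Integration.integral_norm_bound_integral arc_eq_lebesgue(2) Q integrable_mult_right integrable_W)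
    fix s :: real
    show "norm (indicator {0..pi} (\<theta> + \<epsilon> * s) *\<^sub>R Q (\<theta> + \<epsilon> * s)) \<le> CA * CB * ((1 + \<bar>s\<bar>) ^ k * W s)"
    proof (cases "\<theta> + \<epsilon> * s \<in> {0..pi}")
      case True
      have "cmod (Q (\<theta> + \<epsilon> * s)) \<le> (CA * (1 + \<bar>s\<bar>) ^ k) * CB * W s"
        unfolding Q_def norm_mult using A'(2) CB
        by (intro mult_mono A' B weight_le True loc_approx) auto
      then show ?thesis using True by (simp add: mult_ac)
    next
      case False
      then show ?thesis using A'(2) CB W_pos[of s] by simp
    qed
  qed
  also have "(\<integral>s. CA * CB * ((1 + \<bar>s\<bar>) ^ k * W s) \<partial>lborel) = CA * CB * moment k"
    by (simp add: moment_def)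
  finally have "cmod (circle_weight E N \<zeta> \<theta>) * (\<epsilon> * cmod (\<integral>s. indicator {0..pi} (\<theta> + \<epsilon> * s) *\<^sub>R Q (\<theta> + \<epsilon> * s) \<partial>lborel))
      \<le> cmod (circle_weight E N \<zeta> \<theta>) * (\<epsilon> * (CA * CB * moment k))"
    using eps by (intro mult_left_mono) auto
  then show ?thesis unfolding eq by (simp add: mult_ac)
qed

text \<open>Here \<open>A\<close> is the part of the integrand that varies on the scale \<open>\<epsilon>\<close> and \<open>B\<close> the part that varies slowly. Three
  replacements, of \<open>loc t\<close> by \<open>s\<close>, of \<open>B t\<close> by \<open>B \<theta>\<close> and of the weight by the Gaussian, each cost a
  factor \<open>q \<epsilon>\<close> at the price of at most three powers of \<open>s\<close>. The part of the Gaussian integral beyond the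
  ends of the half circle is small because the distance of \<open>\<theta>\<close> from the ends is at least \<open>s0\<close>.\<close>
lemma arc_asymp:
  assumes A: "polybound CA k A"
    and B: "continuous_on {0..pi} B" "\<And>t. t \<in> {0..pi} \<Longrightarrow> cmod (B t) \<le> CB"
      "\<And>t. t \<in> {0..pi} \<Longrightarrow> cmod (B t - B \<theta>) \<le> CB * \<bar>t - \<theta>\<bar>"
  shows "cmod (integral {0..pi} (\<lambda>t. A (loc t) * B t * circle_weight E N \<zeta> t)
      - of_real \<epsilon> * circle_weight E N \<zeta> \<theta> * (B \<theta> * (\<integral>s. A (of_real s) * gauss (curv \<theta>) s \<partial>lborel)))
     \<le> CA * CB * (3 + \<bar>\<beta>\<bar> + 1 / s0) * moment (k + 3) * (q * \<epsilon>) * (\<epsilon> * cmod (circle_weight E N \<zeta> \<theta>))"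
proof -
  define Q where "Q t = A (loc t) * B t * exp (X t)" for t
  define L where "L s = B \<theta> * (A (of_real s) * gauss (curv \<theta>) s)" for s
  define D where "D = 3 + \<bar>\<beta>\<bar> + 1 / s0"
  have A': "continuous_on UNIV A" "CA \<ge> 0" "\<And>s x. cmod x \<le> s \<Longrightarrow> cmod (A x) \<le> CA * (1 + s) ^ k"
    "\<And>s x y. cmod x \<le> s \<Longrightarrow> cmod y \<le> s \<Longrightarrow> cmod (A x - A y) \<le> CA * (1 + s) ^ k * cmod (x - y)"
    using A unfolding polybound_def by blast+
  have CB: "CB \<ge> 0" using order_trans[OF norm_ge_zero B(2)[of 0]] by simp
  have B0: "cmod (B \<theta>) \<le> CB" using B(2) \<theta> by simp
  have Q: "continuous_on {0..pi} Q"
    unfolding Q_def X_def phase_def loc_def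
    by (intro continuous_intros B continuous_on_compose2[OF A'(1)]) (use eps w0 in auto)
  have L_le: "cmod (L s) \<le> CA * CB * ((1 + \<bar>s\<bar>) ^ k * W s)" for s
  proof -
    have "cmod (L s) \<le> CB * ((CA * (1 + \<bar>s\<bar>) ^ k) * W s)"
      unfolding L_def norm_mult using A'(2) CB W_pos[of s]
      by (intro mult_mono A'(3) B0 gauss_le_W) auto
    then show ?thesis by (simp only: mult_ac)
  qed
  have L: "integrable lborel L"
  proof (rule Bochner_Integration.integrable_bound)
    show "integrable lborel (\<lambda>s. CA * CB * ((1 + \<bar>s\<bar>) ^ k * W s))"
      by (intro integrable_mult_right integrable_W)
    have "continuous_on UNIV (\<lambda>s :: real. A (of_real s))"
      by (intro continuous_on_compose2[OF A'(1)] continuous_intros) auto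
    then have [measurable]: "(\<lambda>s :: real. A (of_real s)) \<in> borel_measurable borel"
      by (rule borel_measurable_continuous_onI)
    show "L \<in> borel_measurable lborel" unfolding L_def by measurable
    show "AE s in lborel. norm (L s) \<le> norm (CA * CB * ((1 + \<bar>s\<bar>) ^ k * W s))"
      using L_le A'(2) CB less_imp_le[OF W_pos] by (intro AE_I2) (simp add: abs_mult)
  qed
  define S where "S = (\<integral>s. indicator {0..pi} (\<theta> + \<epsilon> * s) *\<^sub>R Q (\<theta> + \<epsilon> * s) \<partial>lborel)"
  define T where "T = (\<integral>s. A (of_real s) * gauss (curv \<theta>) s \<partial>lborel)"
  have "integral {0..pi} (\<lambda>t. A (loc t) * B t * circle_weight E N \<zeta> t) = circle_weight E N \<zeta> \<theta> * integral {0..pi} Q"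
  proof -
    have "A (loc t) * B t * circle_weight E N \<zeta> t = circle_weight E N \<zeta> \<theta> * Q t" for t
      unfolding Q_def circle_weight_ratio[of t] by simp
    then show ?thesis by simp
  qed
  moreover have factor: "x * (e * y) - e * x * v = e * x * (y - v)" for x y e v :: complex
    by (simp add: algebra_simps)
  ultimately have "integral {0..pi} (\<lambda>t. A (loc t) * B t * circle_weight E N \<zeta> t) - of_real \<epsilon> * circle_weight E N \<zeta> \<theta> * (B \<theta> * T)
      = (of_real \<epsilon> * circle_weight E N \<zeta> \<theta>) * (S - B \<theta> * T)"
    unfolding arc_eq_lebesgue(1)[OF Q] S_def[symmetric] by (simp only: factor)
  then have eq: "cmod (integral {0..pi} (\<lambda>t. A (loc t) * B t * circle_weight E N \<zeta> t) - of_real \<epsilon> * circle_weight E N \<zeta> \<theta> * (B \<theta> * T))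
      = \<epsilon> * cmod (circle_weight E N \<zeta> \<theta>) * cmod (S - B \<theta> * T)"
    using eps by (simp add: norm_mult)
  have "B \<theta> * T = (\<integral>s. L s \<partial>lborel)" by (simp add: L_def T_def)
  then have "S - B \<theta> * T = (\<integral>s. indicator {0..pi} (\<theta> + \<epsilon> * s) *\<^sub>R Q (\<theta> + \<epsilon> * s) - L s \<partial>lborel)"
    unfolding S_def by (simp add: arc_eq_lebesgue(2)[OF Q] L)
  then have "cmod (S - B \<theta> * T) = cmod (\<integral>s. indicator {0..pi} (\<theta> + \<epsilon> * s) *\<^sub>R Q (\<theta> + \<epsilon> * s) - L s \<partial>lborel)"
    by (rule arg_cong)
  also have "\<dots> \<le> (\<integral>s. (CA * CB * D * (q * \<epsilon>)) * ((1 + \<bar>s\<bar>) ^ (k + 3) * W s) \<partial>lborel)"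
  proof (intro Bochner_Integration.integral_norm_bound_integral Bochner_Integration.integrable_diff
      arc_eq_lebesgue(2) Q L integrable_mult_right integrable_W)
    fix s :: real
    define t where "t = \<theta> + \<epsilon> * s"
    define Z where "Z = CA * CB * (1 + \<bar>s\<bar>) ^ k * W s"
    have Z: "Z \<ge> 0" using A'(2) CB W_pos[of s] by (simp add: Z_def)
    have goal: "(CA * CB * D * (q * \<epsilon>)) * ((1 + \<bar>s\<bar>) ^ (k + 3) * W s) = Z * (q * \<epsilon> * (D * (1 + \<bar>s\<bar>) ^ 3))"
      by (simp add: Z_def power_add)
    have s1: "\<bar>s\<bar> \<le> (1 + \<bar>s\<bar>) ^ 3" "s\<^sup>2 \<le> (1 + \<bar>s\<bar>) ^ 3"
    proof -
      have "\<bar>s\<bar> \<le> (1 + \<bar>s\<bar>) ^ 1" by simp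
      also have "\<dots> \<le> (1 + \<bar>s\<bar>) ^ 3" by (rule power_increasing) auto
      finally show "\<bar>s\<bar> \<le> (1 + \<bar>s\<bar>) ^ 3" .
      have "s\<^sup>2 \<le> (1 + \<bar>s\<bar>)\<^sup>2" by (subst power2_abs[symmetric], rule power_mono) auto
      also have "\<dots> \<le> (1 + \<bar>s\<bar>) ^ 3" by (rule power_increasing) auto
      finally show "s\<^sup>2 \<le> (1 + \<bar>s\<bar>) ^ 3" .
    qed
    show "norm (indicator {0..pi} (\<theta> + \<epsilon> * s) *\<^sub>R Q (\<theta> + \<epsilon> * s) - L s)
        \<le> (CA * CB * D * (q * \<epsilon>)) * ((1 + \<bar>s\<bar>) ^ (k + 3) * W s)"
    proof (cases "t \<in> {0..pi}")
      case True
      have ts: "\<bar>t - \<theta>\<bar> = \<epsilon> * \<bar>s\<bar>" using eps by (simp add: t_def abs_mult)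
      note loc = loc_approx[OF t_def]
      have collect: "ca * p * x * cb * v + (ca * p) * (cb * y) * v + (ca * p) * cb * (v * (a * b * r)) =
          ca * cb * p * v * (x + y + a * (b * r))" for ca cb p v x y a b r :: real
        by (simp add: algebra_simps)
      have split_diff: "a * b * e - b0 * (a0 * e0) = (a - a0) * b * e + a0 * (b - b0) * e + a0 * b0 * (e - e0)"
        for a b e a0 b0 e0 :: complex
        by (simp add: algebra_simps)
      have "Q t - L s = (A (loc t) - A (of_real s)) * B t * exp (X t) + A (of_real s) * (B t - B \<theta>) * exp (X t)
          + A (of_real s) * B \<theta> * (exp (X t) - gauss (curv \<theta>) s)"
        unfolding Q_def L_def by (rule split_diff)
      also have "cmod \<dots> \<le> (CA * (1 + \<bar>s\<bar>) ^ k * (\<epsilon> * s\<^sup>2 / 2)) * CB * W s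
          + (CA * (1 + \<bar>s\<bar>) ^ k) * (CB * (\<epsilon> * \<bar>s\<bar>)) * W s
          + (CA * (1 + \<bar>s\<bar>) ^ k) * CB * (W s * (q * \<epsilon> * (1 + \<bar>\<beta>\<bar>) * (1 + \<bar>s\<bar>) ^ 3))"
      proof (intro norm_triangle_le add_mono)
        have "cmod (A (loc t) - A (of_real s)) \<le> CA * (1 + \<bar>s\<bar>) ^ k * cmod (loc t - of_real s)"
          by (rule A'(4)) (use loc in auto)
        also have "\<dots> \<le> CA * (1 + \<bar>s\<bar>) ^ k * (\<epsilon> * s\<^sup>2 / 2)"
          using A'(2) by (intro mult_left_mono loc) auto
        finally show "cmod ((A (loc t) - A (of_real s)) * B t * exp (X t)) \<le> (CA * (1 + \<bar>s\<bar>) ^ k * (\<epsilon> * s\<^sup>2 / 2)) * CB * W s"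
          unfolding norm_mult using A'(2) CB eps
          by (intro mult_mono B weight_le[OF True t_def] True) auto
        show "cmod (A (of_real s) * (B t - B \<theta>) * exp (X t)) \<le> (CA * (1 + \<bar>s\<bar>) ^ k) * (CB * (\<epsilon> * \<bar>s\<bar>)) * W s"
          unfolding norm_mult using A'(2) CB eps B(3)[OF True, unfolded ts]
          by (intro mult_mono A'(3) weight_le[OF True t_def]) auto
        show "cmod (A (of_real s) * B \<theta> * (exp (X t) - gauss (curv \<theta>) s))
            \<le> (CA * (1 + \<bar>s\<bar>) ^ k) * CB * (W s * (q * \<epsilon> * (1 + \<bar>\<beta>\<bar>) * (1 + \<bar>s\<bar>) ^ 3))"
          unfolding norm_mult using A'(2) CB eps
          by (intro mult_mono A'(3) weight_diff_le[OF True t_def] B0) auto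
      qed
      also have "\<dots> = Z * (\<epsilon> * s\<^sup>2 / 2 + \<epsilon> * \<bar>s\<bar> + (q * \<epsilon>) * ((1 + \<bar>\<beta>\<bar>) * (1 + \<bar>s\<bar>) ^ 3))"
        unfolding Z_def by (rule collect)
      also have "\<dots> \<le> Z * (q * \<epsilon> * (1 + \<bar>s\<bar>) ^ 3 + q * \<epsilon> * (1 + \<bar>s\<bar>) ^ 3 + q * \<epsilon> * ((1 + \<bar>\<beta>\<bar>) * (1 + \<bar>s\<bar>) ^ 3))"
      proof (rule mult_left_mono[OF _ Z], rule add_mono[OF add_mono order_refl])
        have "\<epsilon> * s\<^sup>2 \<le> (q * \<epsilon>) * (1 + \<bar>s\<bar>) ^ 3" using eps s1 by (intro mult_mono) auto
        moreover have "\<epsilon> * s\<^sup>2 \<ge> 0" using eps by simp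
        ultimately show "\<epsilon> * s\<^sup>2 / 2 \<le> q * \<epsilon> * (1 + \<bar>s\<bar>) ^ 3" by linarith
        show "\<epsilon> * \<bar>s\<bar> \<le> (q * \<epsilon>) * (1 + \<bar>s\<bar>) ^ 3" using eps s1 by (intro mult_mono) auto
      qed
      also have "\<dots> = Z * (q * \<epsilon> * ((3 + \<bar>\<beta>\<bar>) * (1 + \<bar>s\<bar>) ^ 3))" by (simp add: algebra_simps)
      also have "\<dots> \<le> Z * (q * \<epsilon> * (D * (1 + \<bar>s\<bar>) ^ 3))"
        using eps Z q s0 by (intro mult_left_mono mult_right_mono) (auto simp: D_def)
      finally show ?thesis using True unfolding goal by (simp add: t_def)
    next
      case False
      have "s0 \<le> \<epsilon> * \<bar>s\<bar>"
      proof -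
        have "sin \<theta> \<le> \<theta>" using \<theta> by (intro sin_x_le_x) auto
        moreover have "sin \<theta> \<le> pi - \<theta>" using \<theta> sin_x_le_x[of "pi - \<theta>"] by simp
        moreover have "\<theta> < \<epsilon> * \<bar>s\<bar> \<or> pi - \<theta> < \<epsilon> * \<bar>s\<bar>"
        proof -
          have "\<epsilon> * \<bar>s\<bar> = \<bar>\<epsilon> * s\<bar>" using eps by (simp add: abs_mult)
          moreover have "\<theta> + \<epsilon> * s < 0 \<or> \<theta> + \<epsilon> * s > pi" using False by (auto simp: t_def)
          ultimately show ?thesis by linarith
        qed
        ultimately show ?thesis using s0 by linarith
      qed
      then have "1 \<le> \<epsilon> * \<bar>s\<bar> / s0" using s0 by simp
      also have "\<dots> = \<epsilon> * (1 / s0 * \<bar>s\<bar>)" by simp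
      also have "\<dots> \<le> (q * \<epsilon>) * (D * (1 + \<bar>s\<bar>) ^ 3)"
        using eps s0 s1 q by (intro mult_mono) (auto simp: D_def)
      finally have "Z * 1 \<le> Z * (q * \<epsilon> * (D * (1 + \<bar>s\<bar>) ^ 3))" using Z by (rule mult_left_mono)
      moreover have "cmod (L s) \<le> Z" using L_le[of s] by (simp add: Z_def mult_ac)
      ultimately show ?thesis using False unfolding goal by (simp add: t_def)
    qed
  qed
  also have "\<dots> = CA * CB * D * (q * \<epsilon>) * moment (k + 3)" by (simp add: moment_def)
  finally have "\<epsilon> * cmod (circle_weight E N \<zeta> \<theta>) * cmod (S - B \<theta> * T)
      \<le> \<epsilon> * cmod (circle_weight E N \<zeta> \<theta>) * (CA * CB * D * (q * \<epsilon>) * moment (k + 3))"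
    using eps by (intro mult_left_mono) auto
  then show ?thesis unfolding T_def[symmetric] eq D_def[symmetric] by (simp only: mult_ac)
qed

end

section \<open>Hermite polynomials of complex variance\<close>

text \<open>The probabilists' Hermite polynomials \<open>He\<^sub>k\<close> rescaled to variance \<open>\<nu>\<close>, with complex \<open>\<nu>\<close> allowed. At
  \<open>\<nu> = 0\<close> they are the powers, which makes powers of the distance to a saddle point a special case.\<close>
fun hermite_var :: "complex \<Rightarrow> nat \<Rightarrow> complex poly" where
  "hermite_var \<nu> 0 = 1"
| "hermite_var \<nu> (Suc k) = [:0, 1:] * hermite_var \<nu> k - Polynomial.smult \<nu> (pderiv (hermite_var \<nu> k))"

lemma pderiv_hermite_var: "pderiv (hermite_var \<nu> (Suc k)) = Polynomial.smult (of_nat (Suc k)) (hermite_var \<nu> k)"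
proof (induction k)
  case 0
  show ?case by (simp add: pderiv_pCons)
next
  case (Suc k)
  have "pderiv (hermite_var \<nu> (Suc (Suc k))) =
      hermite_var \<nu> (Suc k) + [:0, 1:] * pderiv (hermite_var \<nu> (Suc k)) - Polynomial.smult \<nu> (pderiv (pderiv (hermite_var \<nu> (Suc k))))"
    by (subst hermite_var.simps(2), simp only: pderiv_diff pderiv_mult pderiv_smult)
       (simp add: pderiv_pCons del: hermite_var.simps)
  also have "\<dots> = hermite_var \<nu> (Suc k) + Polynomial.smult (of_nat (Suc k)) (hermite_var \<nu> (Suc k))"
    unfolding Suc.IH by (simp add: pderiv_smult smult_diff_right mult.commute)
  also have "\<dots> = Polynomial.smult (of_nat (Suc (Suc k))) (hermite_var \<nu> (Suc k))"
    by (rule poly_eqI) (simp add: algebra_simps del: hermite_var.simps)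
  finally show ?case .
qed

lemma hermite_var_recursion:
  "poly (hermite_var \<nu> (Suc (Suc k))) x = x * poly (hermite_var \<nu> (Suc k)) x - \<nu> * of_nat (Suc k) * poly (hermite_var \<nu> k) x"
  by (subst hermite_var.simps(2)) (simp only: pderiv_hermite_var, simp)

lemma hermite_var_induct [case_names zero one step]:
  assumes "P 0" "P 1" "\<And>k. P k \<Longrightarrow> P (Suc k) \<Longrightarrow> P (Suc (Suc k))"
  shows "P (n :: nat)"
  using assms by (metis One_nat_def induct_nat_012)

lemma hermite_var_zero: "poly (hermite_var 0 k) x = x ^ k"
  by (induction k) auto

lemma hermite_var_scale: "e \<noteq> 0 \<Longrightarrow> e ^ k * poly (hermite_var \<nu> k) (x / e) = poly (hermite_var (e\<^sup>2 * \<nu>) k) x"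
proof (induction k rule: hermite_var_induct)
  case (step k)
  have "e ^ Suc (Suc k) * poly (hermite_var \<nu> (Suc (Suc k))) (x / e) =
      x * (e ^ Suc k * poly (hermite_var \<nu> (Suc k)) (x / e)) - (e\<^sup>2 * \<nu>) * of_nat (Suc k) * (e ^ k * poly (hermite_var \<nu> k) (x / e))"
    unfolding hermite_var_recursion using step(3) by (simp add: field_simps power2_eq_square)
  also have "\<dots> = poly (hermite_var (e\<^sup>2 * \<nu>) (Suc (Suc k))) x"
    unfolding step(1)[OF step(3)] step(2)[OF step(3)] hermite_var_recursion ..
  finally show ?case .
qed auto

lemma hermite_var_cnj: "cnj (poly (hermite_var \<nu> k) x) = poly (hermite_var (cnj \<nu>) k) (cnj x)"
  by (induction k rule: hermite_var_induct) (simp_all add: hermite_var_recursion del: hermite_var.simps(2), auto)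

lemma degree_hermite_var_le: "degree (hermite_var \<nu> k) \<le> k"
proof (induction k)
  case (Suc k)
  show ?case unfolding hermite_var.simps
    by (intro degree_diff_le order_trans[OF degree_mult_le] order_trans[OF degree_smult_le])
       (use Suc in \<open>auto simp: degree_pderiv\<close>)
qed simp

text \<open>Integration by parts moves one degree of the Hermite polynomial to a derivative of the other factor.\<close>
lemma gaussian_mean_hermite_var_Suc:
  assumes "Re c > 0"
  shows "gaussian_mean c (hermite_var (1 / c) (Suc k) * p) = 1 / c * gaussian_mean c (hermite_var (1 / c) k * pderiv p)"
proof -
  let ?h = "hermite_var (1 / c) k"
  have c0: "c \<noteq> 0" using assms by auto
  have "hermite_var (1 / c) (Suc k) * p = [:0, 1:] * (?h * p) - Polynomial.smult (1 / c) (pderiv ?h * p)"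
    by (simp add: algebra_simps)
  then have "gaussian_mean c (hermite_var (1 / c) (Suc k) * p) =
      gaussian_mean c ([:0, 1:] * (?h * p)) - 1 / c * gaussian_mean c (pderiv ?h * p)"
    by (simp only: gaussian_mean_diff[OF assms] gaussian_mean_smult)
  also have "gaussian_mean c ([:0, 1:] * (?h * p)) = 1 / c * gaussian_mean c (pderiv (?h * p))"
    using gaussian_mean_pderiv[OF assms, of "?h * p"] c0 by simp
  also have "pderiv (?h * p) = ?h * pderiv p + pderiv ?h * p" by (simp add: pderiv_mult mult.commute)
  finally show ?thesis using assms by (simp only: gaussian_mean_add) (simp add: algebra_simps)
qed

lemma gaussian_mean_hermite_var:
  assumes "Re c > 0"
  shows "gaussian_mean c (hermite_var (1 / c) k * p) = (1 / c) ^ k * gaussian_mean c ((pderiv ^^ k) p)"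
proof (induction k arbitrary: p)
  case (Suc k)
  show ?case
    unfolding gaussian_mean_hermite_var_Suc[OF assms] Suc.IH by (simp add: funpow_swap1)
qed simp

lemma higher_pderiv_smult: "(pderiv ^^ k) (Polynomial.smult (a :: complex) p) = Polynomial.smult a ((pderiv ^^ k) p)"
  by (induction k) (simp_all add: pderiv_smult)

lemma higher_pderiv_hermite_var: "j \<le> k \<Longrightarrow> (pderiv ^^ k) (hermite_var \<nu> j) = (if j = k then [:fact k:] else 0)"
proof (induction k arbitrary: j)
  case (Suc k)
  show ?case
  proof (cases j)
    case 0
    have "(pderiv ^^ Suc k) (hermite_var \<nu> j) = (pderiv ^^ k) (pderiv 1)"
      unfolding 0 funpow_Suc_right by simp
    also have "\<dots> = 0" using higher_pderiv_smult[of k 0 0] by (simp add: pderiv_1)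
    finally show ?thesis using 0 by simp
  next
    case (Suc i)
    have "(pderiv ^^ Suc k) (hermite_var \<nu> j) = Polynomial.smult (of_nat (Suc i)) ((pderiv ^^ k) (hermite_var \<nu> i))"
      unfolding Suc funpow_Suc_right o_apply pderiv_hermite_var higher_pderiv_smult ..
    then show ?thesis using Suc.IH[of i] Suc.prems Suc by auto
  qed
qed (auto simp: one_pCons)

text \<open>The higher of the two degrees is moved entirely to derivatives of the other polynomial.\<close>
lemma hermite_var_orthogonal:
  assumes "Re c > 0"
  shows "gaussian_mean c (hermite_var (1 / c) i * hermite_var (1 / c) j) =
    (if i = j then (1 / c) ^ i * fact i * gaussian_mean c 1 else 0)"
proof -
  have *: "gaussian_mean c (hermite_var (1 / c) i * hermite_var (1 / c) j) =
    (if i = j then (1 / c) ^ i * fact i * gaussian_mean c 1 else 0)" if "j \<le> i" for i j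
  proof -
    have "[:fact i :: complex:] = Polynomial.smult (fact i) 1" by simp
    then show ?thesis
      unfolding gaussian_mean_hermite_var[OF assms] higher_pderiv_hermite_var[OF that]
      using gaussian_mean_smult[of c "fact i" 1] gaussian_mean_smult[of c 0 0] by auto
  qed
  show ?thesis
    using *[of i j] *[of j i] by (cases "j \<le> i") (auto simp: mult.commute)
qed

lemma hermite_var_bound:
  assumes "V \<ge> 0"
  shows "\<exists>C\<ge>1. \<forall>\<nu> x s. cmod \<nu> \<le> V \<longrightarrow> cmod x \<le> s \<longrightarrow> cmod (poly (hermite_var \<nu> k) x) \<le> C * (1 + s) ^ k"
proof (induction k rule: hermite_var_induct)
  case zero
  show ?case by (intro exI[of _ 1]) auto
next
  case one
  show ?case by (intro exI[of _ 1]) (auto simp: add_increasing)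
next
  case (step k)
  obtain C where C: "C \<ge> 1" "\<And>\<nu> x s. cmod \<nu> \<le> V \<Longrightarrow> cmod x \<le> s \<Longrightarrow> cmod (poly (hermite_var \<nu> k) x) \<le> C * (1 + s) ^ k"
    using step by blast
  obtain D where D: "D \<ge> 1" "\<And>\<nu> x s. cmod \<nu> \<le> V \<Longrightarrow> cmod x \<le> s \<Longrightarrow> cmod (poly (hermite_var \<nu> (Suc k)) x) \<le> D * (1 + s) ^ Suc k"
    using step by blast
  show ?case
  proof (intro exI[of _ "D + V * of_nat (Suc k) * C"] conjI allI impI)
    have "0 \<le> V * of_nat (Suc k) * C" using assms C by simp
    then show "1 \<le> D + V * of_nat (Suc k) * C" using D by simp
    fix \<nu> x s assume \<nu>: "cmod \<nu> \<le> V" and x: "cmod x \<le> s"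
    have s: "0 \<le> s" using order_trans[OF norm_ge_zero x] .
    have "cmod (poly (hermite_var \<nu> (Suc (Suc k))) x) \<le> cmod (x * poly (hermite_var \<nu> (Suc k)) x) + cmod (\<nu> * of_nat (Suc k) * poly (hermite_var \<nu> k) x)"
      unfolding hermite_var_recursion by (rule norm_triangle_ineq4)
    also have "\<dots> \<le> (1 + s) * (D * (1 + s) ^ Suc k) + V * of_nat (Suc k) * (C * (1 + s) ^ Suc (Suc k))"
    proof (intro add_mono)
      show "cmod (x * poly (hermite_var \<nu> (Suc k)) x) \<le> (1 + s) * (D * (1 + s) ^ Suc k)"
        unfolding norm_mult using x s D by (intro mult_mono D \<nu>) auto
      have "cmod (poly (hermite_var \<nu> k) x) \<le> C * (1 + s) ^ k" by (rule C(2)[OF \<nu> x])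
      also have "\<dots> \<le> C * (1 + s) ^ Suc (Suc k)"
        using C s by (intro mult_left_mono power_increasing) auto
      finally show "cmod (\<nu> * of_nat (Suc k) * poly (hermite_var \<nu> k) x) \<le> V * of_nat (Suc k) * (C * (1 + s) ^ Suc (Suc k))"
        unfolding norm_mult norm_of_nat using \<nu> assms by (intro mult_mono) auto
    qed
    also have "\<dots> = (D + V * of_nat (Suc k) * C) * (1 + s) ^ Suc (Suc k)" by (simp add: algebra_simps)
    finally show "cmod (poly (hermite_var \<nu> (Suc (Suc k))) x) \<le> (D + V * of_nat (Suc k) * C) * (1 + s) ^ Suc (Suc k)" .
  qed
qed

lemma polybound_mult:
  assumes "polybound C k A" "polybound D l B"
  shows "polybound (2 * C * D) (k + l) (\<lambda>x. A x * B x)"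
proof -
  have A: "C \<ge> 0" "continuous_on UNIV A" "\<And>s x. cmod x \<le> s \<Longrightarrow> cmod (A x) \<le> C * (1 + s) ^ k"
     "\<And>s x y. cmod x \<le> s \<Longrightarrow> cmod y \<le> s \<Longrightarrow> cmod (A x - A y) \<le> C * (1 + s) ^ k * cmod (x - y)"
    using assms(1) unfolding polybound_def by blast+
  have B: "D \<ge> 0" "continuous_on UNIV B" "\<And>s x. cmod x \<le> s \<Longrightarrow> cmod (B x) \<le> D * (1 + s) ^ l"
     "\<And>s x y. cmod x \<le> s \<Longrightarrow> cmod y \<le> s \<Longrightarrow> cmod (B x - B y) \<le> D * (1 + s) ^ l * cmod (x - y)"
    using assms(2) unfolding polybound_def by blast+
  show ?thesis unfolding polybound_def
  proof (intro conjI allI impI)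
    fix s x y assume x: "cmod x \<le> s" and y: "cmod y \<le> s"
    have s: "0 \<le> s" using order_trans[OF norm_ge_zero x] .
    have "A x * B x - A y * B y = (A x - A y) * B x + A y * (B x - B y)" by (simp add: algebra_simps)
    also have "cmod \<dots> \<le> (C * (1 + s) ^ k * cmod (x - y)) * (D * (1 + s) ^ l) + (C * (1 + s) ^ k) * (D * (1 + s) ^ l * cmod (x - y))"
      using A(1) B(1) s
      by (intro norm_triangle_le add_mono; unfold norm_mult; intro mult_mono A(3,4) B(3,4) x y) auto
    also have "\<dots> = 2 * C * D * (1 + s) ^ (k + l) * cmod (x - y)" by (simp add: power_add algebra_simps)
    finally show "cmod (A x * B x - A y * B y) \<le> 2 * C * D * (1 + s) ^ (k + l) * cmod (x - y)" .
  next
    fix s x assume x: "cmod x \<le> s"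
    have s: "0 \<le> s" using order_trans[OF norm_ge_zero x] .
    have "cmod (A x * B x) \<le> (C * (1 + s) ^ k) * (D * (1 + s) ^ l)"
      unfolding norm_mult using A(1) s by (intro mult_mono A(3) B(3) x) auto
    also have "\<dots> \<le> 2 * ((C * (1 + s) ^ k) * (D * (1 + s) ^ l))" using A(1) B(1) s by simp
    finally show "cmod (A x * B x) \<le> 2 * C * D * (1 + s) ^ (k + l)" by (simp add: power_add mult_ac)
  qed (use A B in \<open>auto intro: continuous_intros\<close>)
qed

lemma polybound_hermite_var:
  assumes "V \<ge> 0"
  obtains C where "C \<ge> 1" "\<And>\<nu> k. k \<le> n \<Longrightarrow> cmod \<nu> \<le> V \<Longrightarrow> polybound C n (poly (hermite_var \<nu> k))"
proof -
  obtain c where c: "\<And>k. c k \<ge> 1"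
    "\<And>k \<nu> x s. cmod \<nu> \<le> V \<Longrightarrow> cmod x \<le> s \<Longrightarrow> cmod (poly (hermite_var \<nu> k) x) \<le> c k * (1 + s) ^ k"
    using hermite_var_bound[OF assms] by metis
  define D where "D = 1 + (\<Sum>k\<le>n. of_nat (Suc k) * c k)"
  have Dge: "of_nat (Suc k) * c k \<le> D" if "k \<le> n" for k
  proof -
    have "of_nat (Suc k) * c k \<le> (\<Sum>k\<le>n. of_nat (Suc k) * c k)"
      by (rule member_le_sum) (use that order_trans[OF zero_le_one c(1)] in \<open>auto simp del: of_nat_Suc\<close>)
    then show ?thesis by (simp add: D_def)
  qed
  have cD: "c k \<le> D" if "k \<le> n" for k
    using Dge[OF that] mult_right_mono[of 1 "of_nat (Suc k)" "c k"] order_trans[OF zero_le_one c(1)[of k]] by simp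
  show ?thesis
  proof (rule that)
    show "D \<ge> 1" unfolding D_def using order_trans[OF zero_le_one c(1)] by (auto intro!: sum_nonneg)
    then have D0: "D \<ge> 0" by simp
    fix \<nu> k assume k: "k \<le> n" and \<nu>: "cmod \<nu> \<le> V"
    have bd: "cmod (poly (hermite_var \<nu> k) x) \<le> D * (1 + s) ^ n" if "cmod x \<le> s" for s x
    proof -
      have s: "0 \<le> s" using order_trans[OF norm_ge_zero that] .
      have "cmod (poly (hermite_var \<nu> k) x) \<le> c k * (1 + s) ^ k" by (rule c(2)[OF \<nu> that])
      also have "\<dots> \<le> D * (1 + s) ^ n" using cD[OF k] D0 s k by (intro mult_mono power_increasing) auto
      finally show ?thesis .
    qed
    have bd': "cmod (poly (pderiv (hermite_var \<nu> k)) x) \<le> D * (1 + s) ^ n" if "cmod x \<le> s" for s x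
    proof (cases k)
      case 0
      have "0 \<le> s" using order_trans[OF norm_ge_zero that] .
      then show ?thesis using 0 D0 by (simp add: pderiv_1)
    next
      case (Suc i)
      have s: "0 \<le> s" using order_trans[OF norm_ge_zero that] .
      have "cmod (poly (pderiv (hermite_var \<nu> k)) x) = of_nat (Suc i) * cmod (poly (hermite_var \<nu> i) x)"
        unfolding Suc pderiv_hermite_var poly_smult norm_mult norm_of_nat ..
      also have "\<dots> \<le> of_nat (Suc i) * (c i * (1 + s) ^ i)"
        by (intro mult_left_mono c(2)[OF \<nu> that]) auto
      also have "\<dots> = (of_nat (Suc i) * c i) * (1 + s) ^ i" by simp
      also have "\<dots> \<le> D * (1 + s) ^ n" using Dge[of i] D0 s k Suc by (intro mult_mono power_increasing) auto
      finally show ?thesis .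
    qed
    show "polybound D n (poly (hermite_var \<nu> k))" unfolding polybound_def
    proof (intro conjI allI impI D0 bd)
      fix s x y assume x: "cmod x \<le> s" and y: "cmod y \<le> s"
      show "cmod (poly (hermite_var \<nu> k) x - poly (hermite_var \<nu> k) y) \<le> D * (1 + s) ^ n * cmod (x - y)"
        by (rule field_differentiable_bound[of "cball 0 s" _ "poly (pderiv (hermite_var \<nu> k))"])
           (use x y bd' in \<open>auto intro: has_field_derivative_at_within[OF poly_DERIV]\<close>)
    qed (intro continuous_intros)
  qed
qed

text \<open>A Hermite polynomial evaluated far from its saddle point has, after scaling, a variance of order
  \<open>\<epsilon>\<^sup>2\<close>, and then only its leading power matters.\<close>
lemma hermite_var_near_power:
  assumes "V \<ge> 0" "s \<ge> 0"
  shows "\<exists>C\<ge>0. \<forall>\<nu> x. cmod \<nu> \<le> V \<longrightarrow> cmod x \<le> s \<longrightarrow> cmod (poly (hermite_var \<nu> k) x - x ^ k) \<le> C * cmod \<nu>"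
proof (induction k rule: hermite_var_induct)
  case (step k)
  obtain D where D: "D \<ge> 0" "\<And>\<nu> x. cmod \<nu> \<le> V \<Longrightarrow> cmod x \<le> s \<Longrightarrow> cmod (poly (hermite_var \<nu> (Suc k)) x - x ^ Suc k) \<le> D * cmod \<nu>"
    using step by blast
  obtain C where C: "C \<ge> 1" "\<And>\<nu> x s. cmod \<nu> \<le> V \<Longrightarrow> cmod x \<le> s \<Longrightarrow> cmod (poly (hermite_var \<nu> k) x) \<le> C * (1 + s) ^ k"
    using hermite_var_bound[OF assms(1)] by blast
  show ?case
  proof (intro exI[of _ "s * D + of_nat (Suc k) * (C * (1 + s) ^ k)"] conjI allI impI)
    show "0 \<le> s * D + of_nat (Suc k) * (C * (1 + s) ^ k)"
      using assms C(1) D(1) by (intro add_nonneg_nonneg mult_nonneg_nonneg) auto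
    fix \<nu> x assume \<nu>: "cmod \<nu> \<le> V" and x: "cmod x \<le> s"
    have "poly (hermite_var \<nu> (Suc (Suc k))) x - x ^ Suc (Suc k) =
        x * (poly (hermite_var \<nu> (Suc k)) x - x ^ Suc k) - \<nu> * of_nat (Suc k) * poly (hermite_var \<nu> k) x"
      unfolding hermite_var_recursion by (simp add: algebra_simps del: hermite_var.simps)
    also have "cmod \<dots> \<le> s * (D * cmod \<nu>) + cmod \<nu> * of_nat (Suc k) * (C * (1 + s) ^ k)"
      using assms C(1) D(1)
      by (intro norm_triangle_le_diff add_mono; unfold norm_mult norm_of_nat; intro mult_mono x D(2) C(2) \<nu>) auto
    also have "\<dots> = (s * D + of_nat (Suc k) * (C * (1 + s) ^ k)) * cmod \<nu>" by (simp add: algebra_simps)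
    finally show "cmod (poly (hermite_var \<nu> (Suc (Suc k))) x - x ^ Suc (Suc k)) \<le> (s * D + of_nat (Suc k) * (C * (1 + s) ^ k)) * cmod \<nu>" .
  qed
qed (auto intro!: exI[of _ 0])

section \<open>Gram entries on the upper half circle\<close>

text \<open>The affine functions \<open>yp\<close> and \<open>ym\<close> vanish at the upper and the lower saddle point, with derivative \<open>1\<close>
  along the circle there in the direction away from \<open>u = 1\<close>. Complex conjugation interchanges them.\<close>
definition yp :: "real \<Rightarrow> complex \<Rightarrow> complex" where
  "yp \<theta> u = (u - cis \<theta>) / (\<i> * cis \<theta>)"

definition ym :: "real \<Rightarrow> complex \<Rightarrow> complex" where
  "ym \<theta> u = (u - cis (- \<theta>)) / (- (\<i> * cis (- \<theta>)))"

lemma yp_cnj: "cnj (yp \<theta> (cnj u)) = ym \<theta> u" and ym_cnj: "cnj (ym \<theta> (cnj u)) = yp \<theta> u"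
  by (simp_all add: yp_def ym_def cis_cnj)

lemma ym_self: "ym \<theta> (cis \<theta>) = - (2 * of_real (sin \<theta>) * cis \<theta>)"
proof -
  have "cis \<theta> - cis (- \<theta>) = 2 * \<i> * of_real (sin \<theta>)" by (simp add: complex_eq_iff)
  then show ?thesis by (simp add: ym_def cis_inverse[symmetric] field_simps)
qed

lemma ym_norm_le: "cmod (ym \<theta> (cis t)) \<le> 2"
  unfolding ym_def norm_divide using norm_triangle_ineq4[of "cis t" "cis (- \<theta>)"] by (simp add: norm_mult)

lemma ym_lipschitz: "cmod (ym \<theta> (cis s) - ym \<theta> (cis t)) \<le> \<bar>s - t\<bar>"
proof -
  have "ym \<theta> (cis s) - ym \<theta> (cis t) = (cis s - cis t) / (- (\<i> * cis (- \<theta>)))"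
    by (simp add: ym_def diff_divide_distrib)
  then show ?thesis using cmod_cis_diff_le[of s t] by (simp add: norm_divide norm_mult)
qed

text \<open>The basis adapted to the two saddle points: \<open>a\<close> functions living at the upper one, \<open>b\<close> at the lower one, and a last
  one living at both. The powers of \<open>e\<close>, to be taken as \<open>E\<^bsup>-1/2\<^esup>\<close>, balance the sizes: at the upper saddle point
  the functions are of order \<open>e\<^bsup>a\<^esup>\<close>, with an additional factor \<open>e\<close> for those living at the lower one,
  and correspondingly with \<open>b\<close> at the lower saddle point.\<close>
definition saddle_basis :: "real \<Rightarrow> real \<Rightarrow> nat \<Rightarrow> nat \<Rightarrow> nat \<Rightarrow> complex \<Rightarrow> complex" where
  "saddle_basis \<theta> e a b x u =
    (if x < a then of_real e ^ a * poly (hermite_var (1 / curv \<theta>) x) (yp \<theta> u / of_real e) * ym \<theta> u ^ b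
     else if x < a + b then of_real e ^ b * poly (hermite_var (cnj (1 / curv \<theta>)) (x - a)) (ym \<theta> u / of_real e) * yp \<theta> u ^ a
     else of_real e ^ (a + b) * poly (hermite_var (1 / curv \<theta>) a) (yp \<theta> u / of_real e) *
       poly (hermite_var (cnj (1 / curv \<theta>)) b) (ym \<theta> u / of_real e))"

text \<open>Reindexing of the basis under complex conjugation, which exchanges the saddle points and the roles
  of \<open>a\<close> and \<open>b\<close>.\<close>
definition mirror :: "nat \<Rightarrow> nat \<Rightarrow> nat \<Rightarrow> nat" where
  "mirror a b x = (if x < a then b + x else if x < a + b then x - a else x)"

lemma saddle_basis_cnj: "cnj (saddle_basis \<theta> e a b x (cnj u)) = saddle_basis \<theta> e b a (mirror a b x) u"
proof -
  consider "x < a" | "\<not> x < a" "x - a < b" "x < a + b" | "\<not> x < a" "\<not> x < a + b" "\<not> x < b + a" by linarith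
  then show ?thesis
  proof cases
    case 1
    then show ?thesis by (simp add: saddle_basis_def mirror_def hermite_var_cnj yp_cnj ym_cnj)
  next
    case 2
    then show ?thesis by (simp add: saddle_basis_def mirror_def hermite_var_cnj yp_cnj ym_cnj)
  next
    case 3
    then show ?thesis
      by (simp add: saddle_basis_def mirror_def hermite_var_cnj yp_cnj ym_cnj add.commute[of b a])
  qed
qed

text \<open>The contribution of the upper saddle point to the diagonal entry \<open>x\<close> of the Gram matrix, in units
  of \<open>e\<^bsup>2a+1\<^esup>\<close> times the weight at the saddle point.\<close>
definition diagonal_gain :: "real \<Rightarrow> real \<Rightarrow> nat \<Rightarrow> nat \<Rightarrow> nat \<Rightarrow> complex" where
  "diagonal_gain \<theta> e a b x = gaussian_mean (curv \<theta>) 1 *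
    (if x < a then (1 / curv \<theta>) ^ x * fact x * (ym \<theta> (cis \<theta>) ^ b)\<^sup>2
     else if x < a + b then 0
     else (1 / curv \<theta>) ^ a * fact a * (poly (hermite_var (of_real (e\<^sup>2) * cnj (1 / curv \<theta>)) b) (ym \<theta> (cis \<theta>)))\<^sup>2)"

context saddle
begin

lemma curv_bounds: "Re (curv \<theta>) > 0" "cmod (1 / curv \<theta>) \<le> 1 / s0"
  "cmod (of_real (\<epsilon>\<^sup>2) * cnj (1 / curv \<theta>)) \<le> 1 / s0"
proof -
  have s: "sin \<theta> > 0" using s0 by simp
  then show "Re (curv \<theta>) > 0" by (simp add: Re_curv)
  have "cmod (curv \<theta>) = sin \<theta>" using s by (simp add: curv_def norm_mult)
  then show 1: "cmod (1 / curv \<theta>) \<le> 1 / s0" using s0 by (simp add: norm_divide frac_le)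
  have "\<epsilon>\<^sup>2 \<le> 1" using eps(1,2) by (simp add: power_le_one)
  then have "\<epsilon>\<^sup>2 * cmod (1 / curv \<theta>) \<le> 1 * (1 / s0)" using 1 by (intro mult_mono) auto
  then show "cmod (of_real (\<epsilon>\<^sup>2) * cnj (1 / curv \<theta>)) \<le> 1 / s0"
    by (simp only: norm_mult complex_mod_cnj norm_of_real abs_power2)
qed

text \<open>Each basis function is written as a factor in the local variable times a slowly varying factor. For
  functions living at the upper saddle point, \<open>arc_asymp\<close> and the orthogonality of the local Hermite polynomials give
  the entry. As soon as one function lives at the lower saddle point, the extra power of \<open>\<epsilon>\<close> makes \<open>arc_bound\<close>
  sufficient.\<close>
lemma gram_arc_aux:
  assumes D: "D \<ge> 1" "\<And>\<mu> k. k \<le> a + b \<Longrightarrow> cmod \<mu> \<le> 1 / s0 \<Longrightarrow> polybound D (a + b) (poly (hermite_var \<mu> k))"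
    and xy: "x \<le> a + b" "y \<le> a + b"
  defines "C \<equiv> (2 * D * D) * (2 * (D * 3 ^ (a + b)) * (D * 3 ^ (a + b))) * (3 + \<bar>\<beta>\<bar> + 1 / s0) *
    (moment (2 * (a + b)) + moment (2 * (a + b) + 3))"
    and "\<kappa> \<equiv> of_real \<epsilon> * circle_weight E N \<zeta> \<theta> * of_real \<epsilon> ^ (2 * a)"
  shows "cmod (upper_arc E N \<zeta> (\<lambda>u. saddle_basis \<theta> \<epsilon> a b x u * saddle_basis \<theta> \<epsilon> a b y u) - \<kappa> * (if x = y then diagonal_gain \<theta> \<epsilon> a b x else 0))
    \<le> C * (q * \<epsilon>) * cmod \<kappa>"
proof -
  define \<nu> where "\<nu> = 1 / curv \<theta>"
  define M where "M = a + b"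
  define pa where "pa x = (if x < a then hermite_var \<nu> x else if x < M then hermite_var 0 a else hermite_var \<nu> a)" for x
  define A where "A x = poly (pa x)" for x
  define pb where "pb x = (if x < a then hermite_var 0 b else hermite_var (of_real (\<epsilon>\<^sup>2) * cnj \<nu>) (if x < M then x - a else b))" for x
  define B where "B x t = poly (pb x) (ym \<theta> (cis t))" for x t
  define \<sigma> where "\<sigma> x = (if a \<le> x \<and> x < M then \<epsilon> ^ (b - (x - a)) else 1)" for x
  define R where "R = D * 3 ^ M"
  have R: "R \<ge> 0" using D(1) by (simp add: R_def)
  have pb: "polybound D M (poly (pa x))" "polybound D M (poly (pb x))" if "x \<le> M" for x
    using that D(2) curv_bounds s0 by (auto simp: pa_def pb_def M_def \<nu>_def)
  have loc_yp: "loc t = yp \<theta> (cis t) / of_real \<epsilon>" for t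
    by (simp add: loc_def yp_def w_def)
  have saddle_basis: "saddle_basis \<theta> \<epsilon> a b x (cis t) = of_real \<epsilon> ^ a * of_real (\<sigma> x) * (A x (loc t) * B x t)" if "x \<le> M" for x t
  proof -
    have e0: "complex_of_real \<epsilon> \<noteq> 0" using eps by simp
    have yp: "yp \<theta> (cis t) = of_real \<epsilon> * loc t" using e0 by (simp add: loc_yp)
    consider "x < a" | "a \<le> x" "x < M" | "x = M" using \<open>x \<le> M\<close> by linarith
    then show ?thesis
    proof cases
      case 1
      then show ?thesis by (simp add: saddle_basis_def \<sigma>_def A_def B_def pa_def pb_def hermite_var_zero loc_yp \<nu>_def)
    next
      case 2
      have "b = (b - (x - a)) + (x - a)" using 2 by (simp add: M_def)
      then have "complex_of_real \<epsilon> ^ b = of_real \<epsilon> ^ (b - (x - a)) * of_real \<epsilon> ^ (x - a)" by (metis power_add)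
      then have "saddle_basis \<theta> \<epsilon> a b x (cis t) = of_real \<epsilon> ^ (b - (x - a)) *
          (of_real \<epsilon> ^ (x - a) * poly (hermite_var (cnj \<nu>) (x - a)) (ym \<theta> (cis t) / of_real \<epsilon>)) * (of_real \<epsilon> * loc t) ^ a"
        using 2 unfolding saddle_basis_def yp by (simp add: M_def \<nu>_def mult_ac)
      also have "\<dots> = of_real \<epsilon> ^ a * of_real (\<sigma> x) * (A x (loc t) * B x t)"
        unfolding hermite_var_scale[OF e0] using 2
        by (simp add: \<sigma>_def A_def B_def pa_def pb_def hermite_var_zero power_mult_distrib mult_ac)
      finally show ?thesis .
    next
      case 3
      have "saddle_basis \<theta> \<epsilon> a b x (cis t) = of_real \<epsilon> ^ a * poly (hermite_var \<nu> a) (loc t) *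
          (of_real \<epsilon> ^ b * poly (hermite_var (cnj \<nu>) b) (ym \<theta> (cis t) / of_real \<epsilon>))"
        using 3 by (simp add: saddle_basis_def M_def \<nu>_def loc_yp power_add mult_ac)
      also have "\<dots> = of_real \<epsilon> ^ a * of_real (\<sigma> x) * (A x (loc t) * B x t)"
        unfolding hermite_var_scale[OF e0] using 3 by (simp add: \<sigma>_def A_def B_def pa_def pb_def M_def mult_ac)
      finally show ?thesis .
    qed
  qed
  define I where "I = integral {0..pi} (\<lambda>t. (A x (loc t) * A y (loc t)) * (B x t * B y t) * circle_weight E N \<zeta> t)"
  have upper_arc: "upper_arc E N \<zeta> (\<lambda>u. saddle_basis \<theta> \<epsilon> a b x u * saddle_basis \<theta> \<epsilon> a b y u) = of_real \<epsilon> ^ (2 * a) * of_real (\<sigma> x * \<sigma> y) * I"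
  proof -
    have "saddle_basis \<theta> \<epsilon> a b x (cis t) * saddle_basis \<theta> \<epsilon> a b y (cis t) * circle_weight E N \<zeta> t = of_real \<epsilon> ^ (2 * a) * of_real (\<sigma> x * \<sigma> y) *
        ((A x (loc t) * A y (loc t)) * (B x t * B y t) * circle_weight E N \<zeta> t)" for t
      unfolding saddle_basis[OF xy(1)[folded M_def]] saddle_basis[OF xy(2)[folded M_def]] mult_2 power_add by simp
    then show ?thesis unfolding upper_arc_def I_def by (simp only: integral_mult_right)
  qed
  have AA: "polybound (2 * D * D) (M + M) (\<lambda>v. A x v * A y v)"
    unfolding A_def by (intro polybound_mult pb xy[folded M_def])
  have contB: "continuous_on {0..pi} (B x)" for x
    unfolding B_def ym_def by (intro continuous_intros) auto
  then have BBc: "continuous_on {0..pi} (\<lambda>t. B x t * B y t)" by (intro continuous_intros)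
  have B1: "cmod (B x t) \<le> R" and B2: "cmod (B x t - B x t') \<le> R * \<bar>t - t'\<bar>" if "x \<le> M" for x t t'
  proof -
    have **: "\<forall>s z. cmod z \<le> s \<longrightarrow> cmod (poly (pb x) z) \<le> D * (1 + s) ^ M"
      and *: "\<forall>s z w. cmod z \<le> s \<longrightarrow> cmod w \<le> s \<longrightarrow> cmod (poly (pb x) z - poly (pb x) w) \<le> D * (1 + s) ^ M * cmod (z - w)"
      using pb(2)[OF that] unfolding polybound_def by blast+
    show "cmod (B x t) \<le> R" using **[rule_format, OF ym_norm_le[of \<theta> t]] by (simp add: B_def R_def)
    have "cmod (B x t - B x t') \<le> R * cmod (ym \<theta> (cis t) - ym \<theta> (cis t'))"
      using *[rule_format, OF ym_norm_le[of \<theta> t] ym_norm_le[of \<theta> t']] by (simp add: B_def R_def)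
    also have "\<dots> \<le> R * \<bar>t - t'\<bar>" by (intro mult_left_mono ym_lipschitz R)
    finally show "cmod (B x t - B x t') \<le> R * \<bar>t - t'\<bar>" .
  qed
  have BB1: "cmod (B x t * B y t) \<le> 2 * R * R" for t
  proof -
    have "cmod (B x t * B y t) \<le> R * R"
      unfolding norm_mult using R by (intro mult_mono B1 xy[folded M_def]) auto
    also have "\<dots> \<le> 2 * R * R" using R by simp
    finally show ?thesis .
  qed
  have BB2: "cmod (B x t * B y t - B x \<theta> * B y \<theta>) \<le> 2 * R * R * \<bar>t - \<theta>\<bar>" for t
  proof -
    have "B x t * B y t - B x \<theta> * B y \<theta> = (B x t - B x \<theta>) * B y t + B x \<theta> * (B y t - B y \<theta>)"
      by (simp add: algebra_simps)
    also have "cmod \<dots> \<le> (R * \<bar>t - \<theta>\<bar>) * R + R * (R * \<bar>t - \<theta>\<bar>)"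
      using R by (intro norm_triangle_le add_mono; unfold norm_mult; intro mult_mono B1 B2 xy[folded M_def]) auto
    finally show ?thesis by (simp add: algebra_simps)
  qed
  have mom: "moment k \<ge> 0" for k
    unfolding moment_def by (intro Bochner_Integration.integral_nonneg mult_nonneg_nonneg less_imp_le[OF W_pos]) auto
  define c0 where "c0 = (2 * D * D) * (2 * R * R)"
  have c0: "c0 \<ge> 0" using D(1) R by (simp add: c0_def)
  have Cge: "c0 * moment (M + M) \<le> C" "c0 * (3 + \<bar>\<beta>\<bar> + 1 / s0) * moment (M + M + 3) \<le> C"
  proof -
    have "1 / s0 > 0" using s0 by simp
    then have f: "3 + \<bar>\<beta>\<bar> + 1 / s0 \<ge> 1" using abs_ge_zero[of \<beta>] by linarith
    have C: "C = c0 * (3 + \<bar>\<beta>\<bar> + 1 / s0) * (moment (M + M) + moment (M + M + 3))"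
      unfolding C_def c0_def R_def M_def mult_2[of "a + b"] ..
    have "c0 * 1 * moment (M + M) \<le> c0 * (3 + \<bar>\<beta>\<bar> + 1 / s0) * (moment (M + M) + moment (M + M + 3))"
      using f c0 mom by (intro mult_mono mult_left_mono) auto
    then show "c0 * moment (M + M) \<le> C" unfolding C by simp
    show "c0 * (3 + \<bar>\<beta>\<bar> + 1 / s0) * moment (M + M + 3) \<le> C"
      unfolding C using f c0 mom by (intro mult_left_mono) auto
  qed
  have kappa: "cmod \<kappa> = \<epsilon> ^ (2 * a) * (\<epsilon> * cmod (circle_weight E N \<zeta> \<theta>))"
    using eps by (simp add: \<kappa>_def norm_mult norm_power)
  show ?thesis
  proof (cases "(x < a \<or> x = M) \<and> (y < a \<or> y = M)")
    case True
    have s1: "\<sigma> x = 1" "\<sigma> y = 1" using True by (auto simp: \<sigma>_def M_def)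
    define T where "T = (\<integral>s. A x (of_real s) * A y (of_real s) * gauss (curv \<theta>) s \<partial>lborel)"
    have "T = gaussian_mean (curv \<theta>) (pa x * pa y)"
      by (simp add: T_def gaussian_mean_def A_def)
    also have "pa x = hermite_var (1 / curv \<theta>) (if x < a then x else a)" using True by (auto simp: pa_def M_def \<nu>_def)
    also have "pa y = hermite_var (1 / curv \<theta>) (if y < a then y else a)" using True by (auto simp: pa_def M_def \<nu>_def)
    finally have T: "T = (if x = y then \<nu> ^ (if x < a then x else a) * fact (if x < a then x else a) * gaussian_mean (curv \<theta>) 1 else 0)"
      unfolding hermite_var_orthogonal[OF curv_bounds(1)] \<nu>_def using True by (auto simp: M_def)
    have BT: "B x \<theta> * B y \<theta> * T = (if x = y then diagonal_gain \<theta> \<epsilon> a b x else 0)"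
      using True unfolding T
      by (auto simp: diagonal_gain_def B_def pb_def M_def \<nu>_def hermite_var_zero power2_eq_square)
    have "cmod (I - of_real \<epsilon> * circle_weight E N \<zeta> \<theta> * (B x \<theta> * B y \<theta> * T))
       \<le> (2 * D * D) * (2 * R * R) * (3 + \<bar>\<beta>\<bar> + 1 / s0) * moment (M + M + 3) * (q * \<epsilon>) * (\<epsilon> * cmod (circle_weight E N \<zeta> \<theta>))"
      unfolding I_def T_def by (rule arc_asymp[OF AA BBc BB1 BB2])
    also have "\<dots> = (c0 * (3 + \<bar>\<beta>\<bar> + 1 / s0) * moment (M + M + 3)) * (q * \<epsilon>) * (\<epsilon> * cmod (circle_weight E N \<zeta> \<theta>))"
      by (simp add: c0_def)
    also have "\<dots> \<le> C * (q * \<epsilon>) * (\<epsilon> * cmod (circle_weight E N \<zeta> \<theta>))"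
      using eps q by (intro mult_right_mono Cge) auto
    finally have le: "cmod (I - of_real \<epsilon> * circle_weight E N \<zeta> \<theta> * (B x \<theta> * B y \<theta> * T)) \<le>
        C * (q * \<epsilon>) * (\<epsilon> * cmod (circle_weight E N \<zeta> \<theta>))" .
    have factor: "p * 1 * v - e * l * p * h = p * (v - e * l * h)" for p v e l h :: complex
      by (simp add: algebra_simps)
    have "upper_arc E N \<zeta> (\<lambda>u. saddle_basis \<theta> \<epsilon> a b x u * saddle_basis \<theta> \<epsilon> a b y u) - \<kappa> * (if x = y then diagonal_gain \<theta> \<epsilon> a b x else 0)
        = of_real \<epsilon> ^ (2 * a) * (I - of_real \<epsilon> * circle_weight E N \<zeta> \<theta> * (B x \<theta> * B y \<theta> * T))"
      unfolding upper_arc BT[symmetric] s1 \<kappa>_def mult_1_right of_real_1 by (rule factor[unfolded mult_1_right])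
    then have "cmod (upper_arc E N \<zeta> (\<lambda>u. saddle_basis \<theta> \<epsilon> a b x u * saddle_basis \<theta> \<epsilon> a b y u) - \<kappa> * (if x = y then diagonal_gain \<theta> \<epsilon> a b x else 0))
        = \<epsilon> ^ (2 * a) * cmod (I - of_real \<epsilon> * circle_weight E N \<zeta> \<theta> * (B x \<theta> * B y \<theta> * T))"
      using eps(1) by (simp only: norm_mult norm_power norm_of_real abs_of_pos)
    also have "\<dots> \<le> \<epsilon> ^ (2 * a) * (C * (q * \<epsilon>) * (\<epsilon> * cmod (circle_weight E N \<zeta> \<theta>)))"
      using le eps(1) by (intro mult_left_mono) auto
    also have "\<dots> = C * (q * \<epsilon>) * cmod \<kappa>" unfolding kappa by (simp only: mult_ac)
    finally show ?thesis .
  next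
    case False
    have z: "(if x = y then diagonal_gain \<theta> \<epsilon> a b x else 0) = 0"
      using False xy by (auto simp: diagonal_gain_def M_def)
    have \<sigma>_le: "0 \<le> \<sigma> x" "\<sigma> x \<le> 1" for x using eps(1,2) by (auto simp: \<sigma>_def intro!: power_le_one)
    have \<sigma>_mid: "\<sigma> x \<le> \<epsilon>" if "\<not> (x < a \<or> x = M)" "x \<le> M" for x
    proof -
      have "b - (x - a) \<ge> 1" using that by (auto simp: M_def)
      then have "\<epsilon> ^ (b - (x - a)) \<le> \<epsilon> ^ 1" using eps(1,2) by (intro power_decreasing) auto
      then show ?thesis using that by (simp add: \<sigma>_def)
    qed
    consider "\<not> (x < a \<or> x = M)" | "\<not> (y < a \<or> y = M)" using False by blast
    then have "\<sigma> x * \<sigma> y \<le> \<epsilon>"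
    proof cases
      case 1
      then have "\<sigma> x * \<sigma> y \<le> \<epsilon> * 1"
        by (intro mult_mono \<sigma>_mid \<sigma>_le) (use xy eps(1) in \<open>auto simp: M_def\<close>)
      then show ?thesis by simp
    next
      case 2
      then have "\<sigma> x * \<sigma> y \<le> 1 * \<epsilon>"
        by (intro mult_mono \<sigma>_mid \<sigma>_le) (use xy in \<open>auto simp: M_def\<close>)
      then show ?thesis by simp
    qed
    then have \<sigma>: "\<sigma> x * \<sigma> y \<le> q * \<epsilon>" using eps(5) by (rule order_trans)
    have "cmod I \<le> (2 * D * D) * (2 * R * R) * moment (M + M) * \<epsilon> * cmod (circle_weight E N \<zeta> \<theta>)"
      unfolding I_def by (rule arc_bound[OF AA BBc BB1])
    also have "\<dots> = (c0 * moment (M + M)) * (\<epsilon> * cmod (circle_weight E N \<zeta> \<theta>))" by (simp add: c0_def)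
    also have "\<dots> \<le> C * (\<epsilon> * cmod (circle_weight E N \<zeta> \<theta>))" using eps by (intro mult_right_mono Cge) auto
    finally have I: "cmod I \<le> C * (\<epsilon> * cmod (circle_weight E N \<zeta> \<theta>))" .
    have "cmod (upper_arc E N \<zeta> (\<lambda>u. saddle_basis \<theta> \<epsilon> a b x u * saddle_basis \<theta> \<epsilon> a b y u)) = \<epsilon> ^ (2 * a) * ((\<sigma> x * \<sigma> y) * cmod I)"
      unfolding upper_arc using eps \<sigma>_le by (simp add: norm_mult norm_power)
    also have "\<dots> \<le> \<epsilon> ^ (2 * a) * ((q * \<epsilon>) * (C * (\<epsilon> * cmod (circle_weight E N \<zeta> \<theta>))))"
    proof (rule mult_left_mono)
      show "(\<sigma> x * \<sigma> y) * cmod I \<le> (q * \<epsilon>) * (C * (\<epsilon> * cmod (circle_weight E N \<zeta> \<theta>)))"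
        by (rule mult_mono[OF \<sigma>(1) I]) (use eps(1) q(1) in auto)
    qed (use eps(1) in auto)
    finally show ?thesis unfolding z kappa by (simp add: mult_ac)
  qed
qed

end

text \<open>The constant is chosen before \<open>E\<close>, \<open>\<theta>\<close>, \<open>\<eta>\<close> and \<open>N\<close>, which is the uniformity that the final
  estimate requires.\<close>
lemma gram_arc:
  assumes "s0 > 0"
  obtains C where "C \<ge> 0"
   "\<And>E \<theta> q \<eta> N x y. saddle E \<theta> q \<beta> s0 \<eta> N \<Longrightarrow> x \<le> a + b \<Longrightarrow> y \<le> a + b \<Longrightarrow>
    cmod (upper_arc E N (of_real (cos \<theta>) + \<eta>) (\<lambda>u. saddle_basis \<theta> (1 / sqrt E) a b x u * saddle_basis \<theta> (1 / sqrt E) a b y u)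
      - of_real (1 / sqrt E) ^ (2 * a + 1) * circle_weight E N (of_real (cos \<theta>) + \<eta>) \<theta> * (if x = y then diagonal_gain \<theta> (1 / sqrt E) a b x else 0))
    \<le> C * (q / sqrt E) * cmod (of_real (1 / sqrt E) ^ (2 * a + 1) * circle_weight E N (of_real (cos \<theta>) + \<eta>) \<theta>)"
proof -
  have "1 / s0 \<ge> 0" using assms by simp
  then obtain D where D: "D \<ge> 1" "\<And>\<mu> k. k \<le> a + b \<Longrightarrow> cmod \<mu> \<le> 1 / s0 \<Longrightarrow> polybound D (a + b) (poly (hermite_var \<mu> k))"
    by (rule polybound_hermite_var[where n = "a + b"]) (rule that)
  define C where "C = \<bar>(2 * D * D) * (2 * (D * 3 ^ (a + b)) * (D * 3 ^ (a + b))) * (3 + \<bar>\<beta>\<bar> + 1 / s0) *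
    (saddle.moment s0 (2 * (a + b)) + saddle.moment s0 (2 * (a + b) + 3))\<bar>"
  have main: "cmod (upper_arc E N (of_real (cos \<theta>) + \<eta>) (\<lambda>u. saddle_basis \<theta> (1 / sqrt E) a b x u * saddle_basis \<theta> (1 / sqrt E) a b y u)
      - of_real (1 / sqrt E) ^ (2 * a + 1) * circle_weight E N (of_real (cos \<theta>) + \<eta>) \<theta> * (if x = y then diagonal_gain \<theta> (1 / sqrt E) a b x else 0))
    \<le> C * (q / sqrt E) * cmod (of_real (1 / sqrt E) ^ (2 * a + 1) * circle_weight E N (of_real (cos \<theta>) + \<eta>) \<theta>)"
    if s: "saddle E \<theta> q \<beta> s0 \<eta> N" and xy: "x \<le> a + b" "y \<le> a + b" for E \<theta> q \<eta> N x y
  proof -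
    interpret saddle E \<theta> q \<beta> s0 \<eta> N by (rule s)
    define \<kappa> where "\<kappa> = of_real \<epsilon> * circle_weight E N \<zeta> \<theta> * of_real \<epsilon> ^ (2 * a)"
    have k: "of_real (1 / sqrt E) ^ (2 * a + 1) * circle_weight E N (of_real (cos \<theta>) + \<eta>) \<theta> = \<kappa>"
      unfolding \<kappa>_def \<epsilon>_def \<zeta>_def by (simp add: mult_ac)
    have 1: "cmod (upper_arc E N \<zeta> (\<lambda>u. saddle_basis \<theta> \<epsilon> a b x u * saddle_basis \<theta> \<epsilon> a b y u) - \<kappa> * (if x = y then diagonal_gain \<theta> \<epsilon> a b x else 0))
      \<le> ((2 * D * D) * (2 * (D * 3 ^ (a + b)) * (D * 3 ^ (a + b))) * (3 + \<bar>\<beta>\<bar> + 1 / s0) *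
    (moment (2 * (a + b)) + moment (2 * (a + b) + 3))) * (q * \<epsilon>) * cmod \<kappa>"
      unfolding \<kappa>_def by (rule gram_arc_aux[OF D xy])
    have 2: "((2 * D * D) * (2 * (D * 3 ^ (a + b)) * (D * 3 ^ (a + b))) * (3 + \<bar>\<beta>\<bar> + 1 / s0) *
    (moment (2 * (a + b)) + moment (2 * (a + b) + 3))) * (q * \<epsilon>) * cmod \<kappa> \<le> C * (q * \<epsilon>) * cmod \<kappa>"
      unfolding C_def using q(1) eps(1) by (intro mult_right_mono abs_ge_self) auto
    have e: "q * \<epsilon> = q / sqrt E" by (simp add: \<epsilon>_def)
    show ?thesis
      using order_trans[OF 1 2] unfolding k e unfolding \<epsilon>_def \<zeta>_def .
  qed
  have "C \<ge> 0" unfolding C_def by (rule abs_ge_zero)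
  from that[OF this main] show ?thesis .
qed

section \<open>Lower half circle, perturbation of determinants and zeros\<close>

text \<open>Conjugation reduces the lower half circle to the upper one, with \<open>\<zeta>\<close> conjugated.\<close>
lemma lower_arc_eq_cnj:
  assumes "continuous_on UNIV h"
  shows "lower_arc E N \<zeta> h = cnj (upper_arc E N (cnj \<zeta>) (\<lambda>u. cnj (h (cnj u))))"
proof -
  have k: "cnj (circle_weight E N (cnj \<zeta>) t) = circle_weight E N \<zeta> (- t)" for t
    by (simp add: circle_weight_def cis_cnj exp_cnj)
  have "continuous_on {0..pi} (\<lambda>t. cnj (h (cnj (cis t))) * circle_weight E N (cnj \<zeta>) t)"
    by (intro continuous_intros continuous_on_compose2[OF assms]) auto
  from integral_linear[OF integrable_continuous_real[OF this] bounded_linear_cnj]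
  show ?thesis by (simp add: upper_arc_def lower_arc_def o_def k cis_cnj)
qed

definition polyfun :: "nat \<Rightarrow> (complex \<Rightarrow> complex) \<Rightarrow> bool" where
  "polyfun d h \<longleftrightarrow> (\<exists>p. degree p \<le> d \<and> (\<forall>u. poly p u = h u))"

lemma polyfun_const: "polyfun 0 (\<lambda>u. c)"
  unfolding polyfun_def by (intro exI[of _ "[:c:]"]) auto

lemma polyfun_mult: "polyfun d h \<Longrightarrow> polyfun e k \<Longrightarrow> polyfun (d + e) (\<lambda>u. h u * k u)"
  unfolding polyfun_def by (metis add_mono degree_mult_le order_trans poly_mult)

lemma polyfun_power: "polyfun d h \<Longrightarrow> polyfun (k * d) (\<lambda>u. h u ^ k)"
  by (induction k) (simp_all add: polyfun_const polyfun_mult)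

lemma polyfun_poly:
  assumes "polyfun 1 h"
  shows "polyfun (degree p) (\<lambda>u. poly p (h u))"
proof -
  obtain l where l: "degree l \<le> 1" "\<And>u. poly l u = h u" using assms unfolding polyfun_def by blast
  have "degree (pcompose p l) \<le> degree p * 1"
    by (rule order_trans[OF degree_pcompose_le]) (use l(1) in simp)
  then show ?thesis unfolding polyfun_def by (intro exI[of _ "pcompose p l"]) (simp add: poly_pcompose l(2))
qed

lemma polyfun_mono: "polyfun d h \<Longrightarrow> d \<le> e \<Longrightarrow> polyfun e h"
  unfolding polyfun_def using order_trans by blast

lemma polyfun_linear: "polyfun 1 (\<lambda>u. (u - c) / d)"
  unfolding polyfun_def by (intro exI[of _ "[:- c / d, 1 / d:]"]) (simp add: diff_divide_distrib)

text \<open>The degree is at most \<open>a + b = n - 1\<close>, so that the basis is admissible in \<open>generalised_hermite_gram\<close>.\<close>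
lemma polyfun_saddle_basis:
  assumes "x \<le> a + b"
  shows "polyfun (a + b) (saddle_basis \<theta> e a b x)"
proof -
  have y: "polyfun 1 (yp \<theta>)" "polyfun 1 (ym \<theta>)"
    unfolding yp_def[abs_def] ym_def[abs_def] by (rule polyfun_linear)+
  have yd: "polyfun 1 (\<lambda>u. yp \<theta> u / of_real e)" "polyfun 1 (\<lambda>u. ym \<theta> u / of_real e)"
    using y(1)[THEN polyfun_mult, OF polyfun_const, of "1 / of_real e"]
      y(2)[THEN polyfun_mult, OF polyfun_const, of "1 / of_real e"] by simp_all
  have hpf: "polyfun k (\<lambda>u. poly (hermite_var \<mu> k) (h u))" if "polyfun 1 h" for \<mu> k h
    by (rule polyfun_mono[OF polyfun_poly[OF that] degree_hermite_var_le])
  have pw: "polyfun k (\<lambda>u. h u ^ k)" if "polyfun 1 h" for k h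
    using polyfun_power[OF that, of k] by simp
  consider "x < a" | "\<not> x < a" "x < a + b" | "\<not> x < a" "\<not> x < a + b" by linarith
  then show ?thesis
  proof cases
    case 1
    have "polyfun (0 + x + b) (\<lambda>u. of_real e ^ a * poly (hermite_var (1 / curv \<theta>) x) (yp \<theta> u / of_real e) * ym \<theta> u ^ b)"
      by (intro polyfun_mult polyfun_const hpf pw yd y)
    then show ?thesis by (rule polyfun_mono[THEN iffD1[OF arg_cong[where f = "polyfun _"], rotated]])
        (use 1 in \<open>auto simp: saddle_basis_def\<close>)
  next
    case 2
    have "polyfun (0 + (x - a) + a) (\<lambda>u. of_real e ^ b * poly (hermite_var (cnj (1 / curv \<theta>)) (x - a)) (ym \<theta> u / of_real e) * yp \<theta> u ^ a)"
      by (intro polyfun_mult polyfun_const hpf pw yd y)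
    then show ?thesis by (rule polyfun_mono[THEN iffD1[OF arg_cong[where f = "polyfun _"], rotated]])
        (use 2 in \<open>auto simp: saddle_basis_def\<close>)
  next
    case 3
    have "polyfun (0 + a + b) (\<lambda>u. of_real e ^ (a + b) * poly (hermite_var (1 / curv \<theta>) a) (yp \<theta> u / of_real e) *
       poly (hermite_var (cnj (1 / curv \<theta>)) b) (ym \<theta> u / of_real e))"
      by (intro polyfun_mult polyfun_const hpf pw yd y)
    then show ?thesis using 3 by (simp add: saddle_basis_def[abs_def])
  qed
qed

lemma continuous_on_polyfun: "polyfun d h \<Longrightarrow> continuous_on A h"
proof -
  assume "polyfun d h"
  then obtain p where "\<forall>u. poly p u = h u" unfolding polyfun_def by blast
  then have "h = (\<lambda>u. poly p u)" by auto
  then show ?thesis by (simp only: continuous_on_poly continuous_on_id)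
qed

lemma prod_diff_le:
  fixes u v :: "nat \<Rightarrow> complex"
  assumes "finite S" "R \<ge> 1" "\<delta> \<ge> 0"
    "\<And>i. i \<in> S \<Longrightarrow> cmod (u i) \<le> R" "\<And>i. i \<in> S \<Longrightarrow> cmod (v i) \<le> R"
    "\<And>i. i \<in> S \<Longrightarrow> cmod (u i - v i) \<le> \<delta>"
  shows "cmod (prod u S - prod v S) \<le> real (card S) * R ^ card S * \<delta>"
  using assms(1,4,5,6)
proof (induction S rule: finite_induct)
  case (insert i S)
  have R0: "R \<ge> 0" using assms(2) by simp
  have v: "cmod (prod v S) \<le> R ^ card S"
  proof -
    have "cmod (prod v S) \<le> (\<Prod>i\<in>S. R)"
      unfolding prod_norm[symmetric] by (intro prod_mono) (use insert in auto)
    then show ?thesis by simp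
  qed
  have "prod u (insert i S) - prod v (insert i S) = u i * (prod u S - prod v S) + (u i - v i) * prod v S"
    using insert by (simp add: algebra_simps)
  also have "cmod \<dots> \<le> R * (real (card S) * R ^ card S * \<delta>) + \<delta> * R ^ card S"
    using insert v R0 assms(3)
    by (intro norm_triangle_le add_mono; unfold norm_mult; intro mult_mono) auto
  also have "\<dots> \<le> R * (real (card S) * R ^ card S * \<delta>) + R * (R ^ card S * \<delta>)"
    using mult_right_mono[OF assms(2), of "R ^ card S * \<delta>"] R0 assms(3) by (simp add: mult_ac)
  also have "\<dots> = real (card (insert i S)) * R ^ card (insert i S) * \<delta>"
    using insert by (simp add: algebra_simps)
  finally show ?case .
qed simp

text \<open>Termwise comparison in the Leibniz formula.\<close>
lemma det_of_near_diagonal: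
  fixes A :: "nat \<Rightarrow> nat \<Rightarrow> complex"
  assumes R: "R \<ge> 1" and \<delta>: "0 \<le> \<delta>" "\<delta> \<le> 1"
    and d: "\<And>i. i < n \<Longrightarrow> cmod (d i) \<le> R"
    and A: "\<And>i j. i < n \<Longrightarrow> j < n \<Longrightarrow> cmod (A i j - (if i = j then d i else 0)) \<le> \<delta>"
  shows "cmod (det_of n A - (\<Prod>i<n. d i)) \<le> fact n * (real n * (R + 1) ^ n) * \<delta>"
proof -
  define B where "B i j = (if i = j then d i else 0)" for i j
  let ?P = "{p. p permutes {0..<n}}"
  have B: "cmod (B i j) \<le> R + 1" if "i < n" for i j using d[OF that] R by (auto simp: B_def)
  have A': "cmod (A i j) \<le> R + 1" if "i < n" "j < n" for i j
  proof -
    have "cmod (B i j) \<le> R" using d[OF that(1)] R by (auto simp: B_def)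
    moreover have "cmod (A i j - B i j) \<le> 1" using A[OF that] \<delta> by (simp add: B_def)
    ultimately show ?thesis using norm_triangle_sub[of "A i j" "B i j"] by linarith
  qed
  have dtB: "det_of n B = (\<Prod>i<n. d i)" by (subst det_of_lower_triangular) (auto simp: B_def)
  have "det_of n A - (\<Prod>i<n. d i) = (\<Sum>p\<in>?P. signof p * ((\<Prod>i = 0..<n. A i (p i)) - (\<Prod>i = 0..<n. B i (p i))))"
    unfolding dtB[symmetric] det_of_leibniz right_diff_distrib sum_subtractf ..
  also have "cmod \<dots> \<le> (\<Sum>p\<in>?P. real n * (R + 1) ^ n * \<delta>)"
  proof (rule sum_norm_le)
    fix p assume "p \<in> ?P"
    then have p: "p i < n" if "i < n" for i using that permutes_in_image[of p "{0..<n}" i] by auto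
    have "cmod ((\<Prod>i = 0..<n. A i (p i)) - (\<Prod>i = 0..<n. B i (p i)))
        \<le> real (card {0..<n}) * (R + 1) ^ card {0..<n} * \<delta>"
      by (rule prod_diff_le) (use R \<delta> A' B A p in \<open>auto simp: B_def\<close>)
    moreover have "cmod (signof p) = 1" by (simp add: sign_def)
    ultimately show "cmod (signof p * ((\<Prod>i = 0..<n. A i (p i)) - (\<Prod>i = 0..<n. B i (p i)))) \<le> real n * (R + 1) ^ n * \<delta>"
      unfolding norm_mult by simp
  qed
  also have "\<dots> = fact n * (real n * (R + 1) ^ n) * \<delta>"
    by (simp add: card_permutations[of "{0..<n}" n])
  finally show ?thesis .
qed

text \<open>Rouche's theorem counts the zeros of \<open>G\<close> with multiplicity. The count is \<open>1\<close> and multiplicities are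
  positive, so the zero is unique; on the boundary \<open>G\<close> does not vanish, hence the closed disc.\<close>
lemma rouche_simple_zero:
  fixes G T :: "complex \<Rightarrow> complex"
  assumes r: "0 < r" "r < R"
    and G: "G holomorphic_on ball Z R" "finite {p \<in> ball Z R. G p = 0}"
    and T: "T holomorphic_on ball Z R" "\<And>p. p \<in> ball Z R \<Longrightarrow> T p = 0 \<longleftrightarrow> p = Z" "deriv T Z \<noteq> 0"
    and less: "\<And>p. cmod (p - Z) = r \<Longrightarrow> cmod (G p - T p) < cmod (T p)"
  shows "\<exists>!p. G p = 0 \<and> cmod (p - Z) \<le> r"
proof -
  define S where "S = {p \<in> ball Z R. G p = 0}"
  have R: "R > 0" using r by simp
  have TZ: "{p \<in> ball Z R. T p = 0} = {Z}" using T(2) R by auto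
  have wn: "winding_number (circlepath Z r) p = (if cmod (p - Z) < r then 1 else 0)" if "p \<in> S" for p
  proof (cases "cmod (p - Z) < r")
    case True
    then show ?thesis using winding_number_circlepath[of p Z r] by simp
  next
    case False
    have "cmod (p - Z) \<noteq> r" using less[of p] that by (auto simp: S_def)
    then have "p \<notin> cball Z r" using False by (simp add: dist_norm norm_minus_commute)
    then have "winding_number (circlepath Z r) p = 0"
      using r by (intro winding_number_zero_outside[of _ "cball Z r"]) (auto simp: sphere_def)
    then show ?thesis using False by simp
  qed
  have "(\<Sum>p\<in>{p \<in> ball Z R. T p + (G p - T p) = 0}. winding_number (circlepath Z r) p * zorder (\<lambda>p. T p + (G p - T p)) p)
      = (\<Sum>p\<in>{p \<in> ball Z R. T p = 0}. winding_number (circlepath Z r) p * zorder T p)"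
  proof (rule Rouche_theorem)
    show "\<forall>z\<in>path_image (circlepath Z r). cmod (G z - T z) < cmod (T z)"
      using less r by (auto simp: sphere_def dist_norm norm_minus_commute)
    show "\<forall>z. z \<notin> ball Z R \<longrightarrow> winding_number (circlepath Z r) z = 0"
      using r by (auto intro!: winding_number_zero_outside[of _ "ball Z R"] simp: sphere_def)
  qed (use r G T TZ in \<open>auto intro!: holomorphic_intros simp: sphere_def\<close>)
  moreover have "T p + (G p - T p) = G p" for p by simp
  ultimately have "(\<Sum>p\<in>S. winding_number (circlepath Z r) p * zorder G p) = (\<Sum>p\<in>{Z}. winding_number (circlepath Z r) p * zorder T p)"
    by (simp only: S_def TZ)
  then have "(\<Sum>p\<in>S. winding_number (circlepath Z r) p * zorder G p) = winding_number (circlepath Z r) Z * zorder T Z"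
    by simp
  also have "zorder T Z = 1"
    by (rule zorder_zero_eqI[OF T(1)]) (use R T in auto)
  also have "winding_number (circlepath Z r) Z = 1" using r by (simp add: winding_number_circlepath_centre)
  finally have "(\<Sum>p\<in>S. winding_number (circlepath Z r) p * zorder G p) = 1" by simp
  moreover have "(\<Sum>p\<in>S. winding_number (circlepath Z r) p * zorder G p) =
      (\<Sum>p\<in>{p\<in>S. cmod (p - Z) < r}. complex_of_int (zorder G p))"
  proof -
    have "(\<Sum>p\<in>S. winding_number (circlepath Z r) p * zorder G p) =
        (\<Sum>p\<in>S. if cmod (p - Z) < r then complex_of_int (zorder G p) else 0)"
      by (intro sum.cong) (simp_all add: wn)
    moreover have "finite S" using G(2) by (simp only: S_def)
    ultimately show ?thesis by (simp only: sum.inter_filter)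
  qed
  ultimately have "complex_of_int (\<Sum>p\<in>{p\<in>S. cmod (p - Z) < r}. zorder G p) = complex_of_int 1" by simp
  then have one: "(\<Sum>p\<in>{p\<in>S. cmod (p - Z) < r}. zorder G p) = 1" by (simp only: of_int_eq_iff)
  have pos: "zorder G p \<ge> 1" if "p \<in> S" for p
  proof -
    have nz: "\<exists>w\<in>ball Z R. G w \<noteq> 0"
    proof -
      have "cmod ((Z + of_real r) - Z) = r" using r by simp
      from less[OF this] have "G (Z + of_real r) \<noteq> 0" by auto
      then show ?thesis using r by (intro bexI[of _ "Z + of_real r"]) (auto simp: dist_norm)
    qed
    have "zorder G p > 0"
      using zorder_exist_zero[OF G(1) open_ball connected_ball _ nz, of p] that by (simp add: S_def)
    then show ?thesis by simp
  qed
  have "finite S" using G(2) by (simp only: S_def)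
  then have fin: "finite {p\<in>S. cmod (p - Z) < r}" by simp
  have "(\<Sum>p\<in>{p\<in>S. cmod (p - Z) < r}. 1) \<le> (\<Sum>p\<in>{p\<in>S. cmod (p - Z) < r}. zorder G p)"
    by (intro sum_mono) (use pos in auto)
  then have "int (card {p\<in>S. cmod (p - Z) < r}) \<le> 1" unfolding one by simp
  then have "card {p\<in>S. cmod (p - Z) < r} \<le> 1" by simp
  moreover have "{p\<in>S. cmod (p - Z) < r} \<noteq> {}"
  proof
    assume "{p\<in>S. cmod (p - Z) < r} = {}"
    with one have "(0 :: int) = 1" by (simp only: sum.empty)
    then show False by simp
  qed
  moreover from this have "card {p\<in>S. cmod (p - Z) < r} > 0" using fin by (simp only: card_gt_0_iff) simp
  ultimately have "card {p\<in>S. cmod (p - Z) < r} = 1" by linarith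
  then obtain p0 where p0: "{p\<in>S. cmod (p - Z) < r} = {p0}" by (auto simp: card_1_singleton_iff)
  have iff: "G p = 0 \<and> cmod (p - Z) \<le> r \<longleftrightarrow> p \<in> {p\<in>S. cmod (p - Z) < r}" for p
  proof
    assume p: "G p = 0 \<and> cmod (p - Z) \<le> r"
    then have "cmod (p - Z) \<noteq> r" using less[of p] by auto
    then show "p \<in> {p\<in>S. cmod (p - Z) < r}" using p r by (auto simp: S_def dist_norm norm_minus_commute)
  qed (auto simp: S_def)
  show ?thesis unfolding iff p0 by simp
qed

section \<open>Interaction of the two saddle points\<close>

text \<open>The Gaussian integral at the upper saddle point of the squared Hermite polynomial of degree \<open>k\<close>, times the squared
  value of the factor \<open>ym\<^sup>l\<close> there.\<close>
definition leading_coeff_at :: "real \<Rightarrow> nat \<Rightarrow> nat \<Rightarrow> complex" where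
  "leading_coeff_at \<theta> k l = gaussian_mean (curv \<theta>) 1 * ((1 / curv \<theta>) ^ k * fact k * (ym \<theta> (cis \<theta>) ^ l)\<^sup>2)"

lemma curv_eq_cis: "curv \<theta> = of_real (sin \<theta>) * cis (\<theta> - pi / 2)"
  by (simp add: curv_def complex_eq_iff cos_diff sin_diff)

text \<open>The square root of \<open>curv \<theta>\<close> with argument \<open>(\<theta> - \<pi> / 2) / 2\<close>, which lies strictly between \<open>- \<pi> / 4\<close> and
  \<open>\<pi> / 4\<close>, is the branch admissible in \<open>gaussian_mean_one\<close>.\<close>
lemma gaussian_mean_curv:
  assumes "0 < \<theta>" "\<theta> < pi"
  shows "gaussian_mean (curv \<theta>) 1 = of_real (sqrt (2 * pi) / sqrt (sin \<theta>)) * cis (- ((\<theta> - pi / 2) / 2))"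
proof -
  define \<phi> where "\<phi> = (\<theta> - pi / 2) / 2"
  define \<mu> where "\<mu> = of_real (sqrt (sin \<theta>)) * cis \<phi>"
  have s: "sin \<theta> > 0" using assms by (simp add: sin_gt_zero)
  have "cis \<phi> ^ 2 = cis (2 * \<phi>)" by (simp add: Complex.DeMoivre)
  also have "2 * \<phi> = \<theta> - pi / 2" by (simp add: \<phi>_def)
  finally have "\<mu>\<^sup>2 = of_real ((sqrt (sin \<theta>))\<^sup>2) * cis (\<theta> - pi / 2)"
    unfolding \<mu>_def power_mult_distrib by simp
  then have "\<mu>\<^sup>2 = curv \<theta>" using s by (simp add: curv_eq_cis)
  moreover have "\<bar>Im \<mu>\<bar> < Re \<mu>"
  proof -
    have \<phi>: "- (pi / 4) < \<phi>" "\<phi> < pi / 4" using assms by (auto simp: \<phi>_def)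
    then have c: "cos \<phi> > 0" by (intro cos_gt_zero_pi) auto
    have "cos (2 * \<phi>) > 0" using \<phi> by (intro cos_gt_zero_pi) auto
    then have "(sin \<phi>)\<^sup>2 < (cos \<phi>)\<^sup>2" by (simp add: cos_double)
    then have "\<bar>sin \<phi>\<bar> < cos \<phi>" using c power2_less_imp_less[of "\<bar>sin \<phi>\<bar>" "cos \<phi>"] by simp
    then show ?thesis using s by (simp add: \<mu>_def abs_mult)
  qed
  ultimately have "gaussian_mean (curv \<theta>) 1 = of_real (sqrt (2 * pi)) / \<mu>"
    using gaussian_mean_one[of \<mu>] by simp
  also have "\<dots> = of_real (sqrt (2 * pi) / sqrt (sin \<theta>)) * cis (- \<phi>)"
    by (simp add: \<mu>_def divide_inverse cis_inverse)
  finally show ?thesis by (simp add: \<phi>_def)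
qed

lemma leading_coeff_at_eq:
  assumes "0 < \<theta>" "\<theta> < pi"
  shows "leading_coeff_at \<theta> k l = of_real (sqrt (2 * pi) / sqrt (sin \<theta>) * fact k * (2 * sin \<theta>) ^ (2 * l) / sin \<theta> ^ k) *
    cis (- ((\<theta> - pi / 2) / 2) - real k * (\<theta> - pi / 2) + 2 * real l * \<theta>)"
proof -
  have "(1 / curv \<theta>) ^ k = of_real (1 / sin \<theta> ^ k) * cis (- (real k * (\<theta> - pi / 2)))"
  proof -
    have "1 / curv \<theta> = of_real (1 / sin \<theta>) * cis (- (\<theta> - pi / 2))"
      unfolding curv_eq_cis cis_inverse[symmetric] by (simp only: divide_inverse inverse_mult_distrib of_real_mult of_real_inverse of_real_1 mult_1)
    then have "(1 / curv \<theta>) ^ k = of_real (1 / sin \<theta>) ^ k * cis (real k * (- (\<theta> - pi / 2)))"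
      by (simp only: power_mult_distrib Complex.DeMoivre)
    also have "complex_of_real (1 / sin \<theta>) ^ k = of_real (1 / sin \<theta> ^ k)" by (simp add: power_divide)
    also have "real k * (- (\<theta> - pi / 2)) = - (real k * (\<theta> - pi / 2))" by (rule mult_minus_right)
    finally show ?thesis .
  qed
  moreover have "(ym \<theta> (cis \<theta>) ^ l)\<^sup>2 = of_real ((2 * sin \<theta>) ^ (2 * l)) * cis (2 * real l * \<theta>)"
  proof -
    have "(ym \<theta> (cis \<theta>) ^ l)\<^sup>2 = (2 * of_real (sin \<theta>) * cis \<theta>) ^ (2 * l)"
      unfolding ym_self power_mult[symmetric] mult.commute[of l 2] by (simp add: power_mult)
    also have "\<dots> = (2 * of_real (sin \<theta>)) ^ (2 * l) * cis (real (2 * l) * \<theta>)"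
      unfolding power_mult_distrib[of "2 * of_real (sin \<theta>)"] Complex.DeMoivre ..
    finally show ?thesis by (simp add: mult.assoc)
  qed
  ultimately have "leading_coeff_at \<theta> k l = of_real (sqrt (2 * pi) / sqrt (sin \<theta>)) * of_real (1 / sin \<theta> ^ k) * fact k * of_real ((2 * sin \<theta>) ^ (2 * l))
      * (cis (- ((\<theta> - pi / 2) / 2)) * cis (- (real k * (\<theta> - pi / 2))) * cis (2 * real l * \<theta>))"
    unfolding leading_coeff_at_def gaussian_mean_curv[OF assms] by (simp only: mult_ac)
  also have "cis (- ((\<theta> - pi / 2) / 2)) * cis (- (real k * (\<theta> - pi / 2))) * cis (2 * real l * \<theta>) =
      cis (- ((\<theta> - pi / 2) / 2) - real k * (\<theta> - pi / 2) + 2 * real l * \<theta>)"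
    unfolding cis_mult by (rule arg_cong[where f = cis]) simp
  finally show ?thesis by simp
qed

text \<open>Uniform bounds from both sides: from these come the lower bound for the product of the diagonal entries and
  the comparability of the contributions of the two saddle points.\<close>
lemma leading_coeff_at_bounds:
  assumes \<theta>: "0 < \<theta>" "\<theta> < pi" and s0: "0 < s0" "s0 \<le> sin \<theta>" and k: "k \<le> n" "l \<le> n"
  shows "s0 ^ (2 * n) \<le> cmod (leading_coeff_at \<theta> k l)"
    "cmod (leading_coeff_at \<theta> k l) \<le> sqrt (2 * pi) / sqrt s0 * fact n * 2 ^ (2 * n) / s0 ^ n"
proof -
  define s where "s = sin \<theta>"
  have s: "0 < s" "s0 \<le> s" "s \<le> 1" "s0 \<le> 1" using s0 order_trans[OF s0(2) sin_le_one] by (auto simp: s_def)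
  have norm: "cmod (leading_coeff_at \<theta> k l) = (sqrt (2 * pi) / sqrt s) * fact k * (2 * s) ^ (2 * l) / s ^ k"
    unfolding leading_coeff_at_eq[OF \<theta>] s_def[symmetric] norm_mult norm_of_real using s by simp
  have "1 \<le> sqrt (2 * pi) / sqrt s"
  proof -
    have "sqrt s \<le> sqrt (2 * pi)" using s pi_gt3 by (intro real_sqrt_le_mono) linarith
    then show ?thesis using s by simp
  qed
  moreover have "s0 ^ (2 * n) \<le> (2 * s) ^ (2 * l)"
  proof -
    have "s0 ^ (2 * n) \<le> s0 ^ (2 * l)" using s0 s k by (intro power_decreasing) auto
    also have "\<dots> \<le> (2 * s) ^ (2 * l)" using s0 s by (intro power_mono) auto
    finally show ?thesis .
  qed
  moreover have "1 \<le> 1 / s ^ k" using s by (simp add: power_le_one)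
  ultimately have "1 * 1 * s0 ^ (2 * n) * 1 \<le> (sqrt (2 * pi) / sqrt s) * fact k * (2 * s) ^ (2 * l) * (1 / s ^ k)"
    using s0 s by (intro mult_mono) (auto simp: fact_ge_1)
  then show "s0 ^ (2 * n) \<le> cmod (leading_coeff_at \<theta> k l)" unfolding norm by simp
  have "s0 ^ n \<le> s ^ k"
  proof -
    have "s0 ^ n \<le> s0 ^ k" using s0 s k by (intro power_decreasing) auto
    also have "\<dots> \<le> s ^ k" using s0 s by (intro power_mono) auto
    finally show ?thesis .
  qed
  then have 1: "1 / s ^ k \<le> 1 / s0 ^ n" using s0 by (intro divide_left_mono mult_pos_pos) (auto simp: s)
  have 2: "(2 * s) ^ (2 * l) \<le> 2 ^ (2 * n)"
  proof -
    have "(2 * s) ^ (2 * l) \<le> 2 ^ (2 * l)" using s by (intro power_mono) auto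
    also have "\<dots> \<le> (2 :: real) ^ (2 * n)" using k by (intro power_increasing) auto
    finally show ?thesis .
  qed
  have 3: "sqrt (2 * pi) / sqrt s \<le> sqrt (2 * pi) / sqrt s0" using s s0 by (intro divide_left_mono) auto
  have 4: "(fact k :: real) \<le> fact n" using k by (intro fact_mono) auto
  have "(sqrt (2 * pi) / sqrt s) * fact k * (2 * s) ^ (2 * l) * (1 / s ^ k)
      \<le> (sqrt (2 * pi) / sqrt s0) * fact n * 2 ^ (2 * n) * (1 / s0 ^ n)"
    using s s0 by (intro mult_mono 1 2 3 4) auto
  then show "cmod (leading_coeff_at \<theta> k l) \<le> sqrt (2 * pi) / sqrt s0 * fact n * 2 ^ (2 * n) / s0 ^ n" unfolding norm by simp
qed

lemma diagonal_gain_cases: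
  "x < a \<Longrightarrow> diagonal_gain \<theta> e a b x = leading_coeff_at \<theta> x b"
  "a \<le> x \<Longrightarrow> x < a + b \<Longrightarrow> diagonal_gain \<theta> e a b x = 0"
  by (auto simp: diagonal_gain_def leading_coeff_at_def)

text \<open>The last basis function behaves at the upper saddle point like \<open>ym\<^sup>b\<close> times the local Hermite polynomial
  of degree \<open>a\<close>.\<close>
lemma diagonal_gain_last:
  assumes "0 < s0"
  obtains C where "C \<ge> 0" "\<And>\<theta> e. 0 < \<theta> \<Longrightarrow> \<theta> < pi \<Longrightarrow> s0 \<le> sin \<theta> \<Longrightarrow> 0 < e \<Longrightarrow> e \<le> 1 \<Longrightarrow>
    cmod (diagonal_gain \<theta> e a b (a + b) - leading_coeff_at \<theta> a b) \<le> C * e"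
proof -
  have "1 / s0 \<ge> 0" using assms by simp
  then obtain D where D: "D \<ge> 0" "\<And>\<nu> x. cmod \<nu> \<le> 1 / s0 \<Longrightarrow> cmod x \<le> 2 \<Longrightarrow> cmod (poly (hermite_var \<nu> b) x - x ^ b) \<le> D * cmod \<nu>"
    using hermite_var_near_power[of "1 / s0" 2 b] by auto
  define U where "U = sqrt (2 * pi) / sqrt s0 * fact a * 2 ^ (2 * a) / s0 ^ a"
  have U: "U \<ge> 0" using assms by (simp add: U_def)
  define C where "C = U * ((D / s0) * (D / s0 + 2 * 2 ^ b))"
  show ?thesis
  proof (rule that)
    show "C \<ge> 0" unfolding C_def using U D(1) assms by (intro mult_nonneg_nonneg add_nonneg_nonneg divide_nonneg_nonneg) auto
    fix \<theta> e :: real assume \<theta>: "0 < \<theta>" "\<theta> < pi" and s: "s0 \<le> sin \<theta>" and e: "0 < e" "e \<le> 1"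
    define y where "y = ym \<theta> (cis \<theta>)"
    define \<nu> where "\<nu> = of_real (e\<^sup>2) * cnj (1 / curv \<theta>)"
    define h where "h = poly (hermite_var \<nu> b) y"
    have y: "cmod y \<le> 2" unfolding y_def by (rule ym_norm_le)
    have "cmod (curv \<theta>) = sin \<theta>" using s assms by (simp add: curv_eq_cis norm_mult)
    then have "cmod \<nu> = e\<^sup>2 * (1 / sin \<theta>)"
      unfolding \<nu>_def norm_mult complex_mod_cnj norm_divide norm_of_real by simp
    also have "\<dots> \<le> e\<^sup>2 * (1 / s0)" using s assms by (intro mult_left_mono divide_left_mono) auto
    finally have n1: "cmod \<nu> \<le> e\<^sup>2 * (1 / s0)" .
    have e2: "e\<^sup>2 \<le> e" using e by (simp add: power2_eq_square mult_left_le)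
    have "e\<^sup>2 * (1 / s0) \<le> e * (1 / s0)" by (rule mult_right_mono[OF e2]) (use assms in auto)
    then have n2: "cmod \<nu> \<le> e * (1 / s0)" using n1 by simp
    have "e * (1 / s0) \<le> 1 * (1 / s0)" by (rule mult_right_mono) (use e assms in auto)
    then have n3: "cmod \<nu> \<le> 1 / s0" using n2 by simp
    have d: "cmod (h - y ^ b) \<le> D * cmod \<nu>" unfolding h_def by (rule D(2)[OF n3 y])
    have d1: "cmod (h - y ^ b) \<le> (D / s0) * e"
      using order_trans[OF d mult_left_mono[OF n2 D(1)]] by simp
    have d2: "cmod (h - y ^ b) \<le> D / s0"
      using order_trans[OF d mult_left_mono[OF n3 D(1)]] by simp
    have yb: "cmod (y ^ b) \<le> 2 ^ b" unfolding norm_power by (rule power_mono[OF y]) simp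
    have "h + y ^ b = (h - y ^ b) + 2 * y ^ b" by simp
    then have "cmod (h + y ^ b) \<le> cmod (h - y ^ b) + cmod (2 * y ^ b)" using norm_triangle_ineq by metis
    then have sum: "cmod (h + y ^ b) \<le> D / s0 + 2 * 2 ^ b" using d2 yb by (simp add: norm_mult)
    have "h\<^sup>2 - (y ^ b)\<^sup>2 = (h - y ^ b) * (h + y ^ b)" by (simp add: power2_eq_square algebra_simps)
    then have "cmod (h\<^sup>2 - (y ^ b)\<^sup>2) = cmod (h - y ^ b) * cmod (h + y ^ b)" by (simp add: norm_mult)
    also have "\<dots> \<le> ((D / s0) * e) * (D / s0 + 2 * 2 ^ b)"
      using D(1) e assms by (intro mult_mono d1 sum) auto
    finally have sq: "cmod (h\<^sup>2 - (y ^ b)\<^sup>2) \<le> ((D / s0) * e) * (D / s0 + 2 * 2 ^ b)" .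
    have "diagonal_gain \<theta> e a b (a + b) - leading_coeff_at \<theta> a b = leading_coeff_at \<theta> a 0 * (h\<^sup>2 - (y ^ b)\<^sup>2)"
      by (simp add: diagonal_gain_def leading_coeff_at_def h_def y_def \<nu>_def algebra_simps)
    then have "cmod (diagonal_gain \<theta> e a b (a + b) - leading_coeff_at \<theta> a b) = cmod (leading_coeff_at \<theta> a 0) * cmod (h\<^sup>2 - (y ^ b)\<^sup>2)"
      by (simp add: norm_mult)
    also have "\<dots> \<le> U * (((D / s0) * e) * (D / s0 + 2 * 2 ^ b))"
      unfolding U_def using leading_coeff_at_bounds(2)[OF \<theta> assms s, of a a 0] U[unfolded U_def]
      by (intro mult_mono sq) auto
    finally show "cmod (diagonal_gain \<theta> e a b (a + b) - leading_coeff_at \<theta> a b) \<le> C * e" by (simp add: C_def mult_ac)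
  qed
qed

text \<open>Each half circle contributes a nearly diagonal matrix, and the conjugation symmetry maps diagonal
  entries to diagonal entries.\<close>
lemma gram_circle_functional:
  assumes "s0 > 0"
  obtains C where "C \<ge> 0"
   "\<And>E \<theta> q \<eta> N x y. saddle E \<theta> q \<beta> s0 \<eta> N \<Longrightarrow> x \<le> a + b \<Longrightarrow> y \<le> a + b \<Longrightarrow>
    cmod (circle_functional E N (of_real (cos \<theta>) + \<eta>) (\<lambda>u. saddle_basis \<theta> (1 / sqrt E) a b x u * saddle_basis \<theta> (1 / sqrt E) a b y u)
      - (if x = y then of_real (1 / sqrt E) ^ (2 * a + 1) * circle_weight E N (of_real (cos \<theta>) + \<eta>) \<theta> * diagonal_gain \<theta> (1 / sqrt E) a b x
          + of_real (1 / sqrt E) ^ (2 * b + 1) * circle_weight E N (of_real (cos \<theta>) + \<eta>) (- \<theta>) * cnj (diagonal_gain \<theta> (1 / sqrt E) b a (mirror a b x)) else 0))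
    \<le> C * (q / sqrt E) * (cmod (of_real (1 / sqrt E) ^ (2 * a + 1) * circle_weight E N (of_real (cos \<theta>) + \<eta>) \<theta>)
        + cmod (of_real (1 / sqrt E) ^ (2 * b + 1) * circle_weight E N (of_real (cos \<theta>) + \<eta>) (- \<theta>)))"
proof -
  obtain C1 where C1: "C1 \<ge> 0"
   "\<And>E \<theta> q \<eta> N x y. saddle E \<theta> q \<beta> s0 \<eta> N \<Longrightarrow> x \<le> a + b \<Longrightarrow> y \<le> a + b \<Longrightarrow>
    cmod (upper_arc E N (of_real (cos \<theta>) + \<eta>) (\<lambda>u. saddle_basis \<theta> (1 / sqrt E) a b x u * saddle_basis \<theta> (1 / sqrt E) a b y u)
      - of_real (1 / sqrt E) ^ (2 * a + 1) * circle_weight E N (of_real (cos \<theta>) + \<eta>) \<theta> * (if x = y then diagonal_gain \<theta> (1 / sqrt E) a b x else 0))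
    \<le> C1 * (q / sqrt E) * cmod (of_real (1 / sqrt E) ^ (2 * a + 1) * circle_weight E N (of_real (cos \<theta>) + \<eta>) \<theta>)"
    by (rule gram_arc[OF assms, where a = a and b = b and \<beta> = \<beta>]) (rule that)
  obtain C2 where C2: "C2 \<ge> 0"
   "\<And>E \<theta> q \<eta> N x y. saddle E \<theta> q \<beta> s0 \<eta> N \<Longrightarrow> x \<le> b + a \<Longrightarrow> y \<le> b + a \<Longrightarrow>
    cmod (upper_arc E N (of_real (cos \<theta>) + \<eta>) (\<lambda>u. saddle_basis \<theta> (1 / sqrt E) b a x u * saddle_basis \<theta> (1 / sqrt E) b a y u)
      - of_real (1 / sqrt E) ^ (2 * b + 1) * circle_weight E N (of_real (cos \<theta>) + \<eta>) \<theta> * (if x = y then diagonal_gain \<theta> (1 / sqrt E) b a x else 0))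
    \<le> C2 * (q / sqrt E) * cmod (of_real (1 / sqrt E) ^ (2 * b + 1) * circle_weight E N (of_real (cos \<theta>) + \<eta>) \<theta>)"
    by (rule gram_arc[OF assms, where a = b and b = a and \<beta> = \<beta>]) (rule that)
  have main: "cmod (circle_functional E N (of_real (cos \<theta>) + \<eta>) (\<lambda>u. saddle_basis \<theta> (1 / sqrt E) a b x u * saddle_basis \<theta> (1 / sqrt E) a b y u)
      - (if x = y then of_real (1 / sqrt E) ^ (2 * a + 1) * circle_weight E N (of_real (cos \<theta>) + \<eta>) \<theta> * diagonal_gain \<theta> (1 / sqrt E) a b x
          + of_real (1 / sqrt E) ^ (2 * b + 1) * circle_weight E N (of_real (cos \<theta>) + \<eta>) (- \<theta>) * cnj (diagonal_gain \<theta> (1 / sqrt E) b a (mirror a b x)) else 0))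
    \<le> (C1 + C2) * (q / sqrt E) * (cmod (of_real (1 / sqrt E) ^ (2 * a + 1) * circle_weight E N (of_real (cos \<theta>) + \<eta>) \<theta>)
        + cmod (of_real (1 / sqrt E) ^ (2 * b + 1) * circle_weight E N (of_real (cos \<theta>) + \<eta>) (- \<theta>)))"
    if s: "saddle E \<theta> q \<beta> s0 \<eta> N" and x: "x \<le> a + b" and y: "y \<le> a + b"
    for E \<theta> q :: real and \<eta> :: complex and N x y :: nat
  proof -
    define e where "e = 1 / sqrt E"
    define \<zeta> where "\<zeta> = of_real (cos \<theta>) + \<eta>"
    define P where "P = of_real e ^ (2 * a + 1) * circle_weight E N \<zeta> \<theta>"
    define Q where "Q = of_real e ^ (2 * b + 1) * circle_weight E N \<zeta> (- \<theta>)"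
    define mx where "mx = mirror a b x"
    define my where "my = mirror a b y"
    have m: "mx \<le> b + a" "my \<le> b + a" "mx = my \<longleftrightarrow> x = y"
      using x y by (auto simp: mx_def my_def mirror_def)
    define U where "U = upper_arc E N \<zeta> (\<lambda>u. saddle_basis \<theta> e a b x u * saddle_basis \<theta> e a b y u)"
    define V where "V = upper_arc E N (cnj \<zeta>) (\<lambda>u. saddle_basis \<theta> e b a mx u * saddle_basis \<theta> e b a my u)"
    have cont: "continuous_on UNIV (\<lambda>u. saddle_basis \<theta> e a b x u * saddle_basis \<theta> e a b y u)"
      by (intro continuous_intros continuous_on_polyfun[OF polyfun_saddle_basis] x y)
    have circle_functional: "circle_functional E N \<zeta> (\<lambda>u. saddle_basis \<theta> e a b x u * saddle_basis \<theta> e a b y u) = U + cnj V"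
      unfolding circle_functional_def lower_arc_eq_cnj[OF cont] U_def V_def mx_def my_def by (simp add: saddle_basis_cnj)
    have kc: "cnj (circle_weight E N (cnj \<zeta>) \<theta>) = circle_weight E N \<zeta> (- \<theta>)"
      by (simp add: circle_weight_def cis_cnj exp_cnj)
    have Qc: "Q = cnj (of_real e ^ (2 * b + 1) * circle_weight E N (cnj \<zeta>) \<theta>)"
      unfolding Q_def complex_cnj_mult kc by simp
    have zc: "cnj \<zeta> = of_real (cos \<theta>) + cnj \<eta>" by (simp add: \<zeta>_def)
    have s': "saddle E \<theta> q \<beta> s0 (cnj \<eta>) N" using s by (simp add: saddle_def)
    have 1: "cmod (U - P * (if x = y then diagonal_gain \<theta> e a b x else 0)) \<le> C1 * (q / sqrt E) * cmod P"
      unfolding U_def P_def \<zeta>_def e_def by (rule C1(2)[OF s x y])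
    have "cmod (V - (of_real e ^ (2 * b + 1) * circle_weight E N (cnj \<zeta>) \<theta>) * (if mx = my then diagonal_gain \<theta> e b a mx else 0))
        \<le> C2 * (q / sqrt E) * cmod (of_real e ^ (2 * b + 1) * circle_weight E N (cnj \<zeta>) \<theta>)"
      unfolding V_def zc e_def by (rule C2(2)[OF s' m(1,2)])
    then have "cmod (cnj (V - (of_real e ^ (2 * b + 1) * circle_weight E N (cnj \<zeta>) \<theta>) * (if mx = my then diagonal_gain \<theta> e b a mx else 0)))
        \<le> C2 * (q / sqrt E) * cmod Q"
      unfolding complex_mod_cnj Qc .
    then have 2: "cmod (cnj V - Q * (if x = y then cnj (diagonal_gain \<theta> e b a mx) else 0)) \<le> C2 * (q / sqrt E) * cmod Q"
      unfolding complex_cnj_diff complex_cnj_mult[of "_ * circle_weight E N (cnj \<zeta>) \<theta>"] Qc[symmetric] m(3) by (simp split: if_splits)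
    have eq: "U + cnj V - (if x = y then P * diagonal_gain \<theta> e a b x + Q * cnj (diagonal_gain \<theta> e b a mx) else 0)
        = (U - P * (if x = y then diagonal_gain \<theta> e a b x else 0)) + (cnj V - Q * (if x = y then cnj (diagonal_gain \<theta> e b a mx) else 0))"
      by simp
    have "1 \<le> q" "q \<le> sqrt E" using s by (simp_all add: saddle_def)
    then have qE: "q / sqrt E \<ge> 0" by (intro divide_nonneg_nonneg) linarith+
    have "cmod (U + cnj V - (if x = y then P * diagonal_gain \<theta> e a b x + Q * cnj (diagonal_gain \<theta> e b a mx) else 0))
        \<le> C1 * (q / sqrt E) * cmod P + C2 * (q / sqrt E) * cmod Q"
      unfolding eq by (rule norm_triangle_le[OF add_mono[OF 1 2]])
    also have "\<dots> \<le> (C1 + C2) * (q / sqrt E) * cmod P + (C1 + C2) * (q / sqrt E) * cmod Q"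
      using qE C1(1) C2(1) by (intro add_mono mult_right_mono) auto
    also have "\<dots> = (C1 + C2) * (q / sqrt E) * (cmod P + cmod Q)" by (simp add: distrib_left)
    finally show ?thesis unfolding e_def[symmetric] \<zeta>_def[symmetric] P_def[symmetric] Q_def[symmetric] circle_functional mx_def[symmetric] .
  qed
  have "C1 + C2 \<ge> 0" using C1(1) C2(1) by simp
  from that[OF this main] show ?thesis .
qed

lemma f_cos: "0 \<le> \<theta> \<Longrightarrow> \<theta> \<le> pi \<Longrightarrow> f (cos \<theta>) = (cos \<theta> * sin \<theta> - \<theta>) / 2 + pi / 4"
proof -
  assume \<theta>: "0 \<le> \<theta>" "\<theta> \<le> pi"
  have "1 - (cos \<theta>)\<^sup>2 = (sin \<theta>)\<^sup>2" using sin_cos_squared_add[of \<theta>] by linarith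
  then have "sqrt (1 - (cos \<theta>)\<^sup>2) = sin \<theta>" using \<theta> sin_ge_zero by simp
  then show ?thesis using \<theta> by (simp add: f_def arccos_cos)
qed

text \<open>The quotient of the lower and the upper contribution to the last diagonal entry. Its modulus at \<open>\<eta> = 0\<close>
  compares the powers \<open>E\<^bsup>-a\<^esup>\<close> and \<open>E\<^bsup>-b\<^esup>\<close>, powers of \<open>sin \<theta>\<close>, and the constants \<open>a!\<close> and \<open>b!\<close> from orthogonality. Its phase
  consists of the difference of the exponents at \<open>e\<^bsup>i\<theta>\<^esup>\<close> and \<open>e\<^bsup>-i\<theta>\<^esup>\<close>, of the arguments of the square roots of the
  curvature and of the powers of \<open>ym\<close>, and these add up to \<open>m \<pi> - 2 E f (cos \<theta>)\<close> precisely because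
  \<open>E = 2 m + n\<close> (and not, say, \<open>2 m\<close>).\<close>
lemma leading_ratio:
  fixes \<theta> E :: real and \<eta> :: complex
  assumes \<theta>: "0 < \<theta>" "\<theta> < pi" and n: "n = a + b + 1" and E: "E = real (2 * m + n)" and m: "m \<ge> 1"
  defines "e \<equiv> 1 / sqrt E" and "\<zeta> \<equiv> of_real (cos \<theta>) + \<eta>"
  shows "of_real e ^ (2 * b + 1) * circle_weight E (m + n - 1) \<zeta> (- \<theta>) * cnj (leading_coeff_at \<theta> b a) =
    (of_real e ^ (2 * a + 1) * circle_weight E (m + n - 1) \<zeta> \<theta> * leading_coeff_at \<theta> a b) *
    (((-1) ^ m * exp (- (2 * \<i> * of_real (E * f (cos \<theta>))))) *
     of_real (fact b / fact a * (4 * E * sin \<theta> ^ 3) ^ a / (4 * E * sin \<theta> ^ 3) ^ b) *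
     exp (- (2 * \<i> * of_real (sin \<theta> * E) * \<eta>)))"
proof -
  define N where "N = m + n - 1"
  define s where "s = sin \<theta>"
  have s: "s > 0" using \<theta> by (simp add: s_def sin_gt_zero)
  have E0: "E > 0" using m by (simp add: E)
  have e: "e > 0" "e\<^sup>2 = 1 / E" using E0 by (simp_all add: e_def power_divide)
  have rN: "real N = E / 2 + real n / 2 - 1" using m by (simp add: N_def E field_simps)
  define c0 where "c0 = sqrt (2 * pi) / sqrt s"
  have c0: "c0 > 0" using s by (simp add: c0_def)
  define X where "X = of_real E * (\<zeta> * cis \<theta> - cis (2 * \<theta>) / 4)"
  define Y where "Y = - (2 * \<i> * of_real (s * E) * \<eta>)"
  define al where "al = - ((\<theta> - pi / 2) / 2) - real a * (\<theta> - pi / 2) + 2 * real b * \<theta>"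
  define be where "be = - ((\<theta> - pi / 2) / 2) - real b * (\<theta> - pi / 2) + 2 * real a * \<theta>"
  have kapm: "circle_weight E N \<zeta> (- \<theta>) = exp X * exp Y * cis (real N * \<theta> - E * s * cos \<theta>)"
  proof -
    have d1: "cis (- \<theta>) = cis \<theta> - 2 * \<i> * of_real s" by (simp add: s_def complex_eq_iff)
    have d2: "cis (2 * (- \<theta>)) = cis (2 * \<theta>) - 4 * \<i> * of_real (s * cos \<theta>)"
      by (simp add: s_def complex_eq_iff sin_double)
    have arg: "of_real E * (\<zeta> * cis (- \<theta>) - cis (2 * (- \<theta>)) / 4) = X + Y + \<i> * of_real (- (E * s * cos \<theta>))"
      unfolding d1 d2 X_def Y_def \<zeta>_def by (simp add: field_simps)
    have "circle_weight E N \<zeta> (- \<theta>) = exp X * exp Y * cis (- (E * s * cos \<theta>)) * cis (- (real N * (- \<theta>)))"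
      unfolding circle_weight_def arg exp_add cis_conv_exp[symmetric] ..
    also have "\<dots> = exp X * exp Y * cis (- (E * s * cos \<theta>) + - (real N * (- \<theta>)))"
      by (simp only: mult.assoc cis_mult)
    also have "- (E * s * cos \<theta>) + - (real N * (- \<theta>)) = real N * \<theta> - E * s * cos \<theta>" by simp
    finally show ?thesis .
  qed
  have kapp: "circle_weight E N \<zeta> \<theta> = exp X * cis (- (real N * \<theta>))" by (simp add: circle_weight_def X_def)
  have la: "leading_coeff_at \<theta> a b = of_real (c0 * fact a * (2 * s) ^ (2 * b) / s ^ a) * cis al"
    unfolding leading_coeff_at_eq[OF \<theta>] al_def c0_def s_def ..
  have lb: "cnj (leading_coeff_at \<theta> b a) = of_real (c0 * fact b * (2 * s) ^ (2 * a) / s ^ b) * cis (- be)"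
    unfolding leading_coeff_at_eq[OF \<theta>] be_def[symmetric] c0_def[symmetric] s_def[symmetric]
    by (simp only: complex_cnj_mult complex_cnj_complex_of_real cis_cnj)
  have phase: "((-1) ^ m * exp (- (2 * \<i> * of_real (E * f (cos \<theta>))))) = cis (real m * pi - 2 * E * f (cos \<theta>))"
  proof -
    have "(-1 :: complex) ^ m = cis (real m * pi)" using Complex.DeMoivre[of pi m] by simp
    moreover have "exp (- (2 * \<i> * of_real (E * f (cos \<theta>)))) = cis (- (2 * E * f (cos \<theta>)))"
      unfolding cis_conv_exp by (rule arg_cong[where f = exp]) simp
    ultimately show ?thesis by (simp add: cis_mult)
  qed
  have angle: "(real N * \<theta> - E * s * cos \<theta>) + (- be) = - (real N * \<theta>) + al + (real m * pi - 2 * E * f (cos \<theta>))"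
  proof -
    have f2: "2 * E * f (cos \<theta>) = E * s * cos \<theta> - E * \<theta> + E * pi / 2"
      using \<theta> by (simp add: f_cos s_def field_simps)
    have nn: "real n = real a + real b + 1" by (simp add: n)
    have Em: "real m = (E - real n) / 2" by (simp add: E)
    show ?thesis unfolding f2 al_def be_def rN Em nn by (simp add: field_simps)
  qed
  have modulus: "e ^ (2 * b + 1) * (c0 * fact b * (2 * s) ^ (2 * a) / s ^ b) =
      e ^ (2 * a + 1) * (c0 * fact a * (2 * s) ^ (2 * b) / s ^ a) * (fact b / fact a * (4 * E * s ^ 3) ^ a / (4 * E * s ^ 3) ^ b)"
  proof -
    have p: "e ^ (2 * k + 1) = e / E ^ k" for k
      unfolding power_add power_mult e(2) by (simp add: power_divide)
    have q: "(2 * s) ^ (2 * k) = (4 * s\<^sup>2) ^ k" for k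
      unfolding power_mult by (simp add: power_mult_distrib)
    have r: "(4 * E * s ^ 3) ^ k = (4 * s\<^sup>2) ^ k * E ^ k * s ^ k" for k
      unfolding power_mult_distrib[symmetric] by (simp add: power2_eq_square power3_eq_cube mult_ac)
    have cancel: "x / Eb * (c * fb * qa / sb) = x / Ea * (c * fa * qb / sa) * (fb / fa * (qa * Ea * sa) / (qb * Eb * sb))"
      if "Ea \<noteq> 0" "Eb \<noteq> 0" "fa \<noteq> 0" "qb \<noteq> 0" "sa \<noteq> 0" "sb \<noteq> 0" for x c fa fb qa qb sa sb Ea Eb :: real
      using that by (simp add: field_simps)
    show ?thesis unfolding p q r by (rule cancel) (use s E0 in simp_all)
  qed
  have "of_real e ^ (2 * b + 1) * circle_weight E N \<zeta> (- \<theta>) * cnj (leading_coeff_at \<theta> b a) =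
      of_real (e ^ (2 * b + 1) * (c0 * fact b * (2 * s) ^ (2 * a) / s ^ b)) * (exp X * exp Y) *
      cis ((real N * \<theta> - E * s * cos \<theta>) + (- be))"
    unfolding kapm lb cis_mult[symmetric] of_real_mult[of "e ^ _"] of_real_power by (simp only: mult_ac)
  also have "\<dots> = (of_real e ^ (2 * a + 1) * circle_weight E N \<zeta> \<theta> * leading_coeff_at \<theta> a b) *
    (cis (real m * pi - 2 * E * f (cos \<theta>)) *
     of_real (fact b / fact a * (4 * E * s ^ 3) ^ a / (4 * E * s ^ 3) ^ b) * exp Y)"
    unfolding angle modulus kapp la cis_mult[symmetric] of_real_mult[of "e ^ _"] of_real_mult[of "e ^ _ * _"] of_real_power
    by (simp only: mult_ac)
  finally show ?thesis unfolding phase N_def s_def Y_def .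
qed

section \<open>One zero near the approximate zero\<close>

lemma one_minus_exp_ge:
  fixes w :: complex
  assumes "cmod w \<le> 1 / 8"
  shows "cmod w / 2 \<le> cmod (1 - exp w)"
proof -
  have "cmod (exp w - (\<Sum>k\<le>1. w ^ k / fact k)) \<le> exp \<bar>Re w\<bar> * cmod w ^ Suc 1 / fact 1"
    by (rule Taylor_exp)
  then have "cmod (exp w - 1 - w) \<le> exp \<bar>Re w\<bar> * (cmod w * cmod w)" by (simp add: algebra_simps)
  also have "\<dots> \<le> 3 * (1 / 8 * cmod w)"
  proof (intro mult_mono assms order_refl)
    have "\<bar>Re w\<bar> \<le> 1" using assms abs_Re_le_cmod[of w] by linarith
    then have "exp \<bar>Re w\<bar> \<le> exp 1" by simp
    then show "exp \<bar>Re w\<bar> \<le> 3" using exp_le by linarith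
  qed auto
  finally have "cmod (exp w - 1 - w) \<le> 3 / 8 * cmod w" by simp
  moreover have "cmod w \<le> cmod (1 - exp w) + cmod (exp w - 1 - w)"
  proof -
    have "cmod (- w) \<le> cmod (1 - exp w) + cmod (exp w - 1 - w)"
      using norm_triangle_ineq[of "1 - exp w" "exp w - 1 - w"] by simp
    then show ?thesis by simp
  qed
  ultimately show ?thesis using norm_ge_zero[of w] by linarith
qed

lemma circle_weight_nonzero: "circle_weight E N \<zeta> t \<noteq> 0"
  by (simp add: circle_weight_def)

lemma norm_exp_bounds:
  fixes w :: complex
  assumes "cmod w \<le> 1 / 8"
  shows "cmod (exp w) \<le> 3" "1 / 3 \<le> cmod (exp w)"
proof -
  have r: "\<bar>Re w\<bar> \<le> 1" using assms abs_Re_le_cmod[of w] by linarith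
  then have "exp (Re w) \<le> exp 1" by simp
  then show "cmod (exp w) \<le> 3" using exp_le by (simp only: norm_exp_eq_Re)
  have "exp (- 1) \<le> exp (Re w)" using r by simp
  moreover have "1 / 3 \<le> exp (- 1 :: real)" using exp_le by (simp add: exp_minus field_simps)
  ultimately show "1 / 3 \<le> cmod (exp w)" by (simp only: norm_exp_eq_Re)
qed

lemma prod_ge_power:
  fixes h :: "nat \<Rightarrow> real"
  assumes "\<And>x. x < k \<Longrightarrow> c \<le> h x" "0 \<le> c"
  shows "c ^ k \<le> (\<Prod>x<k. h x)"
  using prod_mono[of "{..<k}" "\<lambda>_. c" h] assms by simp

text \<open>The two equations assumed for \<open>\<theta>\<close> and \<open>\<alpha>\<close> say that the ratio in \<open>leading_ratio\<close> equals \<open>-1\<close> at the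
  point \<open>\<surd>E (cos \<theta> + \<i> \<alpha>)\<close>: the first concerns the phase, the second the modulus. Around that point
  the Gram determinant is compared by Rouche's theorem with the product of the leading diagonal terms.
  The number \<open>E0\<close> depends on \<open>n\<close>, \<open>a\<close>, \<open>b\<close> and \<open>s0\<close> only.\<close>
lemma one_zero_in_disc:
  fixes H :: "nat \<Rightarrow> nat \<Rightarrow> complex poly" and s0 :: real
  assumes H: "generalised_hermite H" and s0: "0 < s0" and n: "n = a + b + 1"
  shows "\<exists>E0. \<forall>m \<theta> \<alpha>. m \<ge> 1 \<longrightarrow> real (2 * m + n) \<ge> E0 \<longrightarrow> 0 < \<theta> \<longrightarrow> \<theta> < pi \<longrightarrow> s0 \<le> sin \<theta> \<longrightarrow>
    real (2 * m + n) * \<bar>\<alpha>\<bar> \<le> real (2 * m + n) powr (1 / 12) - 1 \<longrightarrow>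
    (-1) ^ m * exp (- (2 * \<i> * of_real (real (2 * m + n) * f (cos \<theta>)))) = -1 \<longrightarrow>
    fact b / fact a * (4 * real (2 * m + n) * sin \<theta> ^ 3) ^ a / (4 * real (2 * m + n) * sin \<theta> ^ 3) ^ b *
      exp (2 * (sin \<theta> * real (2 * m + n)) * \<alpha>) = 1 \<longrightarrow>
    (\<exists>!z. poly (H m n) z = 0 \<and>
      cmod (z - of_real (sqrt (real (2 * m + n))) * (of_real (cos \<theta>) + \<i> * of_real \<alpha>)) \<le> real (2 * m + n) powr (-5/6))"
proof -
  define \<beta> where "\<beta> = real n / 2 - 1"
  obtain Cg where Cg: "Cg \<ge> 0"
   "\<And>E \<theta> q \<eta> N x y. saddle E \<theta> q \<beta> s0 \<eta> N \<Longrightarrow> x \<le> a + b \<Longrightarrow> y \<le> a + b \<Longrightarrow>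
    cmod (circle_functional E N (of_real (cos \<theta>) + \<eta>) (\<lambda>u. saddle_basis \<theta> (1 / sqrt E) a b x u * saddle_basis \<theta> (1 / sqrt E) a b y u)
      - (if x = y then of_real (1 / sqrt E) ^ (2 * a + 1) * circle_weight E N (of_real (cos \<theta>) + \<eta>) \<theta> * diagonal_gain \<theta> (1 / sqrt E) a b x
          + of_real (1 / sqrt E) ^ (2 * b + 1) * circle_weight E N (of_real (cos \<theta>) + \<eta>) (- \<theta>) * cnj (diagonal_gain \<theta> (1 / sqrt E) b a (mirror a b x)) else 0))
    \<le> Cg * (q / sqrt E) * (cmod (of_real (1 / sqrt E) ^ (2 * a + 1) * circle_weight E N (of_real (cos \<theta>) + \<eta>) \<theta>)
        + cmod (of_real (1 / sqrt E) ^ (2 * b + 1) * circle_weight E N (of_real (cos \<theta>) + \<eta>) (- \<theta>)))"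
    by (rule gram_circle_functional[OF s0, where a = a and b = b and \<beta> = \<beta>]) (rule that)
  obtain Ca where Ca: "Ca \<ge> 0" "\<And>\<theta> e. 0 < \<theta> \<Longrightarrow> \<theta> < pi \<Longrightarrow> s0 \<le> sin \<theta> \<Longrightarrow> 0 < e \<Longrightarrow> e \<le> 1 \<Longrightarrow>
      cmod (diagonal_gain \<theta> e a b (a + b) - leading_coeff_at \<theta> a b) \<le> Ca * e"
    by (rule diagonal_gain_last[OF s0, where a = a and b = b]) (rule that)
  obtain Cb where Cb: "Cb \<ge> 0" "\<And>\<theta> e. 0 < \<theta> \<Longrightarrow> \<theta> < pi \<Longrightarrow> s0 \<le> sin \<theta> \<Longrightarrow> 0 < e \<Longrightarrow> e \<le> 1 \<Longrightarrow>
      cmod (diagonal_gain \<theta> e b a (b + a) - leading_coeff_at \<theta> b a) \<le> Cb * e"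
    by (rule diagonal_gain_last[OF s0, where a = b and b = a]) (rule that)
  define L where "L = s0 ^ (2 * n)"
  define U where "U = sqrt (2 * pi) / sqrt s0 * fact n * 2 ^ (2 * n) / s0 ^ n + L"
  have L: "L > 0" using s0 by (simp add: L_def)
  have U: "U \<ge> L" unfolding U_def using s0 by simp
  define P where "P = 3 * U / L"
  have P: "P \<ge> 3" using U L by (simp add: P_def field_simps)
  define R where "R = 1 + 4 * U + P * U"
  have R: "R \<ge> 1" using U L P by (simp add: R_def)
  define Ce where "Ce = (1 + P) * (Cg + Ca + Cb)"
  have Ce: "Ce \<ge> 0" using P Cg(1) Ca(1) Cb(1) by (simp add: Ce_def)
  define Wc where "Wc = fact n * (real n * (R + 1) ^ n) * Ce"
  have Wc: "Wc \<ge> 0" using Ce R by (simp add: Wc_def)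
  define l0 where "l0 = L * L / (3 * U)"
  have l0: "l0 > 0" using L U by (simp add: l0_def)
  have l0_le: "l0 \<le> L" using L U by (simp add: l0_def field_simps)
  define l1 where "l1 = l0 ^ (a + b) * (L * s0)"
  have l1: "l1 > 0" using l0 L s0 by (simp add: l1_def)
  have "\<forall>\<^sub>F E in at_top. 1 \<le> E \<and> Ce * E powr (-5/12) < 1 \<and> Wc * E powr (-1/12) < l1 \<and> 4 * E powr (-1/3) < 1 / 8"
  proof (intro eventually_conj eventually_ge_at_top)
    have t: "((\<lambda>E :: real. c * E powr - p) \<longlongrightarrow> 0) at_top" if "p > 0" for c p :: real
      using tendsto_mult_right_zero[OF tendsto_neg_powr[OF _ filterlim_ident, of "- p"], of c] that by simp
    show "\<forall>\<^sub>F E in at_top. Ce * E powr (-5/12) < 1"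
      using order_tendstoD(2)[OF t[of "5/12" Ce], of 1] by simp
    show "\<forall>\<^sub>F E in at_top. Wc * E powr (-1/12) < l1"
      using order_tendstoD(2)[OF t[of "1/12" Wc], of l1] l1 by simp
    show "\<forall>\<^sub>F E :: real in at_top. 4 * E powr (-1/3) < 1 / 8"
      using order_tendstoD(2)[OF t[of "1/3" 4], of "1/8"] by simp
  qed
  then obtain E0 where E0: "\<And>E. E \<ge> E0 \<Longrightarrow> 1 \<le> E \<and> Ce * E powr (-5/12) < 1 \<and> Wc * E powr (-1/12) < l1 \<and> 4 * E powr (-1/3) < 1 / 8"
    unfolding eventually_at_top_linorder by blast
  show ?thesis
  proof (intro exI[of _ E0] allI impI)
    fix m \<theta> \<alpha>
    assume m: "1 \<le> m" and EE0: "E0 \<le> real (2 * m + n)" and \<theta>: "0 < \<theta>" "\<theta> < pi" and s0s: "s0 \<le> sin \<theta>"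
      and al: "real (2 * m + n) * \<bar>\<alpha>\<bar> \<le> real (2 * m + n) powr (1 / 12) - 1"
      and ph: "(-1) ^ m * exp (- (2 * \<i> * of_real (real (2 * m + n) * f (cos \<theta>)))) = -1"
      and md: "fact b / fact a * (4 * real (2 * m + n) * sin \<theta> ^ 3) ^ a / (4 * real (2 * m + n) * sin \<theta> ^ 3) ^ b *
        exp (2 * (sin \<theta> * real (2 * m + n)) * \<alpha>) = 1"
    define E where "E = real (2 * m + n)"
    define N where "N = m + n - 1"
    define e where "e = 1 / sqrt E"
    \<comment> \<open>Any exponent in \<open>(0, 1/6)\<close> works: it has to beat \<open>log E\<close> and keep \<open>q / \<surd>E\<close> below \<open>E\<^bsup>-1/3\<^esup>\<close>.\<close>
    define q where "q = E powr (1 / 12)"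
    define r where "r = E powr (-5/6)"
    define s where "s = sin \<theta>"
    define \<kappa> where "\<kappa> = 2 * s * sqrt E"
    define Z where "Z = of_real (sqrt E) * (of_real (cos \<theta>) + \<i> * of_real \<alpha>)"
    have E: "1 \<le> E" "Ce * E powr (-5/12) < 1" "Wc * E powr (-1/12) < l1" "4 * E powr (-1/3) < 1 / 8"
      using E0[OF EE0] by (simp_all add: E_def)
    have sE: "sqrt E = E powr (1/2)" "sqrt E > 0" using E(1) by (simp_all add: powr_half_sqrt)
    have s: "0 < s" "s \<le> 1" "s0 \<le> s" using s0 s0s by (simp_all add: s_def)
    have r: "r > 0" using E(1) by (simp add: r_def)
    have e: "0 < e" "e \<le> 1" using E(1) by (simp_all add: e_def)
    have sr: "sqrt E * r = E powr (-1/3)"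
      unfolding sE(1) r_def powr_add[symmetric] by simp
    have qe: "q / sqrt E = E powr (-5/12)"
      unfolding sE(1) q_def powr_diff[symmetric] by simp
    have q1: "1 \<le> q" "q \<le> sqrt E"
    proof -
      show "1 \<le> q" unfolding q_def using E(1) by (intro ge_one_powr_ge_zero) auto
      show "q \<le> sqrt E" unfolding q_def sE(1) using E(1) by (intro powr_mono) auto
    qed
    define Kp where "Kp z = of_real e ^ (2 * a + 1) * circle_weight E N (z / of_real (sqrt E)) \<theta>" for z
    define Km where "Km z = of_real e ^ (2 * b + 1) * circle_weight E N (z / of_real (sqrt E)) (- \<theta>)" for z
    define \<rho> where "\<rho> z = Km z / Kp z" for z
    define w where "w z = - (\<i> * of_real \<kappa> * (z - Z))" for z
    have K0: "Kp z \<noteq> 0" "Km z \<noteq> 0" for z using e by (simp_all add: Kp_def Km_def circle_weight_nonzero)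
    have hol: "Kp holomorphic_on A" "Km holomorphic_on A" "w holomorphic_on A" "\<rho> holomorphic_on A" for A
    proof -
      show 1: "Kp holomorphic_on A" and 2: "Km holomorphic_on A" and "w holomorphic_on A"
        unfolding Kp_def Km_def circle_weight_def w_def using sE(2) by (auto intro!: holomorphic_intros)
      show "\<rho> holomorphic_on A" unfolding \<rho>_def using K0 by (intro holomorphic_intros 1 2) auto
    qed
    define \<eta> where "\<eta> z = z / of_real (sqrt E) - of_real (cos \<theta>)" for z :: complex
    have zeta: "z / of_real (sqrt E) = of_real (cos \<theta>) + \<eta> z" for z by (simp add: \<eta>_def)
    have sEc: "complex_of_real (sqrt E) \<noteq> 0" "complex_of_real (sqrt E) * complex_of_real (sqrt E) = of_real E"
      using sE(2) E(1) by (simp_all flip: of_real_mult)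
    have eta: "\<eta> z = \<i> * of_real \<alpha> + (z - Z) / of_real (sqrt E)" for z
      unfolding \<eta>_def Z_def using sEc by (simp add: field_simps)
    \<comment> \<open>Both assumed equations enter here: the last diagonal entry has leading term \<open>0\<close> exactly at \<open>Z\<close>.\<close>
    have rho: "\<rho> z * cnj (leading_coeff_at \<theta> b a) = - (leading_coeff_at \<theta> a b * exp (w z))" for z
    proof -
      have x: "- (2 * \<i> * of_real (s * E) * \<eta> z) = of_real (2 * (s * E) * \<alpha>) + w z"
        unfolding eta w_def \<kappa>_def using sEc(1) by (simp add: sEc(2)[symmetric] field_simps)
      have "Km z * cnj (leading_coeff_at \<theta> b a) = (Kp z * leading_coeff_at \<theta> a b) *
        (((-1) ^ m * exp (- (2 * \<i> * of_real (E * f (cos \<theta>))))) *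
         of_real (fact b / fact a * (4 * E * s ^ 3) ^ a / (4 * E * s ^ 3) ^ b) * exp (- (2 * \<i> * of_real (s * E) * \<eta> z)))"
        unfolding Km_def Kp_def e_def N_def s_def zeta by (rule leading_ratio[OF \<theta> n E_def m])
      also have "\<dots> = (Kp z * leading_coeff_at \<theta> a b) * (-1 *
         of_real (fact b / fact a * (4 * E * s ^ 3) ^ a / (4 * E * s ^ 3) ^ b * exp (2 * (s * E) * \<alpha>)) * exp (w z))"
        unfolding x exp_add ph[folded E_def] exp_of_real of_real_mult[of "_ / _"] by (simp only: mult.assoc)
      also have "\<dots> = Kp z * (- (leading_coeff_at \<theta> a b * exp (w z)))"
        unfolding md[folded E_def s_def] by simp
      finally show ?thesis using K0 by (simp add: \<rho>_def field_simps)
    qed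
    have leading_coeff_at: "L \<le> cmod (leading_coeff_at \<theta> k l)" "cmod (leading_coeff_at \<theta> k l) \<le> U" if "k \<le> n" "l \<le> n" for k l
      using leading_coeff_at_bounds[OF \<theta> s0 s0s that] L by (simp_all add: L_def U_def)
    have lead0: "leading_coeff_at \<theta> k l \<noteq> 0" if "k \<le> n" "l \<le> n" for k l using leading_coeff_at(1)[OF that] L by auto
    have w_small: "cmod (w z) \<le> 1 / 8" if "cmod (z - Z) \<le> 2 * r" for z
    proof -
      have "cmod (w z) = \<kappa> * cmod (z - Z)" using s sE by (simp add: w_def norm_mult \<kappa>_def)
      also have "\<dots> \<le> (2 * 1 * sqrt E) * (2 * r)"
        unfolding \<kappa>_def using s sE(2) that r by (intro mult_mono) auto
      also have "\<dots> = 4 * E powr (-1/3)" using sr by simp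
      finally show ?thesis using E(4) by simp
    qed
    \<comment> \<open>Near \<open>Z\<close> both saddle points contribute with comparable size, so entries from either one count.\<close>
    have rho_bounds: "cmod (\<rho> z) \<le> P" "L / (3 * U) \<le> cmod (\<rho> z)" if "cmod (z - Z) \<le> 2 * r" for z
    proof -
      have "cmod (\<rho> z * cnj (leading_coeff_at \<theta> b a)) = cmod (leading_coeff_at \<theta> a b) * cmod (exp (w z))"
        unfolding rho by (simp add: norm_mult)
      then have eq: "cmod (\<rho> z) * cmod (leading_coeff_at \<theta> b a) = cmod (leading_coeff_at \<theta> a b) * cmod (exp (w z))"
        by (simp only: norm_mult complex_mod_cnj)
      have la: "L \<le> cmod (leading_coeff_at \<theta> a b)" "cmod (leading_coeff_at \<theta> a b) \<le> U" and lb: "L \<le> cmod (leading_coeff_at \<theta> b a)" "cmod (leading_coeff_at \<theta> b a) \<le> U"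
        using leading_coeff_at n by auto
      note ex = norm_exp_bounds[OF w_small[OF that]]
      have "cmod (\<rho> z) * L \<le> cmod (\<rho> z) * cmod (leading_coeff_at \<theta> b a)" using lb by (intro mult_left_mono) auto
      also have "\<dots> \<le> U * 3" unfolding eq using la ex L U by (intro mult_mono) auto
      finally show "cmod (\<rho> z) \<le> P" using L by (simp add: P_def field_simps)
      have "L * (1 / 3) \<le> cmod (leading_coeff_at \<theta> a b) * cmod (exp (w z))" using la ex L by (intro mult_mono) auto
      also have "\<dots> \<le> cmod (\<rho> z) * U" unfolding eq[symmetric] using lb by (intro mult_left_mono) auto
      finally show "L / (3 * U) \<le> cmod (\<rho> z)" using L U by (simp add: field_simps)
    qed
    \<comment> \<open>The limiting diagonal, divided by the upper saddle contribution \<open>Kp\<close>; only its last entry vanishes at \<open>Z\<close>.\<close>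
    define d where "d z x = (if x < a then leading_coeff_at \<theta> x b else if x < a + b then \<rho> z * cnj (leading_coeff_at \<theta> (x - a) a)
        else leading_coeff_at \<theta> a b * (1 - exp (w z)))" for z x
    define M where "M z = (\<Prod>x<a + b. d z x) * leading_coeff_at \<theta> a b" for z
    define T where "T z = (\<Prod>x<n. d z x)" for z
    have T_eq: "T z = M z * (1 - exp (w z))" for z by (simp add: T_def M_def n d_def)
    have d_low: "l0 \<le> cmod (d z x)" if "cmod (z - Z) \<le> 2 * r" "x < a + b" for z x
    proof (cases "x < a")
      case True
      then show ?thesis using leading_coeff_at(1)[of x b] n l0_le by (simp add: d_def)
    next
      case False
      have "(L / (3 * U)) * L \<le> cmod (\<rho> z) * cmod (leading_coeff_at \<theta> (x - a) a)"
        using rho_bounds[OF that(1)] leading_coeff_at(1)[of "x - a" a] n that(2) L U by (intro mult_mono) auto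
      then show ?thesis using False that(2) by (simp add: d_def norm_mult l0_def)
    qed
    have M_low: "l0 ^ (a + b) * L \<le> cmod (M z)" if "cmod (z - Z) \<le> 2 * r" for z
    proof -
      have "l0 ^ (a + b) \<le> (\<Prod>x<a + b. cmod (d z x))" using d_low[OF that] l0 by (intro prod_ge_power) auto
      then show ?thesis unfolding M_def norm_mult prod_norm[symmetric]
        using leading_coeff_at(1)[of a b] n L l0 by (intro mult_mono) (auto intro: prod_nonneg)
    qed
    have M0: "M z \<noteq> 0" if "cmod (z - Z) \<le> 2 * r" for z
    proof -
      have "0 < l0 ^ (a + b) * L" using l0 L by simp
      then show ?thesis using M_low[OF that] by auto
    qed
    have d_up: "cmod (d z x) \<le> R" if "cmod (z - Z) \<le> 2 * r" "x < n" for z x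
    proof -
      consider "x < a" | "\<not> x < a" "x < a + b" | "\<not> x < a" "\<not> x < a + b" by linarith
      then show ?thesis
      proof cases
        case 1
        have "0 \<le> P * U" using P U L by simp
        then show ?thesis using 1 leading_coeff_at(2)[of x b] n U L unfolding R_def d_def by auto
      next
        case 2
        have "cmod (d z x) \<le> P * U"
          using 2 rho_bounds(1)[OF that(1)] leading_coeff_at(2)[of "x - a" a] n P by (auto simp: d_def norm_mult intro!: mult_mono)
        then show ?thesis using U L unfolding R_def by linarith
      next
        case 3
        have "cmod (1 - exp (w z)) \<le> 1 + 3"
          using norm_triangle_ineq4[of 1 "exp (w z)"] norm_exp_bounds(1)[OF w_small[OF that(1)]] by simp
        then have "cmod (d z x) \<le> U * 4"
          using 3 leading_coeff_at(2)[of a b] n U L by (auto simp: d_def norm_mult intro!: mult_mono)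
        moreover have "0 \<le> P * U" using P U L by simp
        ultimately show ?thesis unfolding R_def by linarith
      qed
    qed
    define A where "A z x y = circle_functional E N (z / of_real (sqrt E)) (\<lambda>u. saddle_basis \<theta> e a b x u * saddle_basis \<theta> e a b y u) / Kp z" for z x y
    have entry: "cmod (A z x y - (if x = y then d z x else 0)) \<le> Ce * E powr (-5/12)"
      if z: "cmod (z - Z) = r" and x: "x < n" and y: "y < n" for z x y
    proof -
      have z2: "cmod (z - Z) \<le> 2 * r" using z r by simp
      have "E * cmod (\<eta> z) \<le> E * (\<bar>\<alpha>\<bar> + r / sqrt E)"
      proof (intro mult_left_mono)
        show "cmod (\<eta> z) \<le> \<bar>\<alpha>\<bar> + r / sqrt E"
          unfolding eta using norm_triangle_ineq[of "\<i> * of_real \<alpha>" "(z - Z) / of_real (sqrt E)"] z sE(2)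
          by (simp add: norm_mult norm_divide)
      qed (use E(1) in auto)
      also have "\<dots> = E * \<bar>\<alpha>\<bar> + E powr (-1/3)"
        unfolding sr[symmetric] using E(1) sE(2) by (simp add: field_simps)
      also have "\<dots> \<le> q" using al[folded E_def] E(4) by (simp add: q_def)
      finally have Eeta: "E * cmod (\<eta> z) \<le> q" .
      have sad: "saddle E \<theta> q \<beta> s0 (\<eta> z) N"
        using s0 s0s \<theta> q1 Eeta m by (simp add: saddle_def \<beta>_def N_def E_def field_simps)
      define D where "D = diagonal_gain \<theta> e a b x + \<rho> z * cnj (diagonal_gain \<theta> e b a (mirror a b x))"
      have xy: "x \<le> a + b" "y \<le> a + b" using x y n by auto
      define F where "F = circle_functional E N (z / of_real (sqrt E)) (\<lambda>u. saddle_basis \<theta> e a b x u * saddle_basis \<theta> e a b y u)"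
      have "cmod (F - (if x = y then Kp z * diagonal_gain \<theta> e a b x + Km z * cnj (diagonal_gain \<theta> e b a (mirror a b x)) else 0))
          \<le> Cg * (q / sqrt E) * (cmod (Kp z) + cmod (Km z))"
        unfolding F_def Kp_def Km_def zeta e_def by (rule Cg(2)[OF sad xy])
      moreover have "F - (if x = y then Kp z * diagonal_gain \<theta> e a b x + Km z * cnj (diagonal_gain \<theta> e b a (mirror a b x)) else 0)
          = Kp z * (A z x y - (if x = y then D else 0))"
        using K0(1)[of z] by (auto simp: A_def F_def D_def \<rho>_def field_simps)
      moreover have "cmod (Kp z) + cmod (Km z) = cmod (Kp z) * (1 + cmod (\<rho> z))"
        using K0(1)[of z] by (simp add: \<rho>_def norm_divide field_simps)
      ultimately have "cmod (Kp z) * cmod (A z x y - (if x = y then D else 0))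
          \<le> cmod (Kp z) * (Cg * (q / sqrt E) * (1 + cmod (\<rho> z)))"
        by (simp only: norm_mult) (simp only: mult_ac)
      then have AD: "cmod (A z x y - (if x = y then D else 0)) \<le> Cg * (q / sqrt E) * (1 + cmod (\<rho> z))"
        by (rule mult_left_le_imp_le) (use K0(1)[of z] in simp)
      have Dd: "cmod (D - d z x) \<le> (Ca + P * Cb) * e"
      proof -
        have nn: "0 \<le> (Ca + P * Cb) * e" using Ca(1) Cb(1) P e by simp
        consider "x < a" | "\<not> x < a" "x < a + b" | "x = a + b" using xy by linarith
        then show ?thesis
        proof cases
          case 1
          then have "D = d z x" by (simp add: D_def d_def diagonal_gain_cases mirror_def)
          then show ?thesis using nn by simp
        next
          case 2
          then have "D = d z x" by (simp add: D_def d_def diagonal_gain_cases mirror_def less_diff_conv2)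
          then show ?thesis using nn by simp
        next
          case 3
          have "d z x = leading_coeff_at \<theta> a b + \<rho> z * cnj (leading_coeff_at \<theta> b a)"
            unfolding rho using 3 by (simp add: d_def algebra_simps)
          then have "D - d z x = (diagonal_gain \<theta> e a b (a + b) - leading_coeff_at \<theta> a b) + \<rho> z * cnj (diagonal_gain \<theta> e b a (b + a) - leading_coeff_at \<theta> b a)"
            using 3 by (simp add: D_def mirror_def algebra_simps add.commute[of b a])
          also have "cmod \<dots> \<le> Ca * e + P * (Cb * e)"
          proof (rule norm_triangle_le[OF add_mono])
            show "cmod (diagonal_gain \<theta> e a b (a + b) - leading_coeff_at \<theta> a b) \<le> Ca * e" by (rule Ca(2)[OF \<theta> s0s e])
            show "cmod (\<rho> z * cnj (diagonal_gain \<theta> e b a (b + a) - leading_coeff_at \<theta> b a)) \<le> P * (Cb * e)"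
              unfolding norm_mult complex_mod_cnj using P by (intro mult_mono rho_bounds(1)[OF z2] Cb(2)[OF \<theta> s0s e]) auto
          qed
          finally show ?thesis by (simp add: algebra_simps)
        qed
      qed
      have eq: "e \<le> q / sqrt E" using q1 sE(2) by (simp add: e_def divide_right_mono)
      have "A z x y - (if x = y then d z x else 0) = (A z x y - (if x = y then D else 0)) + (if x = y then D - d z x else 0)"
        by simp
      also have "cmod \<dots> \<le> Cg * (q / sqrt E) * (1 + cmod (\<rho> z)) + (Ca + P * Cb) * e"
      proof (rule norm_triangle_le[OF add_mono[OF AD]])
        have "0 \<le> (Ca + P * Cb) * e" using Ca(1) Cb(1) P e by simp
        then show "cmod (if x = y then D - d z x else 0) \<le> (Ca + P * Cb) * e"
          using Dd by (cases "x = y") simp_all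
      qed
      also have "\<dots> \<le> Cg * (q / sqrt E) * (1 + P) + ((1 + P) * (Ca + Cb)) * (q / sqrt E)"
      proof (rule add_mono)
        have nn: "0 \<le> Cg * (q / sqrt E)" using Cg(1) q1 sE(2) by simp
        show "Cg * (q / sqrt E) * (1 + cmod (\<rho> z)) \<le> Cg * (q / sqrt E) * (1 + P)"
          by (rule mult_left_mono[OF _ nn]) (use rho_bounds(1)[OF z2] in simp)
        have "Ca + P * Cb \<le> (1 + P) * (Ca + Cb)" using Ca(1) Cb(1) P by (simp add: algebra_simps)
        then show "(Ca + P * Cb) * e \<le> ((1 + P) * (Ca + Cb)) * (q / sqrt E)"
          using eq e Ca(1) Cb(1) P by (intro mult_mono) auto
      qed
      also have "\<dots> = Ce * E powr (-5/12)" unfolding qe by (simp add: Ce_def algebra_simps)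
      finally show ?thesis .
    qed
    \<comment> \<open>The Gram determinant, divided by \<open>Kp z ^ n\<close>, is \<open>H m n\<close> times a function without zeros.\<close>
    have poly_ex: "\<exists>p. degree p \<le> a + b \<and> (\<forall>u. poly p u = saddle_basis \<theta> e a b x u)" if "x \<le> a + b" for x
      using polyfun_saddle_basis[OF that] unfolding polyfun_def .
    then obtain p where p: "\<And>x. x \<le> a + b \<Longrightarrow> degree (p x) \<le> a + b" "\<And>x u. x \<le> a + b \<Longrightarrow> poly (p x) u = saddle_basis \<theta> e a b x u"
      by (metis (no_types))
    define h where "h = sqrt E / 2"
    have h: "h > 0" "E = 4 * h\<^sup>2" "2 * h = sqrt E" using E(1) sE(2) by (simp_all add: h_def power_divide)
    obtain c where c: "c \<noteq> 0" "\<And>z \<zeta> b. z = 2 * of_real h * \<zeta> \<Longrightarrow> (\<And>i. i < n \<Longrightarrow> degree (b i) < n) \<Longrightarrow>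
      c * det_of n (\<lambda>i j. circle_functional E (m + n - 1) \<zeta> (\<lambda>u. poly (b i) u * poly (b j) u)) =
      (det_of n (\<lambda>i k. coeff (b i) k))\<^sup>2 * poly (H m n) z"
    proof (rule generalised_hermite_gram[OF H h(1,2), where m = m and n = n], goal_cases)
      case (1 c)
      show ?case by (rule 1(1)[OF 1(2,3)])
    qed
    define \<tau> where "\<tau> = det_of n (\<lambda>i k. coeff (p i) k)"
    define G where "G z = \<tau>\<^sup>2 * poly (H m n) z / (c * Kp z ^ n)" for z
    have GA: "G z = det_of n (A z)" for z :: complex
    proof -
      have "z = 2 * of_real h * (z / of_real (sqrt E))"
      proof -
        have "2 * complex_of_real h = of_real (sqrt E)" unfolding h(3)[symmetric] by simp
        then show ?thesis using sEc(1) by simp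
      qed
      then have "c * det_of n (\<lambda>i j. circle_functional E (m + n - 1) (z / of_real (sqrt E)) (\<lambda>u. poly (p i) u * poly (p j) u)) = \<tau>\<^sup>2 * poly (H m n) z"
        unfolding \<tau>_def by (rule c(2)) (use p(1) n in \<open>auto simp: less_Suc_eq_le\<close>)
      moreover have "det_of n (\<lambda>i j. circle_functional E (m + n - 1) (z / of_real (sqrt E)) (\<lambda>u. poly (p i) u * poly (p j) u)) =
          det_of n (\<lambda>i j. Kp z * A z i j * 1)"
      proof (rule det_of_cong)
        fix i j assume "i < n" "j < n"
        then have "i \<le> a + b" "j \<le> a + b" using n by auto
        then show "circle_functional E (m + n - 1) (z / of_real (sqrt E)) (\<lambda>u. poly (p i) u * poly (p j) u) = Kp z * A z i j * 1"
          using K0(1)[of z] by (simp add: A_def p(2) N_def)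
      qed
      ultimately have "c * (Kp z ^ n * det_of n (A z)) = \<tau>\<^sup>2 * poly (H m n) z"
        using det_of_scale[of n "\<lambda>_. Kp z" "A z" "\<lambda>_. 1"] by simp
      then show ?thesis using c(1) K0(1)[of z] by (simp add: G_def field_simps)
    qed
    \<comment> \<open>The error has exponent \<open>-5/12\<close> and the main term \<open>-1/3 = -4/12\<close>.\<close>
    have close: "cmod (G z - T z) < cmod (T z)" if z: "cmod (z - Z) = r" for z
    proof -
      have z2: "cmod (z - Z) \<le> 2 * r" using z r by simp
      have "cmod (det_of n (A z) - (\<Prod>x<n. d z x)) \<le> fact n * (real n * (R + 1) ^ n) * (Ce * E powr (-5/12))"
        by (rule det_of_near_diagonal[OF R _ _ d_up[OF z2] entry[OF z]]) (use Ce E(2) in auto)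
      also have "\<dots> = (Wc * E powr (-1/12)) * E powr (-1/3)"
        unfolding Wc_def mult.assoc powr_add[symmetric] by simp
      also have "\<dots> < l1 * E powr (-1/3)" using E(1,3) by (intro mult_strict_right_mono) auto
      also have "\<dots> = (l0 ^ (a + b) * L) * (s0 * E powr (-1/3))" by (simp add: l1_def)
      also have "\<dots> \<le> cmod (M z) * cmod (1 - exp (w z))"
      proof (intro mult_mono M_low[OF z2])
        have "s0 * E powr (-1/3) \<le> s * (sqrt E * r)" unfolding sr using s by (intro mult_right_mono) auto
        also have "\<dots> = cmod (w z) / 2" using z s sE by (simp add: w_def norm_mult \<kappa>_def)
        also have "\<dots> \<le> cmod (1 - exp (w z))" by (rule one_minus_exp_ge[OF w_small[OF z2]])
        finally show "s0 * E powr (-1/3) \<le> cmod (1 - exp (w z))" .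
      qed (use s0 in auto)
      finally show ?thesis unfolding GA T_eq[symmetric] norm_mult[symmetric] unfolding T_def .
    qed
    \<comment> \<open>The basis is linearly independent since its Gram determinant is nonzero on the boundary circle.\<close>
    have \<tau>0: "\<tau> \<noteq> 0"
    proof
      assume "\<tau> = 0"
      then have "G (Z + of_real r) = 0" by (simp add: G_def)
      moreover have "cmod ((Z + of_real r) - Z) = r" using r by simp
      ultimately show False using close[of "Z + of_real r"] by simp
    qed
    have G0: "G z = 0 \<longleftrightarrow> poly (H m n) z = 0" for z
      using \<tau>0 c(1) K0(1)[of z] by (simp add: G_def)
    have M_hol: "M holomorphic_on A" for A
    proof -
      have "(\<lambda>z. d z x) holomorphic_on A" for x
        unfolding d_def by (cases "x < a"; cases "x < a + b") (auto intro!: holomorphic_intros hol)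
      then show ?thesis unfolding M_def by (intro holomorphic_intros)
    qed
    have wZ: "w Z = 0" by (simp add: w_def)
    have "\<exists>!z. G z = 0 \<and> cmod (z - Z) \<le> r"
    proof (rule rouche_simple_zero[where R = "2 * r" and T = T])
      show "0 < r" "r < 2 * r" using r by auto
      show "G holomorphic_on ball Z (2 * r)"
        unfolding G_def using c(1) K0(1) by (intro holomorphic_intros hol) auto
      show "finite {z \<in> ball Z (2 * r). G z = 0}"
        unfolding G0 by (rule finite_subset[OF _ poly_roots_finite[OF generalised_hermite_nonzero[OF H, of m n]]]) auto
      show "T holomorphic_on ball Z (2 * r)"
        unfolding T_eq[abs_def] by (intro holomorphic_intros M_hol hol)
      show "T z = 0 \<longleftrightarrow> z = Z" if "z \<in> ball Z (2 * r)" for z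
      proof -
        have z: "cmod (z - Z) \<le> 2 * r" using that by (simp add: dist_norm norm_minus_commute)
        have "1 - exp (w z) = 0 \<longleftrightarrow> w z = 0"
          using one_minus_exp_ge[OF w_small[OF z]] by auto
        moreover have "w z = 0 \<longleftrightarrow> z = Z" using s sE(2) by (simp add: w_def \<kappa>_def)
        ultimately show ?thesis using M0[OF z] by (simp add: T_eq)
      qed
      show "deriv T Z \<noteq> 0"
      proof -
        define M' where "M' = deriv M Z"
        have M': "(M has_field_derivative M') (at Z)"
          unfolding M'_def by (rule holomorphic_derivI[OF M_hol open_UNIV UNIV_I])
        have w': "(w has_field_derivative - (\<i> * of_real \<kappa>)) (at Z)"
          unfolding w_def by (rule derivative_eq_intros | simp)+
        have "(T has_field_derivative M' * (1 - exp (w Z)) + (0 - exp (w Z) * (- (\<i> * of_real \<kappa>))) * M Z) (at Z)"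
          unfolding T_eq[abs_def]
          by (rule DERIV_mult[OF M' DERIV_diff[OF DERIV_const DERIV_chain2[OF DERIV_exp w']]])
        then have "deriv T Z = \<i> * of_real \<kappa> * M Z"
          by (simp add: DERIV_imp_deriv wZ)
        then show ?thesis using M0[of Z] r s sE(2) by (simp add: \<kappa>_def)
      qed
    qed (rule close)
    then show "\<exists>!z. poly (H m n) z = 0 \<and>
      cmod (z - of_real (sqrt (real (2 * m + n))) * (of_real (cos \<theta>) + \<i> * of_real \<alpha>)) \<le> real (2 * m + n) powr (-5/6)"
      unfolding G0 r_def Z_def E_def .
  qed
qed

section \<open>The quantisation condition\<close>

text \<open>The function \<open>f\<close> in the angle variable; its derivative is \<open>- sin\<^sup>2 \<theta>\<close>.\<close>
definition phase_fun :: "real \<Rightarrow> real" where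
  "phase_fun \<theta> = sin (2 * \<theta>) / 4 - \<theta> / 2 + pi / 4"

lemma f_cos_eq: "0 \<le> \<theta> \<Longrightarrow> \<theta> \<le> pi \<Longrightarrow> f (cos \<theta>) = phase_fun \<theta>"
  unfolding phase_fun_def sin_double by (simp add: f_cos field_simps)

lemma phase_fun_decreasing:
  assumes "0 \<le> s" "s < t" "t \<le> pi"
  shows "phase_fun t < phase_fun s"
proof (rule DERIV_neg_imp_decreasing_open[OF assms(2)])
  fix x assume x: "s < x" "x < t"
  then have "sin x > 0" using assms by (intro sin_gt_zero) auto
  then have "(cos x)\<^sup>2 < 1" using sin_cos_squared_add[of x] zero_less_power[of "sin x" 2] by linarith
  then have "cos (2 * x) < 1" by (simp add: cos_double_cos)
  moreover have "(phase_fun has_real_derivative (cos (2 * x) / 2 - 1 / 2)) (at x)"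
    unfolding phase_fun_def[abs_def] by (auto intro!: derivative_eq_intros)
  ultimately show "\<exists>y. (phase_fun has_real_derivative y) (at x) \<and> y < 0"
    by (intro exI[of _ "cos (2 * x) / 2 - 1 / 2"]) simp
next
  show "continuous_on {s..t} phase_fun" unfolding phase_fun_def[abs_def] by (intro continuous_intros) auto
qed

lemma phase_fun_solution:
  assumes "\<bar>y\<bar> < pi / 4"
  obtains \<theta> where "0 < \<theta>" "\<theta> < pi" "phase_fun \<theta> = y"
proof -
  have e: "phase_fun 0 = pi / 4" "phase_fun pi = - (pi / 4)" by (simp_all add: phase_fun_def)
  have "continuous_on {0..pi} phase_fun" unfolding phase_fun_def[abs_def] by (intro continuous_intros) auto
  moreover have y: "phase_fun pi < y" "y < phase_fun 0" unfolding e using assms by linarith+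
  ultimately obtain \<theta> where \<theta>: "0 \<le> \<theta>" "\<theta> \<le> pi" "phase_fun \<theta> = y"
    using IVT2'[of phase_fun pi y 0] by auto
  moreover have "\<theta> \<noteq> 0" "\<theta> \<noteq> pi" using y \<theta>(3) by auto
  ultimately show ?thesis by (intro that[of \<theta>]) auto
qed

lemma phase_fun_inj:
  assumes "0 \<le> s" "s \<le> pi" "0 \<le> t" "t \<le> pi" "phase_fun s = phase_fun t"
  shows "s = t"
  using phase_fun_decreasing[of s t] phase_fun_decreasing[of t s] assms by (cases s t rule: linorder_cases) auto

text \<open>The sine is unimodal on \<open>[0, \<pi>]\<close>, so bounding \<open>\<theta>\<close> away from the ends bounds \<open>sin \<theta>\<close> from below.\<close>
lemma sin_ge_min:
  assumes "0 \<le> s" "s \<le> x" "x \<le> t" "t \<le> pi"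
  shows "min (sin s) (sin t) \<le> sin x"
proof (cases "x \<le> pi / 2")
  case True
  have "sin s \<le> sin x" using assms True by (intro sin_monotone_2pi_le) auto
  then show ?thesis by simp
next
  case False
  have "sin (pi - t) \<le> sin (pi - x)" using assms False by (intro sin_monotone_2pi_le) auto
  then show ?thesis by simp
qed

lemma alpha_eq:
  assumes \<theta>: "0 < \<theta>" "\<theta> < pi" and k: "phase_fun \<theta> = pi * k / E"
  shows "alpha n E j k = of_real (cos \<theta>) + \<i> * of_real (g n j E (cos \<theta>))"
  unfolding alpha_def
proof (rule the_equality)
  have "cos \<theta> < cos 0" "cos pi < cos \<theta>" using cos_monotone_0_pi[of 0 \<theta>] cos_monotone_0_pi[of \<theta> pi] \<theta> by simp_all
  then show "f (Re (of_real (cos \<theta>) + \<i> * of_real (g n j E (cos \<theta>)))) = pi * k / E \<and>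
    Re (of_real (cos \<theta>) + \<i> * of_real (g n j E (cos \<theta>))) \<in> {-1<..<1} \<and>
    Im (of_real (cos \<theta>) + \<i> * of_real (g n j E (cos \<theta>))) =
      g n j E (Re (of_real (cos \<theta>) + \<i> * of_real (g n j E (cos \<theta>))))"
    using f_cos_eq[of \<theta>] \<theta> k by simp
  fix z assume z: "f (Re z) = pi * k / E \<and> Re z \<in> {-1<..<1} \<and> Im z = g n j E (Re z)"
  define t where "t = arccos (Re z)"
  have t: "0 \<le> t" "t \<le> pi" "cos t = Re z" 
    using arccos_lbound[of "Re z"] arccos_ubound[of "Re z"] cos_arccos[of "Re z"] z by (simp_all add: t_def)
  have "phase_fun t = f (cos t)" by (rule f_cos_eq[symmetric, OF t(1,2)])
  also have "\<dots> = phase_fun \<theta>" using z unfolding t(3) k by simp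
  finally have "t = \<theta>" by (rule phase_fun_inj[rotated 4]) (use t \<theta> in simp_all)
  then have "Re z = cos \<theta>" using t by simp
  then show "z = of_real (cos \<theta>) + \<i> * of_real (g n j E (cos \<theta>))" using z by (simp add: complex_eq_iff)
qed

text \<open>With \<open>j = b - a\<close> the Gamma quotient is \<open>b! / a!\<close>, and the formula says that \<open>g\<close> solves the modulus
  equation of \<open>one_zero_in_disc\<close>.\<close>
lemma g_cos:
  assumes \<theta>: "0 < \<theta>" "\<theta> < pi" and E: "E > 0" and n: "n = a + b + 1" and j: "j = int b - int a"
  shows "2 * (sin \<theta> * E) * g n j E (cos \<theta>) =
    (real b - real a) * ln (4 * E * sin \<theta> ^ 3) - ln (fact b / fact a)"
proof -
  define s where "s = sin \<theta>"
  have s: "s > 0" using \<theta> by (simp add: s_def sin_gt_zero)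
  have c: "1 - (cos \<theta>)\<^sup>2 = s\<^sup>2" using sin_cos_squared_add[of \<theta>] unfolding s_def by linarith
  have "s\<^sup>2 powr (3 / 4) = s powr (3 / 2)" using s by (simp add: powr_powr flip: powr_numeral)
  moreover have "ln (2 * sqrt E * s powr (3 / 2)) = ln (4 * E * s ^ 3) / 2"
  proof -
    have "ln (2 * sqrt E * s powr (3 / 2)) = ln 2 + ln E / 2 + 3 / 2 * ln s"
      using s E by (simp add: ln_mult ln_sqrt ln_powr)
    moreover have "ln (4 * E * s ^ 3) = ln 4 + ln E + 3 * ln s"
      using s E by (simp add: ln_mult ln_realpow)
    moreover have "ln (4 :: real) = 2 * ln 2" using ln_realpow[of 2 2] by simp
    ultimately show ?thesis by simp
  qed
  moreover have "F n j = fact b / fact a"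
  proof -
    have "(1 + real n + of_int j) / 2 = 1 + real b" "(1 + real n - of_int j) / 2 = 1 + real a"
      by (simp_all add: n j)
    then show ?thesis unfolding F_def by (simp only: Gamma_fact)
  qed
  moreover have "sqrt (s\<^sup>2) = s" using s by simp
  ultimately have "g n j E (cos \<theta>) = (2 * of_int j * (ln (4 * E * s ^ 3) / 2) - ln (fact b / fact a)) / (2 * E * s)"
    unfolding g_def c by simp
  then show ?thesis using s E unfolding s_def[symmetric] by (simp add: j field_simps)
qed

theorem theorem1p2:
  fixes H :: "nat \<Rightarrow> nat \<Rightarrow> complex poly" and n :: nat and \<sigma> :: real
  assumes "generalised_hermite H"
    and "n \<ge> 1"
    and "0 < \<sigma>" and "\<sigma> < 1/4"
  shows "\<exists>E\<^sub>0 C\<^sub>\<sigma> :: real. \<forall>m::nat. m \<ge> 1 \<longrightarrow>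
           (let E = real (2 * m + n) in
              E \<ge> E\<^sub>0 \<longrightarrow>
              (\<forall>j\<in>J n. \<forall>k\<in>K m. \<bar>k\<bar> \<le> \<sigma> * E \<longrightarrow>
                 (\<exists>!z::complex. poly (H m n) z = 0 \<and>
                    cmod (z - complex_of_real (sqrt E) * alpha n E j k) \<le> C\<^sub>\<sigma> * E powr (-5/6))))"
proof -
  have \<sigma>4: "\<bar>pi * \<sigma>\<bar> < pi / 4" "\<bar>- (pi * \<sigma>)\<bar> < pi / 4" using assms by simp_all
  \<comment> \<open>The angles of all \<open>k\<close> in question lie between those of the extreme values \<open>\<plusminus>\<sigma> E\<close>.\<close>
  obtain \<theta>1 where \<theta>1: "0 < \<theta>1" "\<theta>1 < pi" "phase_fun \<theta>1 = pi * \<sigma>" by (rule phase_fun_solution[OF \<sigma>4(1)])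
  obtain \<theta>2 where \<theta>2: "0 < \<theta>2" "\<theta>2 < pi" "phase_fun \<theta>2 = - (pi * \<sigma>)" by (rule phase_fun_solution[OF \<sigma>4(2)])
  define s0 where "s0 = min (sin \<theta>1) (sin \<theta>2)"
  have s0: "s0 > 0" using \<theta>1 \<theta>2 by (simp add: s0_def sin_gt_zero)
  define good where "good i E0 \<longleftrightarrow> (\<forall>m \<theta> \<alpha>. m \<ge> 1 \<longrightarrow> real (2 * m + n) \<ge> E0 \<longrightarrow> 0 < \<theta> \<longrightarrow> \<theta> < pi \<longrightarrow> s0 \<le> sin \<theta> \<longrightarrow>
    real (2 * m + n) * \<bar>\<alpha>\<bar> \<le> real (2 * m + n) powr (1 / 12) - 1 \<longrightarrow>
    (-1) ^ m * exp (- (2 * \<i> * of_real (real (2 * m + n) * f (cos \<theta>)))) = -1 \<longrightarrow>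
    fact i / fact (n - 1 - i) * (4 * real (2 * m + n) * sin \<theta> ^ 3) ^ (n - 1 - i) / (4 * real (2 * m + n) * sin \<theta> ^ 3) ^ i *
      exp (2 * (sin \<theta> * real (2 * m + n)) * \<alpha>) = 1 \<longrightarrow>
    (\<exists>!z. poly (H m n) z = 0 \<and>
      cmod (z - of_real (sqrt (real (2 * m + n))) * (of_real (cos \<theta>) + \<i> * of_real \<alpha>)) \<le> real (2 * m + n) powr (-5/6)))"
    for i E0
  have "\<exists>E0. i < n \<longrightarrow> good i E0" for i
  proof (cases "i < n")
    case True
    then have "n = (n - 1 - i) + i + 1" by simp
    from one_zero_in_disc[OF assms(1) s0 this] have "\<exists>E0. good i E0" unfolding good_def .
    then show ?thesis by blast
  qed simp
  then have "\<forall>i. \<exists>E0. i < n \<longrightarrow> good i E0" by blast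
  from choice[OF this] obtain Ei where Ei: "\<And>i. i < n \<Longrightarrow> good i (Ei i)" by blast
  \<comment> \<open>The bound \<open>c1 ln E + c2\<close> for \<open>E \<bar>g\<bar>\<close> comes from \<open>g_cos\<close>.\<close>
  define c1 where "c1 = real n / (2 * s0)"
  define c2 where "c2 = (real n * (ln 4 + 3 * \<bar>ln s0\<bar>) + ln (fact n)) / (2 * s0)"
  have "((\<lambda>E :: real. c1 * (ln E / E powr (1 / 12)) + (c2 + 1) * (1 / E powr (1 / 12))) \<longlongrightarrow> c1 * 0 + (c2 + 1) * 0) at_top"
    by (intro tendsto_intros) real_asymp+
  then have "\<forall>\<^sub>F E in at_top. c1 * (ln E / E powr (1 / 12)) + (c2 + 1) * (1 / E powr (1 / 12)) < 1"
    by (intro order_tendstoD(2)[where y = "c1 * 0 + (c2 + 1) * 0"]) auto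
  then have "\<forall>\<^sub>F E in at_top. 1 \<le> E \<and> c1 * ln E + c2 \<le> E powr (1 / 12) - 1"
    using eventually_ge_at_top[of 1]
  proof eventually_elim
    case (elim E)
    have p: "E powr (1 / 12) > 0" using elim by simp
    have "(c1 * ln E + (c2 + 1)) / E powr (1 / 12) < 1" using elim by (simp add: add_divide_distrib)
    then have "c1 * ln E + (c2 + 1) < E powr (1 / 12)" using p by (simp add: divide_less_eq)
    then show ?case using elim by simp
  qed
  then obtain E1 where E1: "\<And>E. E \<ge> E1 \<Longrightarrow> 1 \<le> E \<and> c1 * ln E + c2 \<le> E powr (1 / 12) - 1"
    unfolding eventually_at_top_linorder by blast
  \<comment> \<open>One threshold for the finitely many \<open>j\<close>.\<close>
  define E0 where "E0 = max E1 (\<Sum>i<n. \<bar>Ei i\<bar>)"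
  have main: "\<exists>!z. poly (H m n) z = 0 \<and>
      cmod (z - complex_of_real (sqrt (real (2 * m + n))) * alpha n (real (2 * m + n)) j k) \<le> 1 * real (2 * m + n) powr (-5/6)"
    if m: "m \<ge> 1" and EE: "real (2 * m + n) \<ge> E0" and j: "j \<in> J n" and k: "k \<in> K m" and k\<sigma>: "\<bar>k\<bar> \<le> \<sigma> * real (2 * m + n)"
    for m :: nat and j :: int and k :: real
  proof -
    define E where "E = real (2 * m + n)"
    obtain i where i: "i < n" "j = 2 * int i - int n + 1" using j by (auto simp: J_def)
    define a where "a = n - 1 - i"
    have n: "n = a + i + 1" and ja: "j = int i - int a" using i by (auto simp: a_def)
    have E: "1 \<le> E" "c1 * ln E + c2 \<le> E powr (1 / 12) - 1"
      using E1[of E] EE by (simp_all add: E0_def E_def)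
    have "\<bar>Ei i\<bar> \<le> (\<Sum>i<n. \<bar>Ei i\<bar>)" by (rule member_le_sum) (use i in auto)
    moreover have "(\<Sum>i<n. \<bar>Ei i\<bar>) \<le> real (2 * m + n)" using EE by (simp only: E0_def max.bounded_iff)
    ultimately have EiE: "Ei i \<le> real (2 * m + n)" using abs_ge_self[of "Ei i"] by linarith
    define y where "y = pi * k / E"
    have y: "\<bar>y\<bar> \<le> pi * \<sigma>"
    proof -
      have "\<bar>y\<bar> = pi * (\<bar>k\<bar> / E)" using E by (simp add: y_def abs_mult)
      also have "\<dots> \<le> pi * \<sigma>" using k\<sigma>[folded E_def] E by (intro mult_left_mono) (simp_all add: divide_le_eq)
      finally show ?thesis .
    qed
    then have "\<bar>y\<bar> < pi / 4" using \<sigma>4 by linarith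
    then obtain \<theta> where \<theta>: "0 < \<theta>" "\<theta> < pi" "phase_fun \<theta> = y" by (rule phase_fun_solution)
    have "\<not> \<theta> < \<theta>1"
    proof
      assume "\<theta> < \<theta>1"
      then have "phase_fun \<theta>1 < phase_fun \<theta>" using \<theta> \<theta>1 by (intro phase_fun_decreasing) auto
      then show False using y \<theta>(3) \<theta>1(3) by linarith
    qed
    moreover have "\<not> \<theta>2 < \<theta>"
    proof
      assume "\<theta>2 < \<theta>"
      then have "phase_fun \<theta> < phase_fun \<theta>2" using \<theta> \<theta>2 by (intro phase_fun_decreasing) auto
      then show False using y \<theta>(3) \<theta>2(3) by linarith
    qed
    ultimately have s: "s0 \<le> sin \<theta>" unfolding s0_def using \<theta>1 \<theta>2 by (intro sin_ge_min) auto
    define s where "s = sin \<theta>"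
    have ss: "0 < s" "s0 \<le> s" "s \<le> 1" using s s0 by (simp_all add: s_def)
    define Q where "Q = 4 * E * s ^ 3"
    have Q: "Q > 0" using E ss by (simp add: Q_def)
    define \<alpha> where "\<alpha> = g n j E (cos \<theta>)"
    have g: "2 * (s * E) * \<alpha> = (real i - real a) * ln Q - ln (fact i / fact a)"
      unfolding s_def Q_def \<alpha>_def using E by (intro g_cos \<theta> n ja) auto
    have al: "E * \<bar>\<alpha>\<bar> \<le> E powr (1 / 12) - 1"
    proof -
      have "2 * s * (E * \<bar>\<alpha>\<bar>) = \<bar>2 * (s * E) * \<alpha>\<bar>" using ss E by (simp add: abs_mult)
      also have "\<dots> \<le> \<bar>real i - real a\<bar> * \<bar>ln Q\<bar> + \<bar>ln (fact i / fact a)\<bar>"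
        unfolding g by (rule order_trans[OF abs_triangle_ineq4]) (simp add: abs_mult)
      also have "\<dots> \<le> real n * (ln E + (ln 4 + 3 * \<bar>ln s0\<bar>)) + ln (fact n)"
      proof (intro add_mono mult_mono)
        show "\<bar>real i - real a\<bar> \<le> real n" using n by auto
        have "ln Q = ln 4 + ln E + 3 * ln s" using ss E by (simp add: Q_def ln_mult ln_realpow)
        moreover have "\<bar>ln s\<bar> \<le> \<bar>ln s0\<bar>"
        proof -
          have "ln s0 \<le> ln s" "ln s \<le> 0" using ss s0 by auto
          then show ?thesis by linarith
        qed
        moreover have "0 \<le> ln E" "0 \<le> ln (4 :: real)" using E by auto
        ultimately show "\<bar>ln Q\<bar> \<le> ln E + (ln 4 + 3 * \<bar>ln s0\<bar>)" by linarith
        have f1: "0 \<le> ln (fact x :: real)" "x \<le> n \<Longrightarrow> ln (fact x :: real) \<le> ln (fact n)" for x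
          by (simp_all add: fact_ge_1 fact_mono)
        have "ln (fact i / fact a :: real) = ln (fact i) - ln (fact a)" by (simp add: ln_div)
        then show "\<bar>ln (fact i / fact a :: real)\<bar> \<le> ln (fact n)"
          using f1(1)[of i] f1(1)[of a] f1(2)[of i] f1(2)[of a] n by linarith
      qed (use E in auto)
      finally have "2 * s * (E * \<bar>\<alpha>\<bar>) \<le> real n * (ln E + (ln 4 + 3 * \<bar>ln s0\<bar>)) + ln (fact n)" .
      moreover have "2 * s0 * (E * \<bar>\<alpha>\<bar>) \<le> 2 * s * (E * \<bar>\<alpha>\<bar>)" using ss E by (intro mult_right_mono) auto
      ultimately have "2 * s0 * (E * \<bar>\<alpha>\<bar>) \<le> real n * (ln E + (ln 4 + 3 * \<bar>ln s0\<bar>)) + ln (fact n)" by linarith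
      then have "E * \<bar>\<alpha>\<bar> \<le> (real n * (ln E + (ln 4 + 3 * \<bar>ln s0\<bar>)) + ln (fact n)) / (2 * s0)"
        using s0 by (simp add: pos_le_divide_eq mult_ac)
      also have "\<dots> = c1 * ln E + c2" by (simp add: c1_def c2_def add_divide_distrib distrib_left)
      finally show ?thesis using E by linarith
    qed
    have md: "fact i / fact a * Q ^ a / Q ^ i * exp (2 * (s * E) * \<alpha>) = 1"
    proof -
      have "exp ((real i - real a) * ln Q) = Q powr (real i - real a)" using Q by (simp add: powr_def)
      also have "\<dots> = Q ^ i / Q ^ a" using Q by (simp add: powr_diff powr_realpow)
      finally have "exp (2 * (s * E) * \<alpha>) = Q ^ i / Q ^ a / (fact i / fact a)"
        unfolding g exp_diff by simp
      then show ?thesis using Q by simp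
    qed
    have ph: "(-1) ^ m * exp (- (2 * \<i> * of_real (E * f (cos \<theta>)))) = -1"
    proof -
      have "E * f (cos \<theta>) = pi * k" using \<theta> E by (simp add: f_cos_eq y_def)
      then have ex: "exp (- (2 * \<i> * of_real (E * f (cos \<theta>)))) = cis (2 * pi * (- k))"
        by (simp add: cis_conv_exp mult_ac)
      \<comment> \<open>The parity rule for \<open>k\<close> compensates the sign \<open>(-1)\<^sup>m\<close>.\<close>
      show ?thesis
      proof (cases "odd m")
        case True
        then have "- k \<in> \<int>" using k by (simp add: K_def)
        then have "cis (2 * pi * (- k)) = 1" by (rule cis_multiple_2pi)
        then show ?thesis unfolding ex using True by simp
      next
        case False
        then have "- (k - 1 / 2) \<in> \<int>" using k by (simp add: K_def del: minus_diff_eq)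
        then have "cis (2 * pi * (- (k - 1 / 2))) = 1" by (rule cis_multiple_2pi)
        moreover have "cis (2 * pi * (- k)) = cis (2 * pi * (- (k - 1 / 2))) * cis (- pi)"
          unfolding cis_mult by (rule arg_cong[where f = cis]) (simp add: algebra_simps)
        moreover have "cis (- pi) = -1" by (simp add: complex_eq_iff)
        ultimately show ?thesis unfolding ex using False by simp
      qed
    qed
    have "\<exists>!z. poly (H m n) z = 0 \<and>
      cmod (z - of_real (sqrt (real (2 * m + n))) * (of_real (cos \<theta>) + \<i> * of_real \<alpha>)) \<le> real (2 * m + n) powr (-5/6)"
      by (rule Ei[OF i(1), unfolded good_def, rule_format,
            OF m EiE \<theta>(1,2) s al[unfolded E_def] ph[unfolded E_def] md[unfolded a_def Q_def s_def E_def]])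
    moreover have "alpha n (real (2 * m + n)) j k = of_real (cos \<theta>) + \<i> * of_real \<alpha>"
      using alpha_eq[OF \<theta>(1,2), of k E n j] \<theta>(3) unfolding y_def \<alpha>_def E_def by simp
    ultimately show ?thesis by simp
  qed
  show ?thesis
    by (intro exI[of _ E0] exI[of _ 1]) (unfold Let_def, intro allI impI ballI main)
qed

end
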